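(* Let $X$ be one of the types $B_n$, $C_n$, $D_n$, let $\mathcal{B}$, $\mathcal{M}$ be the braiding and fusion matrices of the fundamental representation of the simple Lie algebra of type $X$ (written out in the context), and let $\langle K\rangle$ be the corresponding state sum (vacuum expectation) of an unoriented link diagram $K$. Then $\langle K\rangle$ is the Kauffman polynomial: for every unoriented link diagram $K$, $$\langle K\rangle = D_K(z,\alpha),$$ where $$(\alpha,z)=\begin{cases}\left(q^{n},\ q^{1/2}-q^{-1/2}\right), & X=B_n,\\ \left(-q^{\frac{2n+1}{4}},\ q^{1/4}-q^{-1/4}\right), & X=C_n,\\ \left(q^{\frac{2n-1}{2}},\ q^{1/2}-q^{-1/2}\right), & X=D_n.\end{cases}$$
   Context: **Parameter.** Let $K_0=\mathbb{C}(t)$ with $t$ an indeterminate, $q=t^4$, $q^{k/4}=t^k$ for $k\in\mathbb{Z}$, and $i=\sqrt{-1}$. **Index sets.** $I=\{0,1,\dots,N\}$ with $N=2n$ for $B_n$ ($n\ge1$), $N=2n-1$ for $C_n$ ($n\ge 1$), $N=2n-1$ for $D_n$ ($n\ge2$). (For $D_n$ the index is the position of the weight in the ordered list $0,1,\dots,n-1,(n-1)',n,\dots,2n-2$.) Two indices $a,c$ are complementary if $a+c=N$. $\mathcal{B}$ acts on the $K_0$-space with basis $\mathcal{J}_{a,c}$ $(a,c\in I)$, with entries defined by $\mathcal{B}\mathcal{J}_{a,c}=\sum_{b,d}\mathcal{B}_{ac}^{bd}\mathcal{J}_{b,d}$. **Braiding matrix.** Put $\gamma=q^{-1/2}$ for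 $B_n$ and $D_n$, $\gamma=q^{-1/4}$ for $C_n$. If $a+c\neq N$: $\mathcal{B}\mathcal{J}_{a,c}=\gamma\mathcal{J}_{a,a}$ if $a=c$; $=\mathcal{J}_{c,a}$ if $a>c$; $=\mathcal{J}_{c,a}+(\gamma-\gamma^{-1})\mathcal{J}_{a,c}$ if $a<c$. If $c=N-a$: $$\mathcal{B}\mathcal{J}_{a,N-a}=\epsilon_a\mathcal{J}_{N-a,a}+\sum_{b=a+1}^{N}\beta_{a,N-a}^{N-b,b}\,\mathcal{J}_{N-b,b},$$ where $\epsilon_a=1$ if $a=N-a$ and $\epsilon_a=\gamma^{-1}$ otherwise, and for $a<b$ (with $\delta$ the Kronecker delta): - $B_n$: $\beta_{a,2n-a}^{2n-b,b}=(q^{1/2}-q^{-1/2})q^{-\frac12(a-b)}$ if $(a-n)(b-n)>0$; $(q^{1/2}-q^{-1/2})q^{-\frac12(a-b+\frac12)}$ if $(a-n)(b-n)=0$; $(q^{1/2}-q^{-1/2})q^{-\frac12(a-b+1)}+\delta_{a,2n-b}(q^{-1/2}-q^{1/2})$ if $(a-n)(b-n)<0$. - $C_n$: $\beta_{a,2n-1-a}^{2n-1-b,b}=(q^{1/4}-q^{-1/4})q^{-\frac14(a-b)}$ if $(a-n+\frac12)(b-n+\frac12)>0$; $(q^{-1/4}-q^{1/4})q^{-\frac14(a-b-1)}+\delta_{a,2n-1-b}(q^{-1/4}-q^{1/4})$ if $(a-n+\frac12)(b-n+\frac12)<0$. - $D_n$: $\beta_{a,2n-1-a}^{2n-1-b,b}=(q^{1/2}-q^{-1/2})q^{-\frac12(a-b)}$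 if $(a-n+\frac12)(b-n+\frac12)>0$; $(q^{1/2}-q^{-1/2})q^{-\frac12(a-b+1)}+\delta_{a,2n-1-b}(q^{-1/2}-q^{1/2})$ if $(a-n+\frac12)(b-n+\frac12)<0$. **Fusion matrix.** $\mathcal{M}_{ac}=0$ unless $a+c=N$, and $\mathcal{M}_{a,N-a}=\zeta_a$ where - $B_n$: $\zeta_a=q^{\frac12(n-a-\frac12)}$ for $a<n$, $\zeta_n=1$, $\zeta_a=q^{\frac12(n-a+\frac12)}$ for $a>n$; - $C_n$: $\zeta_a=-i\,q^{\frac{n-a}{4}}$ for $a\le n-1$, $\zeta_a=i\,q^{\frac{n-1-a}{4}}$ for $a\ge n$; - $D_n$: $\zeta_a=q^{\frac{n-1-a}{2}}$ for $a\le n-1$, $\zeta_a=q^{\frac{n-a}{2}}$ for $a\ge n$. $\mathcal{M}^{ac}$ denotes the entries of the inverse matrix of $(\mathcal{M}_{ac})$ (here $\mathcal{M}^{ac}=\mathcal{M}_{ac}$). **State sum.** Put an unoriented link diagram $K$ in general position with respect to a height function so that it is composed of vertical strands, creations (local extrema where two strands are born), annihilations (local extrema where two strands merge) and two-strand crossings. Label each arc between these elementary pieces by an element of $I$. Assign $\mathcal{M}^{ab}$ to a creation of strands labelled $a,b$ (left to right), $\mathcal{M}_{ab}$ to an annihilation, $\delta_a^b$ to a vertical strand, and $\mathcal{B}_{ac}^{bd}$ or $(\mathcal{B}^{-1})_{ac}^{bd}$ to a crossing with incoming labels $a,c$ (on the creation side) and outgoing labels $b,d$, according to which of the two strands is the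 overstrand (one fixed convention is used throughout). Then $\langle K\rangle$ is the sum over all labellings of the product of all these weights. For example $\langle\bigcirc\rangle=\sum_{a,b}\mathcal{M}_{ab}\mathcal{M}^{ab}$. **Kauffman polynomial.** Regular isotopy is the equivalence relation on link diagrams generated by planar isotopy and Reidemeister moves II and III. $D_K=D_K(z,\alpha)$ is the invariant of unoriented link diagrams determined by: (1) $D_K=D_{K'}$ if $K,K'$ are regularly isotopic; (2) $D_{L_+}-D_{L_-}=z(D_{L_\infty}-D_{L_0})$, where the four diagrams agree outside a disc in which $L_+$ is a crossing of the kind assigned $\mathcal{B}$, $L_-$ is the crossing of the kind assigned $\mathcal{B}^{-1}$, $L_\infty$ is an annihilation together with a creation, and $L_0$ is two vertical strands; (3) $D_{\bigcirc}=(\alpha-\alpha^{-1})/z+1$, $D_{W_+}=\alpha D_{W}$ and $D_{W_-}=\alpha^{-1}D_{W}$, where $W_{+}$ (resp. $W_-$) is a diagram containing a curl formed by an annihilation applied to the outgoing strands of a crossing assigned $\mathcal{B}$ (resp. $\mathcal{B}^{-1}$), and $W$ is the diagram obtained by replacing the curl by a plain annihilation arc. *)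

theory Defs
  imports
    Complex_Main
    "HOL-Computational_Algebra.Polynomial"
    "HOL-Computational_Algebra.Fraction_Field"
    "HOL-Library.FuncSet"
begin

section \<open>Link diagrams in general position\<close>

text \<open>
  A diagram in general position with respect to the height function is cut into horizontal slices,
  each of which contains exactly one elementary piece. The slice \<open>Slice l p r\<close> consists of the piece
  \<open>p\<close> with \<open>l\<close> vertical strands on its left and \<open>r\<close> on its right, and a diagram is the list of its
  slices, in the direction in which labels are incoming first and outgoing second: a creation has two
  outgoing strands, an annihilation two incoming ones. Vertical strands occur only as the numbers
  \<open>l\<close> and \<open>r\<close>; there is no slice consisting of vertical strands alone.
\<close>

datatype piece = Creation | Annihilation | CrossB | CrossBinv

datatype slice = Slice nat piece nat

type_synonym diagram = "slice list"

fun legs_in :: "piece \<Rightarrow> nat" where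
  "legs_in Creation = 0"
| "legs_in Annihilation = 2"
| "legs_in CrossB = 2"
| "legs_in CrossBinv = 2"

fun legs_out :: "piece \<Rightarrow> nat" where
  "legs_out Creation = 2"
| "legs_out Annihilation = 0"
| "legs_out CrossB = 2"
| "legs_out CrossBinv = 2"

fun strands_below :: "slice \<Rightarrow> nat" where
  "strands_below (Slice l p r) = l + legs_in p + r"

fun strands_above :: "slice \<Rightarrow> nat" where
  "strands_above (Slice l p r) = l + legs_out p + r"

fun composable :: "nat \<Rightarrow> diagram \<Rightarrow> nat \<Rightarrow> bool" where
  "composable m [] k \<longleftrightarrow> m = k"
| "composable m (s # w) k \<longleftrightarrow> strands_below s = m \<and> composable (strands_above s) w k"

text \<open>
  Links have at least one component. The empty diagram has to be excluded: the skein relations and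
  the value on the circle do not constrain an invariant there.
\<close>

definition link_diagram :: "diagram \<Rightarrow> bool" where
  "link_diagram K \<longleftrightarrow> K \<noteq> [] \<and> composable 0 K 0"


section \<open>Regular isotopy\<close>

text \<open>
  The rules \<open>exchange\<close>, \<open>straighten\<close> and \<open>slide\<close> generate planar isotopy of diagrams
  in general position: they are the changes of the relative height of two pieces, the cancellation
  of a pair of extrema on a strand, and the passage of a crossing past an extremum of one of its two
  strands. In the last case the crossing gets rotated by a quarter turn, which exchanges the two
  kinds of crossings.
\<close>

fun is_crossing :: "piece \<Rightarrow> bool" where
  "is_crossing p \<longleftrightarrow> p = CrossB \<or> p = CrossBinv"

fun opposite :: "piece \<Rightarrow> piece" where
  "opposite CrossB = CrossBinv"
| "opposite CrossBinv = CrossB"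
| "opposite p = p"

inductive local_move :: "diagram \<Rightarrow> diagram \<Rightarrow> bool" where
  exchange:
    "local_move
       [Slice l p (m + legs_in p' + r), Slice (l + legs_out p + m) p' r]
       [Slice (l + legs_in p + m) p' r, Slice l p (m + legs_out p' + r)]"
| straighten_left:
    "local_move [Slice (l + 1) Creation r, Slice l Annihilation (r + 1)] []"
| straighten_right:
    "local_move [Slice l Creation (r + 1), Slice (l + 1) Annihilation r] []"
| slide_annihilation:
    "is_crossing x \<Longrightarrow>
     local_move
       [Slice (l + 1) x r, Slice l Annihilation (r + 1)]
       [Slice l (opposite x) (r + 1), Slice (l + 1) Annihilation r]"
| slide_creation:
    "is_crossing x \<Longrightarrow>
     local_move
       [Slice l Creation (r + 1), Slice (l + 1) x r]
       [Slice (l + 1) Creation r, Slice l (opposite x) (r + 1)]"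
| reidemeister_II:
    "is_crossing x \<Longrightarrow> local_move [Slice l x r, Slice l (opposite x) r] []"
  \<comment> \<open>The side condition excludes the two sign patterns in which no strand is on top of both others.\<close>
| reidemeister_III:
    "is_crossing x \<Longrightarrow> is_crossing y \<Longrightarrow> is_crossing w \<Longrightarrow> \<not> (x = w \<and> y = opposite x) \<Longrightarrow>
     local_move
       [Slice l x (r + 1), Slice (l + 1) y r, Slice l w (r + 1)]
       [Slice (l + 1) w r, Slice l y (r + 1), Slice (l + 1) x r]"

definition regular_isotopy_step :: "diagram \<Rightarrow> diagram \<Rightarrow> bool" where
  "regular_isotopy_step K K' \<longleftrightarrow>
     link_diagram K \<and> link_diagram K' \<and>
     (\<exists>u v x y. K = u @ x @ v \<and> K' = u @ y @ v \<and> local_move x y)"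

definition regularly_isotopic :: "diagram \<Rightarrow> diagram \<Rightarrow> bool" where
  "regularly_isotopic = equivclp regular_isotopy_step"


section \<open>The Kauffman polynomial\<close>

definition kauffman_invariant :: "'a::field \<Rightarrow> 'a \<Rightarrow> (diagram \<Rightarrow> 'a) \<Rightarrow> bool" where
  "kauffman_invariant z \<alpha> D \<longleftrightarrow>
     (\<forall>K K'. link_diagram K \<longrightarrow> link_diagram K' \<longrightarrow> regularly_isotopic K K' \<longrightarrow> D K = D K') \<and>
     (\<forall>u v l r. link_diagram (u @ [Slice l CrossB r] @ v) \<longrightarrow>
        D (u @ [Slice l CrossB r] @ v) - D (u @ [Slice l CrossBinv r] @ v) =
        z * (D (u @ [Slice l Annihilation r, Slice l Creation r] @ v) - D (u @ v))) \<and>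
     D [Slice 0 Creation 0, Slice 0 Annihilation 0] = (\<alpha> - inverse \<alpha>) / z + 1 \<and>
     (\<forall>u v l r. link_diagram (u @ [Slice l Annihilation r] @ v) \<longrightarrow>
        D (u @ [Slice l CrossB r, Slice l Annihilation r] @ v) =
          \<alpha> * D (u @ [Slice l Annihilation r] @ v) \<and>
        D (u @ [Slice l CrossBinv r, Slice l Annihilation r] @ v) =
          inverse \<alpha> * D (u @ [Slice l Annihilation r] @ v))"

text \<open>
  Extensionality fixes the irrelevant values on lists of slices that are not link diagrams.
\<close>

definition kauffman_polynomial :: "'a::field \<Rightarrow> 'a \<Rightarrow> diagram \<Rightarrow> 'a" where
  "kauffman_polynomial z \<alpha> =
     (THE D. D \<in> extensional {K. link_diagram K} \<and> kauffman_invariant z \<alpha> D)"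


section \<open>Braiding and fusion matrices\<close>

type_synonym K0 = "complex poly fract"

definition t_var :: K0 where
  "t_var = Fract [:0, 1:] 1"

definition imag_K0 :: K0 where
  "imag_K0 = Fract [:\<i>:] 1"

text \<open>\<open>q4 k\<close> is \<open>q\<close> to the power \<open>k/4\<close>; exponents below are those of \<open>q\<close> multiplied by 4.\<close>

definition q4 :: "int \<Rightarrow> K0" where
  "q4 k = t_var powi k"

datatype lie_type = TypeB | TypeC | TypeD

fun rank_ok :: "lie_type \<Rightarrow> nat \<Rightarrow> bool" where
  "rank_ok TypeB n \<longleftrightarrow> n \<ge> 1"
| "rank_ok TypeC n \<longleftrightarrow> n \<ge> 1"
| "rank_ok TypeD n \<longleftrightarrow> n \<ge> 2"

fun top_index :: "lie_type \<Rightarrow> nat \<Rightarrow> nat" where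
  "top_index TypeB n = 2 * n"
| "top_index TypeC n = 2 * n - 1"
| "top_index TypeD n = 2 * n - 1"

definition index_set :: "lie_type \<Rightarrow> nat \<Rightarrow> nat set" where
  "index_set X n = {0..top_index X n}"

definition delta :: "'i \<Rightarrow> 'i \<Rightarrow> 'a::zero_neq_one" where
  "delta x y = (if x = y then 1 else 0)"

fun gam :: "lie_type \<Rightarrow> K0" where
  "gam TypeB = q4 (- 2)"
| "gam TypeC = q4 (- 1)"
| "gam TypeD = q4 (- 2)"

text \<open>
  \<open>beta X n a b\<close> is the coefficient of $J_{N-b,b}$ in the image of $J_{a,N-a}$, for $a < b$.
  For types C and D the half-integral factors of the case distinction are doubled.
\<close>

fun beta :: "lie_type \<Rightarrow> int \<Rightarrow> int \<Rightarrow> int \<Rightarrow> K0" where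
  "beta TypeB n a b =
     (if (a - n) * (b - n) > 0 then (q4 2 - q4 (- 2)) * q4 (- 2 * (a - b))
      else if (a - n) * (b - n) = 0 then (q4 2 - q4 (- 2)) * q4 (- 2 * (a - b) - 1)
      else (q4 2 - q4 (- 2)) * q4 (- 2 * (a - b + 1))
           + delta a (2 * n - b) * (q4 (- 2) - q4 2))"
| "beta TypeC n a b =
     (if (2 * a - 2 * n + 1) * (2 * b - 2 * n + 1) > 0
      then (q4 1 - q4 (- 1)) * q4 (- (a - b))
      else (q4 (- 1) - q4 1) * q4 (- (a - b - 1))
           + delta a (2 * n - 1 - b) * (q4 (- 1) - q4 1))"
| "beta TypeD n a b =
     (if (2 * a - 2 * n + 1) * (2 * b - 2 * n + 1) > 0
      then (q4 2 - q4 (- 2)) * q4 (- 2 * (a - b))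
      else (q4 2 - q4 (- 2)) * q4 (- 2 * (a - b + 1))
           + delta a (2 * n - 1 - b) * (q4 (- 2) - q4 2))"

text \<open>
  \<open>braiding X n (a, c) (b, d)\<close> is the entry with lower indices $a,c$ and upper indices $b,d$, that
  is, the coefficient of $J_{b,d}$ in the image of $J_{a,c}$.
\<close>

fun braiding :: "lie_type \<Rightarrow> nat \<Rightarrow> nat \<times> nat \<Rightarrow> nat \<times> nat \<Rightarrow> K0" where
  "braiding X n (a, c) (b, d) =
     (let N = top_index X n in
      if a + c \<noteq> N then
        (if a = c then gam X * delta (b, d) (a, a)
         else if a > c then delta (b, d) (c, a)
         else delta (b, d) (c, a) + (gam X - inverse (gam X)) * delta (b, d) (a, c))
      else
        (if a = c then 1 else inverse (gam X)) * delta (b, d) (c, a)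
        + (\<Sum>e = a + 1..N. beta X (int n) (int a) (int e) * delta (b, d) (N - e, e)))"

fun zeta :: "lie_type \<Rightarrow> int \<Rightarrow> int \<Rightarrow> K0" where
  "zeta TypeB n a =
     (if a < n then q4 (2 * (n - a) - 1) else if a = n then 1 else q4 (2 * (n - a) + 1))"
| "zeta TypeC n a =
     (if a \<le> n - 1 then - imag_K0 * q4 (n - a) else imag_K0 * q4 (n - 1 - a))"
| "zeta TypeD n a =
     (if a \<le> n - 1 then q4 (2 * (n - 1 - a)) else q4 (2 * (n - a)))"

definition fusion :: "lie_type \<Rightarrow> nat \<Rightarrow> nat \<Rightarrow> nat \<Rightarrow> K0" where
  "fusion X n a c = (if a + c = top_index X n then zeta X (int n) (int a) else 0)"

text \<open>The inverse of a square matrix indexed by a finite set \<open>S\<close>, with zero entries outside \<open>S\<close>.\<close>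

definition matrix_inverse_on :: "'i set \<Rightarrow> ('i \<Rightarrow> 'i \<Rightarrow> 'a::field) \<Rightarrow> 'i \<Rightarrow> 'i \<Rightarrow> 'a" where
  "matrix_inverse_on S A =
     (THE C. (\<forall>i j. i \<notin> S \<or> j \<notin> S \<longrightarrow> C i j = 0) \<and>
             (\<forall>i\<in>S. \<forall>j\<in>S. (\<Sum>k\<in>S. A i k * C k j) = delta i j \<and>
                             (\<Sum>k\<in>S. C i k * A k j) = delta i j))"

definition braiding_inv :: "lie_type \<Rightarrow> nat \<Rightarrow> nat \<times> nat \<Rightarrow> nat \<times> nat \<Rightarrow> K0" where
  "braiding_inv X n = matrix_inverse_on (index_set X n \<times> index_set X n) (braiding X n)"

definition fusion_inv :: "lie_type \<Rightarrow> nat \<Rightarrow> nat \<Rightarrow> nat \<Rightarrow> K0" where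
  "fusion_inv X n = matrix_inverse_on (index_set X n) (fusion X n)"


section \<open>The state sum\<close>

text \<open>\<open>xs\<close> lists the labels of the strands below, \<open>ys\<close> those of the strands above.\<close>

fun piece_weight :: "lie_type \<Rightarrow> nat \<Rightarrow> piece \<Rightarrow> nat list \<Rightarrow> nat list \<Rightarrow> K0" where
  "piece_weight X n Creation xs ys = fusion_inv X n (ys ! 0) (ys ! 1)"
| "piece_weight X n Annihilation xs ys = fusion X n (xs ! 0) (xs ! 1)"
| "piece_weight X n CrossB xs ys = braiding X n (xs ! 0, xs ! 1) (ys ! 0, ys ! 1)"
| "piece_weight X n CrossBinv xs ys = braiding_inv X n (xs ! 0, xs ! 1) (ys ! 0, ys ! 1)"

fun slice_weight :: "lie_type \<Rightarrow> nat \<Rightarrow> slice \<Rightarrow> nat list \<Rightarrow> nat list \<Rightarrow> K0" where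
  "slice_weight X n (Slice l p r) xs ys =
     (\<Prod>j<l. delta (xs ! j) (ys ! j))
     * piece_weight X n p (drop l xs) (drop l ys)
     * (\<Prod>j<r. delta (xs ! (l + legs_in p + j)) (ys ! (l + legs_out p + j)))"

text \<open>
  A labelling assigns a list of labels to each of the \<open>length K + 1\<close> levels that bound the slices of
  \<open>K\<close>; the lowest level of a link diagram has no strands.
\<close>

definition labellings :: "lie_type \<Rightarrow> nat \<Rightarrow> diagram \<Rightarrow> nat list list set" where
  "labellings X n K =
     {ls. list_all2 (\<lambda>xs m. length xs = m \<and> set xs \<subseteq> index_set X n)
            ls (0 # map strands_above K)}"

definition state_sum :: "lie_type \<Rightarrow> nat \<Rightarrow> diagram \<Rightarrow> K0" where
  "state_sum X n K =
     (\<Sum>ls\<in>labellings X n K. \<Prod>i<length K. slice_weight X n (K ! i) (ls ! i) (ls ! Suc i))"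


section \<open>Parameters of the Kauffman polynomial\<close>

fun param_\<alpha> :: "lie_type \<Rightarrow> nat \<Rightarrow> K0" where
  "param_\<alpha> TypeB n = q4 (4 * int n)"
| "param_\<alpha> TypeC n = - q4 (2 * int n + 1)"
| "param_\<alpha> TypeD n = q4 (2 * (2 * int n - 1))"

fun param_z :: "lie_type \<Rightarrow> K0" where
  "param_z TypeB = q4 2 - q4 (- 2)"
| "param_z TypeC = q4 1 - q4 (- 1)"
| "param_z TypeD = q4 2 - q4 (- 2)"

end

theory Submission
  imports Defs
begin

text \<open>
  Uniqueness: the difference \<open>D\<close> of two Kauffman invariants satisfies the same local relations and
  vanishes on the circle. By induction on the number of strands, every functional \<open>v \<mapsto> D (w @ v)\<close> is a
  linear combination of those in which \<open>w\<close> is built by successively inserting an arc that starts on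
  the far left and passes over the strands below it, since the span of these is closed under
  composition with creations, annihilations and crossings. Hence \<open>D\<close> is a multiple of its value on
  the empty diagram, which may be taken to be \<open>0\<close>.

  Existence: put \<open>s = q\<^sup>1\<^sup>/\<^sup>2\<close> for types B and D, \<open>s = q\<^sup>1\<^sup>/\<^sup>4\<close> for type C, and \<open>z = s - s\<inverse>\<close>. In all types
  the entries of the braiding matrix are powers of \<open>s\<close> on the transposition, \<open>- z\<close> on the diagonal for
  \<open>a < c\<close>, and \<open>z \<zeta>\<^sub>a \<zeta>\<^sub>b\<close> from \<open>(a, N - a)\<close> to \<open>(b, N - b)\<close> for \<open>a < N - b\<close>, where the \<open>\<zeta>\<^sub>a\<close> satisfy
  \<open>\<zeta>\<^sub>a \<zeta>\<^bsub>N-a\<^esub> = 1\<close>. The partial sums of \<open>z \<zeta>\<^sub>e\<^sup>2\<close> have a closed form, so that every sum over inner labels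
  can be evaluated and the Yang--Baxter equation becomes, for each relative position of the outer
  labels, an identity of rational functions in \<open>s\<close> and the \<open>\<zeta>\<^sub>a\<close>.
\<close>


section \<open>Uniqueness of the Kauffman polynomial\<close>

text \<open>An arc lies on top of everything below it, so every piece can be pulled under it unless
  it sits at an end of the arc. There a crossing of the wrong sign is switched by the skein
  relation, at the price of an annihilation followed by a creation; this ties the closure under
  crossings to that under annihilations. The factor of a circle is found through a strand next to
  it, so a circle without neighbours is exceptional, and the value 0 on the empty diagram is what
  makes the span consistent there.

  The inverse braiding matrix is not given by formulas; the skein relation dictates its entries,
  which are then checked. The constant \<alpha> is dictated as well: the partial sum below the
  smallest label is empty, so \<alpha> is \<open>s\<close> times the square of \<zeta> at that
  label. In the Yang--Baxter equation the obstacle is the coincidences among six labels.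
  Conservation of weight leaves nine placements of complementary pairs, and symmetries leave four of
  them.\<close>

lemma composable_append: "composable a (x @ y) b \<longleftrightarrow> (\<exists>c. composable a x c \<and> composable c y b)"
  by (induction x arbitrary: a) auto

lemma composable_unique: "composable a x b \<Longrightarrow> composable a x c \<Longrightarrow> b = c"
  by (induction x arbitrary: a) auto

text \<open>
  The numbers of strands are part of the relation because a straightening move replaces a diagram by
  the empty one, which is composable with any number of strands.
\<close>

inductive isotopic :: "nat \<Rightarrow> diagram \<Rightarrow> diagram \<Rightarrow> nat \<Rightarrow> bool" where
  isotopic_move: "local_move x y \<Longrightarrow> composable a x b \<Longrightarrow> composable a y b \<Longrightarrow> isotopic a x y b"
| isotopic_refl: "composable a x b \<Longrightarrow> isotopic a x x b"
| isotopic_sym: "isotopic a x y b \<Longrightarrow> isotopic a y x b"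
| isotopic_trans [trans]: "isotopic a x y b \<Longrightarrow> isotopic a y w b \<Longrightarrow> isotopic a x w b"
| isotopic_append: "isotopic a x y b \<Longrightarrow> isotopic b x' y' c \<Longrightarrow> isotopic a (x @ x') (y @ y') c"

lemma isotopic_composable: "isotopic a x y b \<Longrightarrow> composable a x b \<and> composable a y b"
  by (induction rule: isotopic.induct) (auto simp: composable_append)

lemma isotopic_context:
  assumes "isotopic b x y c" "composable a u b" "composable c v d"
  shows "isotopic a (u @ x @ v) (u @ y @ v) d"
  using assms by (intro isotopic_append isotopic_refl)

lemma isotopic_prefix:
  assumes "isotopic b x y c" "composable a u b"
  shows "isotopic a (u @ x) (u @ y) c"
  using assms by (intro isotopic_append isotopic_refl)

lemma isotopic_suffix:
  assumes "isotopic b x y c" "composable c v d"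
  shows "isotopic b (x @ v) (y @ v) d"
  using assms by (intro isotopic_append isotopic_refl)

section \<open>Local isotopies and strands that pass over pieces\<close>

lemma isotopic_exchange:
  "isotopic (l + legs_in p + m + legs_in p' + r)
     [Slice l p (m + legs_in p' + r), Slice (l + legs_out p + m) p' r]
     [Slice (l + legs_in p + m) p' r, Slice l p (m + legs_out p' + r)]
     (l + legs_out p + m + legs_out p' + r)"
  by (rule isotopic_move[OF local_move.exchange]) auto

text \<open>
  \<open>arc k r\<close> adds a strand that joins the new leftmost point to the point with index \<open>k + 1\<close> and passes
  over \<open>k\<close> of the \<open>k + r\<close> old strands.
\<close>

fun arc :: "nat \<Rightarrow> nat \<Rightarrow> diagram" where
  "arc 0 r = [Slice 0 Creation r]"
| "arc (Suc k) r = arc k (Suc r) @ [Slice (Suc k) CrossB r]"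

lemma composable_arc: "composable (k + r) (arc k r) (k + r + 2)"
proof (induction k arbitrary: r)
  case (Suc k)
  show ?case
    using Suc[of "Suc r"] by (auto simp: composable_append)
qed simp

lemma composable_arc_append:
  "composable a (arc k r @ w) b \<longleftrightarrow> a = k + r \<and> composable (k + r + 2) w b"
proof -
  have "a = k + r" if "composable a (arc k r) c" for c
    using that
  proof (induction k arbitrary: r c)
    case (Suc k)
    then show ?case
      using Suc.IH[of "Suc r"] by (auto simp: composable_append)
  qed auto
  then show ?thesis
    using composable_arc[of k r] composable_unique[OF composable_arc[of k r]]
    unfolding composable_append by metis
qed

lemma composable_arc_iff: "composable a (arc k r) b \<longleftrightarrow> a = k + r \<and> b = k + r + 2"
  using composable_arc_append[of a k r "[]" b] by auto

text \<open>All slices of the arc lie to the left of the piece, so one exchange per slice brings the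
  piece below the arc. Its index drops by 2 because both ends of the arc are to its left.\<close>

lemma isotopic_arc_right:
  "isotopic (k + j + legs_in p + r)
     (arc k (j + legs_in p + r) @ [Slice (k + 2 + j) p r])
     ([Slice (k + j) p r] @ arc k (j + legs_out p + r))
     (k + j + legs_out p + r + 2)"
proof (induction k arbitrary: j)
  case 0
  show ?case
    using isotopic_exchange[of 0 Creation j p r] by (simp add: add_ac)
next
  case (Suc k)
  have "isotopic (Suc k + j + legs_in p + r)
     (arc k (Suc j + legs_in p + r) @ [Slice (Suc k) CrossB (j + legs_in p + r), Slice (Suc k + 2 + j) p r])
     (arc k (Suc j + legs_in p + r) @ [Slice (Suc k + 2 + j) p r, Slice (Suc k) CrossB (j + legs_out p + r)])
     (Suc k + j + legs_out p + r + 2)"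
    using isotopic_exchange[of "Suc k" CrossB j p r]
    by (intro isotopic_prefix[where b = "Suc k + 2 + j + legs_in p + r"])
      (auto simp: composable_arc_iff)
  also have "isotopic (Suc k + j + legs_in p + r)
     ((arc k (Suc j + legs_in p + r) @ [Slice (k + 2 + Suc j) p r]) @ [Slice (Suc k) CrossB (j + legs_out p + r)])
     (([Slice (k + Suc j) p r] @ arc k (Suc j + legs_out p + r)) @ [Slice (Suc k) CrossB (j + legs_out p + r)])
     (Suc k + j + legs_out p + r + 2)"
    using Suc[of "Suc j"]
    by (intro isotopic_suffix[where c = "k + Suc j + legs_out p + r + 2"]) auto
  then have "isotopic (Suc k + j + legs_in p + r)
     (arc k (Suc j + legs_in p + r) @ [Slice (Suc k + 2 + j) p r, Slice (Suc k) CrossB (j + legs_out p + r)])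
     ([Slice (Suc k + j) p r] @ arc (Suc k) (j + legs_out p + r))
     (Suc k + j + legs_out p + r + 2)"
    by simp
  finally show ?case
    by simp
qed

text \<open>The tail of an arc without its creation. By \<open>arc_add\<close> an arc can be split
  anywhere, so that its passage over the legs of a single piece can be treated locally.\<close>

fun over_strands :: "nat \<Rightarrow> nat \<Rightarrow> nat \<Rightarrow> diagram" where
  "over_strands l 0 r = []"
| "over_strands l (Suc k) r = over_strands l k (Suc r) @ [Slice (l + k) CrossB r]"

lemma arc_add: "arc (i + k) r = arc i (k + r) @ over_strands (Suc i) k r"
  by (induction k arbitrary: r) auto

lemma isotopic_annihilation_slide:
  "is_crossing x \<Longrightarrow> isotopic (l + 3 + r)
     [Slice (Suc l) x r, Slice l Annihilation (Suc r)]
     [Slice l (opposite x) (Suc r), Slice (Suc l) Annihilation r] (l + 1 + r)"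
  using local_move.slide_annihilation[of x l r] by (intro isotopic_move) auto

lemma isotopic_creation_slide:
  "is_crossing x \<Longrightarrow> isotopic (l + 1 + r)
     [Slice l Creation (Suc r), Slice (Suc l) x r]
     [Slice (Suc l) Creation r, Slice l (opposite x) (Suc r)] (l + 3 + r)"
  using local_move.slide_creation[of x l r] by (intro isotopic_move) auto

lemma isotopic_cancel:
  "is_crossing x \<Longrightarrow> isotopic (l + 2 + r) [Slice l x r, Slice l (opposite x) r] [] (l + 2 + r)"
  using local_move.reidemeister_II[of x l r] by (intro isotopic_move) auto

lemma isotopic_straighten_left:
  "isotopic (l + 1 + r) [Slice (Suc l) Creation r, Slice l Annihilation (Suc r)] [] (l + 1 + r)"
  using local_move.straighten_left[of l r] by (intro isotopic_move) auto

lemma isotopic_straighten_right: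
  "isotopic (l + 1 + r) [Slice l Creation (Suc r), Slice (Suc l) Annihilation r] [] (l + 1 + r)"
  using local_move.straighten_right[of l r] by (intro isotopic_move) auto

text \<open>The upper strand is pulled across an extremum by a slide and the second Reidemeister
  move, and across a crossing by the third. Being on top, it makes the first two crossings of the
  triple equal, so the forbidden sign patterns do not occur and both kinds of crossings are
  covered.\<close>

lemma isotopic_strand_over_piece:
  "isotopic (l + 1 + legs_in p + r)
     (over_strands l (legs_in p) r @ [Slice l p (Suc r)])
     ([Slice (Suc l) p r] @ over_strands l (legs_out p) r)
     (l + 1 + legs_out p + r)"
proof (cases p)
  case Creation
  \<comment> \<open>The inserted pair supplies the crossing that the slide then carries past the
    creation.\<close>
  have "isotopic (l + 1 + r) ([Slice l Creation (Suc r)] @ [])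
    ([Slice l Creation (Suc r)] @ [Slice (Suc l) CrossBinv r, Slice (Suc l) CrossB r]) (l + 3 + r)"
    using isotopic_cancel[of CrossBinv "Suc l" r, THEN isotopic_sym]
    by (intro isotopic_prefix[where b = "l + 3 + r"]) (auto simp: numeral_2_eq_2 numeral_3_eq_3)
  also have "isotopic (l + 1 + r)
    ([Slice l Creation (Suc r), Slice (Suc l) CrossBinv r] @ [Slice (Suc l) CrossB r])
    ([Slice (Suc l) Creation r, Slice l CrossB (Suc r)] @ [Slice (Suc l) CrossB r]) (l + 3 + r)"
    using isotopic_creation_slide[of CrossBinv l r]
    by (intro isotopic_suffix[where c = "l + 3 + r"]) (auto simp: numeral_2_eq_2 numeral_3_eq_3)
  then have "isotopic (l + 1 + r)
    ([Slice l Creation (Suc r)] @ [Slice (Suc l) CrossBinv r, Slice (Suc l) CrossB r])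
    [Slice (Suc l) Creation r, Slice l CrossB (Suc r), Slice (Suc l) CrossB r] (l + 3 + r)"
    by simp
  finally show ?thesis
    using Creation by (simp add: numeral_2_eq_2 numeral_3_eq_3)
next
  case Annihilation
  have "isotopic (l + 3 + r)
    ([Slice l CrossB (Suc r)] @ [Slice (Suc l) CrossB r, Slice l Annihilation (Suc r)])
    ([Slice l CrossB (Suc r)] @ [Slice l CrossBinv (Suc r), Slice (Suc l) Annihilation r]) (l + 1 + r)"
    using isotopic_annihilation_slide[of CrossB l r]
    by (intro isotopic_prefix[where b = "l + 3 + r"]) auto
  also have "isotopic (l + 3 + r)
    ([Slice l CrossB (Suc r), Slice l CrossBinv (Suc r)] @ [Slice (Suc l) Annihilation r])
    ([] @ [Slice (Suc l) Annihilation r]) (l + 1 + r)"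
    using isotopic_cancel[of CrossB l "Suc r"]
    by (intro isotopic_suffix[where c = "l + 3 + r"]) (auto simp: numeral_2_eq_2 numeral_3_eq_3)
  then have "isotopic (l + 3 + r)
    ([Slice l CrossB (Suc r)] @ [Slice l CrossBinv (Suc r), Slice (Suc l) Annihilation r])
    [Slice (Suc l) Annihilation r] (l + 1 + r)"
    by simp
  finally show ?thesis
    using Annihilation by (simp add: numeral_2_eq_2 numeral_3_eq_3)
next
  case CrossB
  then show ?thesis
    using local_move.reidemeister_III[of CrossB CrossB CrossB l r]
    by (auto simp: numeral_2_eq_2 intro!: isotopic_move)
next
  case CrossBinv
  then show ?thesis
    using local_move.reidemeister_III[of CrossB CrossB CrossBinv l r]
    by (auto simp: numeral_2_eq_2 intro!: isotopic_move)
qed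

lemma composable_over_strands:
  "composable (l + 1 + k + r) (over_strands l k r) (l + 1 + k + r)"
proof (induction k arbitrary: r)
  case (Suc k)
  show ?case
    using Suc[of "Suc r"] by (auto simp: composable_append)
qed simp

text \<open>Crossings of the arc to the right of the piece are exchanged with it one at a time. In
  the base case the tail over the legs of the piece is pulled across, and the piece then stands to
  the right of what remains of the arc. Only the left end of the arc is to the left of the piece,
  hence \<open>Suc i\<close> above the arc and \<open>i\<close> below it.\<close>

lemma isotopic_arc_inside:
  "isotopic (i + legs_in p + j + r)
     (arc (i + legs_in p + j) r @ [Slice (Suc i) p (Suc (j + r))])
     ([Slice i p (j + r)] @ arc (i + legs_out p + j) r)
     (i + legs_out p + j + r + 2)"
proof (induction j arbitrary: r)
  case 0
  have "isotopic (i + legs_in p + r)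
     (arc i (legs_in p + r) @ over_strands (Suc i) (legs_in p) r @ [Slice (Suc i) p (Suc r)])
     (arc i (legs_in p + r) @ [Slice (Suc (Suc i)) p r] @ over_strands (Suc i) (legs_out p) r)
     (i + legs_out p + r + 2)"
    using isotopic_strand_over_piece[of "Suc i" p r]
    by (intro isotopic_prefix[where b = "Suc i + 1 + legs_in p + r"]) (auto simp: composable_arc_iff)
  also have "isotopic (i + legs_in p + r)
     ((arc i (legs_in p + r) @ [Slice (Suc (Suc i)) p r]) @ over_strands (Suc i) (legs_out p) r)
     (([Slice i p r] @ arc i (legs_out p + r)) @ over_strands (Suc i) (legs_out p) r)
     (i + legs_out p + r + 2)"
    using isotopic_arc_right[of i 0 p r] composable_over_strands[of "Suc i" "legs_out p" r]
    by (intro isotopic_suffix[where c = "i + legs_out p + r + 2"]) (auto simp: numeral_2_eq_2 numeral_3_eq_3)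
  then have "isotopic (i + legs_in p + r)
     (arc i (legs_in p + r) @ [Slice (Suc (Suc i)) p r] @ over_strands (Suc i) (legs_out p) r)
     ([Slice i p r] @ arc (i + legs_out p) r) (i + legs_out p + r + 2)"
    by (simp add: arc_add)
  finally show ?case
    by (simp add: arc_add)
next
  case (Suc j)
  have "isotopic (i + legs_in p + Suc j + r)
     (arc (i + legs_in p + j) (Suc r) @ [Slice (Suc (i + legs_in p + j)) CrossB r, Slice (Suc i) p (j + 2 + r)])
     (arc (i + legs_in p + j) (Suc r) @ [Slice (Suc i) p (j + 2 + r), Slice (Suc (i + legs_out p + j)) CrossB r])
     (i + legs_out p + Suc j + r + 2)"
    using isotopic_exchange[of "Suc i" p j CrossB r, THEN isotopic_sym]
    by (intro isotopic_prefix[where b = "Suc i + legs_in p + j + 2 + r"]) (auto simp: composable_arc_iff)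
  also have "isotopic (i + legs_in p + Suc j + r)
     ((arc (i + legs_in p + j) (Suc r) @ [Slice (Suc i) p (Suc (j + Suc r))]) @ [Slice (Suc (i + legs_out p + j)) CrossB r])
     (([Slice i p (j + Suc r)] @ arc (i + legs_out p + j) (Suc r)) @ [Slice (Suc (i + legs_out p + j)) CrossB r])
     (i + legs_out p + Suc j + r + 2)"
    using Suc[of "Suc r"]
    by (intro isotopic_suffix[where c = "i + legs_out p + j + Suc r + 2"]) auto
  then have "isotopic (i + legs_in p + Suc j + r)
     (arc (i + legs_in p + j) (Suc r) @ [Slice (Suc i) p (j + 2 + r), Slice (Suc (i + legs_out p + j)) CrossB r])
     ([Slice i p (Suc j + r)] @ arc (i + legs_out p + Suc j) r)
     (i + legs_out p + Suc j + r + 2)"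
    by simp
  finally show ?case
    by simp
qed


text \<open>
  The local relations for functionals on the diagrams from \<open>m\<close> strands to none. If they hold for \<open>D\<close>,
  they hold for \<open>v \<mapsto> D (w @ v)\<close>.
\<close>

definition skein_functional :: "'a::field \<Rightarrow> 'a \<Rightarrow> nat \<Rightarrow> (diagram \<Rightarrow> 'a) \<Rightarrow> bool" where
  "skein_functional z \<alpha> m f \<longleftrightarrow>
     (\<forall>u a x y b v. composable m u a \<longrightarrow> isotopic a x y b \<longrightarrow> composable b v 0 \<longrightarrow>
        f (u @ x @ v) = f (u @ y @ v)) \<and>
     (\<forall>u l r v. composable m u (l + 2 + r) \<longrightarrow> composable (l + 2 + r) v 0 \<longrightarrow>
        f (u @ [Slice l CrossB r] @ v) - f (u @ [Slice l CrossBinv r] @ v) =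
        z * (f (u @ [Slice l Annihilation r, Slice l Creation r] @ v) - f (u @ v))) \<and>
     (\<forall>u l r v. composable m u (l + 2 + r) \<longrightarrow> composable (l + r) v 0 \<longrightarrow>
        f (u @ [Slice l CrossB r, Slice l Annihilation r] @ v) =
          \<alpha> * f (u @ [Slice l Annihilation r] @ v) \<and>
        f (u @ [Slice l CrossBinv r, Slice l Annihilation r] @ v) =
          inverse \<alpha> * f (u @ [Slice l Annihilation r] @ v))"

section \<open>Calculus of functionals that satisfy the skein relations\<close>

lemma skein_functional_isotopic:
  assumes "skein_functional z \<alpha> m f" "composable m u a" "isotopic a x y b" "composable b v 0"
  shows "f (u @ x @ v) = f (u @ y @ v)"
  using assms unfolding skein_functional_def by blast

lemma skein_functional_skein:
  assumes "skein_functional z \<alpha> m f" "composable m u (l + 2 + r)" "composable (l + 2 + r) v 0"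
  shows "f (u @ [Slice l CrossB r] @ v) - f (u @ [Slice l CrossBinv r] @ v) =
    z * (f (u @ [Slice l Annihilation r, Slice l Creation r] @ v) - f (u @ v))"
  using assms unfolding skein_functional_def by blast

lemma skein_functional_curl:
  assumes "skein_functional z \<alpha> m f" "composable m u (l + 2 + r)" "composable (l + r) v 0"
  shows "f (u @ [Slice l CrossB r, Slice l Annihilation r] @ v) =
      \<alpha> * f (u @ [Slice l Annihilation r] @ v)"
    and "f (u @ [Slice l CrossBinv r, Slice l Annihilation r] @ v) =
      inverse \<alpha> * f (u @ [Slice l Annihilation r] @ v)"
  using assms unfolding skein_functional_def by blast+

lemma skein_functional_prefix:
  assumes "skein_functional z \<alpha> m f" "composable m w k"
  shows "skein_functional z \<alpha> k (\<lambda>v. f (w @ v))"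
proof -
  have w: "composable m (w @ u) a" if "composable k u a" for u a
    using assms(2) that by (auto simp: composable_append)
  show ?thesis
    unfolding skein_functional_def
  proof (intro conjI allI impI)
    fix u a x y b v
    assume "composable k u a" "isotopic a x y b" "composable b v 0"
    then show "f (w @ u @ x @ v) = f (w @ u @ y @ v)"
      using skein_functional_isotopic[OF assms(1) w, of u a x y b v] by simp
  next
    fix u l r v
    assume "composable k u (l + 2 + r)" "composable (l + 2 + r) v 0"
    then show "f (w @ u @ [Slice l CrossB r] @ v) - f (w @ u @ [Slice l CrossBinv r] @ v) =
      z * (f (w @ u @ [Slice l Annihilation r, Slice l Creation r] @ v) - f (w @ u @ v))"
      using skein_functional_skein[OF assms(1) w, of u l r v] by simp
  next
    fix u l r v
    assume *: "composable k u (l + 2 + r)" "composable (l + r) v 0"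
    then show "f (w @ u @ [Slice l CrossB r, Slice l Annihilation r] @ v) =
        \<alpha> * f (w @ u @ [Slice l Annihilation r] @ v)"
      using skein_functional_curl(1)[OF assms(1) w, of u l r v] by simp
    show "f (w @ u @ [Slice l CrossBinv r, Slice l Annihilation r] @ v) =
        inverse \<alpha> * f (w @ u @ [Slice l Annihilation r] @ v)"
      using * skein_functional_curl(2)[OF assms(1) w, of u l r v] by simp
  qed
qed

lemma skein_functional_add:
  assumes "skein_functional z \<alpha> m f" "skein_functional z \<alpha> m g"
  shows "skein_functional z \<alpha> m (\<lambda>v. f v + g v)"
  unfolding skein_functional_def
proof (intro conjI allI impI)
  fix u l r v
  assume *: "composable m u (l + 2 + r)" "composable (l + 2 + r) v 0"
  show "f (u @ [Slice l CrossB r] @ v) + g (u @ [Slice l CrossB r] @ v)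
      - (f (u @ [Slice l CrossBinv r] @ v) + g (u @ [Slice l CrossBinv r] @ v)) =
    z * (f (u @ [Slice l Annihilation r, Slice l Creation r] @ v)
      + g (u @ [Slice l Annihilation r, Slice l Creation r] @ v) - (f (u @ v) + g (u @ v)))"
    using skein_functional_skein[OF assms(1) *] skein_functional_skein[OF assms(2) *]
    by (simp add: algebra_simps)
qed (use assms in \<open>auto simp: skein_functional_def distrib_left\<close>)

lemma skein_functional_scale:
  assumes "skein_functional z \<alpha> m f"
  shows "skein_functional z \<alpha> m (\<lambda>v. c * f v)"
  unfolding skein_functional_def
proof (intro conjI allI impI)
  fix u l r v
  assume *: "composable m u (l + 2 + r)" "composable (l + 2 + r) v 0"
  show "c * f (u @ [Slice l CrossB r] @ v) - c * f (u @ [Slice l CrossBinv r] @ v) =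
    z * (c * f (u @ [Slice l Annihilation r, Slice l Creation r] @ v) - c * f (u @ v))"
    using arg_cong[OF skein_functional_skein[OF assms *], of "\<lambda>x. c * x"]
    by (simp add: algebra_simps)
qed (use assms in \<open>auto simp: skein_functional_def\<close>)

text \<open>The relations evaluate a functional only at diagrams that lead from \<open>m\<close>
  strands to none, so functionals may be compared on those alone.\<close>

lemma skein_functional_cong:
  assumes "skein_functional z \<alpha> m f" "\<And>v. composable m v 0 \<Longrightarrow> f v = g v"
  shows "skein_functional z \<alpha> m g"
  unfolding skein_functional_def
proof (intro conjI allI impI)
  fix u a x y b v
  assume *: "composable m u a" "isotopic a x y b" "composable b v 0"
  have "composable m (u @ x @ v) 0" "composable m (u @ y @ v) 0"
    using * isotopic_composable[OF *(2)] by (auto simp: composable_append)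
  then show "g (u @ x @ v) = g (u @ y @ v)"
    using skein_functional_isotopic[OF assms(1) *] assms(2) by simp
next
  fix u l r v
  assume *: "composable m u (l + 2 + r)" "composable (l + 2 + r) v 0"
  then show "g (u @ [Slice l CrossB r] @ v) - g (u @ [Slice l CrossBinv r] @ v) =
    z * (g (u @ [Slice l Annihilation r, Slice l Creation r] @ v) - g (u @ v))"
    using skein_functional_skein[OF assms(1) *]
    by (subst (1 2 3 4) assms(2)[symmetric]) (auto simp: composable_append)
next
  fix u l r v
  assume *: "composable m u (l + 2 + r)" "composable (l + r) v 0"
  show "g (u @ [Slice l CrossB r, Slice l Annihilation r] @ v) = \<alpha> * g (u @ [Slice l Annihilation r] @ v)"
    using skein_functional_curl(1)[OF assms(1) *] *
    by (subst (1 2) assms(2)[symmetric]) (auto simp: composable_append)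
  show "g (u @ [Slice l CrossBinv r, Slice l Annihilation r] @ v) = inverse \<alpha> * g (u @ [Slice l Annihilation r] @ v)"
    using skein_functional_curl(2)[OF assms(1) *] *
    by (subst (1 2) assms(2)[symmetric]) (auto simp: composable_append)
qed

text \<open>
  The curl rule of the Kauffman invariant is about a curl at an annihilation. Adding a zigzag to one
  leg turns a curl at a creation into one at an annihilation.
\<close>

lemma isotopic_creation_curl:
  "isotopic r [Slice 0 Creation r, Slice 0 CrossB r]
     [Slice 0 Creation r, Slice 1 Creation (Suc r), Slice 2 CrossB r, Slice 2 Annihilation r]
     (r + 2)"
proof -
  have "isotopic r ([Slice 0 Creation r, Slice 0 CrossB r] @ [])
    ([Slice 0 Creation r, Slice 0 CrossB r] @ [Slice 0 Creation (2 + r), Slice 1 Annihilation (Suc r)]) (r + 2)"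
    using isotopic_straighten_right[of 0 "Suc r", THEN isotopic_sym]
    by (intro isotopic_prefix[where b = "r + 2"]) auto
  also have "isotopic r
    ([Slice 0 Creation r] @ [Slice 0 CrossB r, Slice 0 Creation (2 + r)] @ [Slice 1 Annihilation (Suc r)])
    ([Slice 0 Creation r] @ [Slice 0 Creation (2 + r), Slice 2 CrossB r] @ [Slice 1 Annihilation (Suc r)]) (r + 2)"
    using isotopic_exchange[of 0 Creation 0 CrossB r, THEN isotopic_sym]
    by (intro isotopic_context[where b = "r + 2" and c = "r + 4"]) (auto simp: numeral_eq_Suc)
  then have "isotopic r
    ([Slice 0 Creation r, Slice 0 CrossB r] @ [Slice 0 Creation (2 + r), Slice 1 Annihilation (Suc r)])
    ([Slice 0 Creation r, Slice 0 Creation (2 + r)] @ [Slice 2 CrossB r, Slice 1 Annihilation (Suc r)]) (r + 2)"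
    by simp
  also have "isotopic r
    ([Slice 0 Creation r, Slice 0 Creation (2 + r)] @ [Slice 2 CrossB r, Slice 1 Annihilation (Suc r)])
    ([Slice 0 Creation r, Slice 2 Creation r] @ [Slice 2 CrossB r, Slice 1 Annihilation (Suc r)]) (r + 2)"
    using isotopic_exchange[of 0 Creation 0 Creation r, THEN isotopic_sym]
    by (intro isotopic_suffix[where c = "r + 4"]) (auto simp: numeral_eq_Suc)
  also have "isotopic r
    ([Slice 0 Creation r, Slice 2 Creation r] @ [Slice 2 CrossB r, Slice 1 Annihilation (Suc r)])
    ([Slice 0 Creation r, Slice 2 Creation r] @ [Slice 1 CrossBinv (Suc r), Slice 2 Annihilation r]) (r + 2)"
    using isotopic_annihilation_slide[of CrossB 1 r]
    by (intro isotopic_prefix[where b = "r + 4"]) (auto simp: numeral_eq_Suc)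
  also have "isotopic r
    ([Slice 0 Creation r] @ [Slice 2 Creation r, Slice 1 CrossBinv (Suc r)] @ [Slice 2 Annihilation r])
    ([Slice 0 Creation r] @ [Slice 1 Creation (Suc r), Slice 2 CrossB r] @ [Slice 2 Annihilation r]) (r + 2)"
    using isotopic_creation_slide[of CrossB 1 r, THEN isotopic_sym]
    by (intro isotopic_context[where b = "r + 2" and c = "r + 4"]) (auto simp: numeral_eq_Suc)
  then have "isotopic r
    ([Slice 0 Creation r, Slice 2 Creation r] @ [Slice 1 CrossBinv (Suc r), Slice 2 Annihilation r])
    [Slice 0 Creation r, Slice 1 Creation (Suc r), Slice 2 CrossB r, Slice 2 Annihilation r] (r + 2)"
    by simp
  finally show ?thesis
    by simp
qed

lemma skein_functional_creation_curl:
  assumes f: "skein_functional z \<alpha> r f" and v: "composable (r + 2) v 0"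
  shows "f ([Slice 0 Creation r, Slice 0 CrossB r] @ v) = \<alpha> * f ([Slice 0 Creation r] @ v)"
proof -
  have "f ([Slice 0 Creation r, Slice 0 CrossB r] @ v) =
    f ([Slice 0 Creation r, Slice 1 Creation (Suc r)] @ [Slice 2 CrossB r, Slice 2 Annihilation r] @ v)"
    using skein_functional_isotopic[OF f _ isotopic_creation_curl v, of "[]"] by simp
  also have "\<dots> = \<alpha> * f ([Slice 0 Creation r, Slice 1 Creation (Suc r)] @ [Slice 2 Annihilation r] @ v)"
    using v by (intro skein_functional_curl[OF f]) auto
  also have "f ([Slice 0 Creation r] @ [Slice 1 Creation (Suc r), Slice 2 Annihilation r] @ v) =
    f ([Slice 0 Creation r] @ [] @ v)"
    using isotopic_straighten_right[of 1 r] v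
    by (intro skein_functional_isotopic[OF f, where a = "r + 2" and b = "r + 2"]) (auto simp: numeral_2_eq_2)
  then have "f ([Slice 0 Creation r, Slice 1 Creation (Suc r)] @ [Slice 2 Annihilation r] @ v) =
    f ([Slice 0 Creation r] @ v)"
    by simp
  finally show ?thesis .
qed

text \<open>
  Joining the circle to the strand next to it by a single crossing gives a curl on that strand, for
  either sign of the crossing; the skein relation compares the two curls with the circle.
\<close>

lemma skein_functional_circle:
  assumes f: "skein_functional z \<alpha> m f" and "z \<noteq> 0"
    and u: "composable m u (Suc r)" and v: "composable (Suc r) v 0"
  shows "f (u @ [Slice 0 Creation (Suc r), Slice 0 Annihilation (Suc r)] @ v) =
    ((\<alpha> - inverse \<alpha>) / z + 1) * f (u @ v)"
proof -
  let ?loop = "\<lambda>x. f (u @ [Slice 0 Creation (Suc r), Slice 1 x r, Slice 0 Annihilation (Suc r)] @ v)"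
  have rotate: "?loop x = f ((u @ [Slice 1 Creation r]) @ [Slice 0 (opposite x) (Suc r), Slice 0 Annihilation (Suc r)] @ v)"
    if "is_crossing x" for x
  proof -
    have "f (u @ [Slice 0 Creation (Suc r), Slice (Suc 0) x r] @ ([Slice 0 Annihilation (Suc r)] @ v)) =
      f (u @ [Slice (Suc 0) Creation r, Slice 0 (opposite x) (Suc r)] @ ([Slice 0 Annihilation (Suc r)] @ v))"
      using isotopic_creation_slide[OF that, of 0 r] u v
      by (intro skein_functional_isotopic[OF f, where a = "Suc r" and b = "3 + r"]) auto
    then show ?thesis
      by simp
  qed
  have straight: "f ((u @ [Slice 1 Creation r]) @ [Slice 0 Annihilation (Suc r)] @ v) = f (u @ v)"
    using skein_functional_isotopic[OF f u _ v, of "[Slice 1 Creation r, Slice 0 Annihilation (Suc r)]" "[]"]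
      isotopic_straighten_left[of 0 r] by simp
  have u1: "composable m (u @ [Slice 1 Creation r]) (0 + 2 + Suc r)"
    using u by (auto simp: composable_append)
  have B: "?loop CrossB = inverse \<alpha> * f (u @ v)" and Binv: "?loop CrossBinv = \<alpha> * f (u @ v)"
    using rotate[of CrossB] rotate[of CrossBinv] skein_functional_curl[OF f u1, of v] v straight by auto
  have "f (u @ [Slice 0 Creation (Suc r), Slice 1 Annihilation r, Slice 1 Creation r, Slice 0 Annihilation (Suc r)] @ v)
     = f (u @ [Slice 1 Creation r, Slice 0 Annihilation (Suc r)] @ v)"
    using skein_functional_isotopic[OF f u, of "[Slice 0 Creation (Suc r), Slice 1 Annihilation r]" "[]" "Suc r"
        "[Slice 1 Creation r, Slice 0 Annihilation (Suc r)] @ v"]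
      isotopic_straighten_right[of 0 r] v by simp
  with straight have arcs: "f (u @ [Slice 0 Creation (Suc r), Slice 1 Annihilation r, Slice 1 Creation r, Slice 0 Annihilation (Suc r)] @ v)
     = f (u @ v)"
    by simp
  have "?loop CrossB - ?loop CrossBinv =
    z * (f (u @ v) - f (u @ [Slice 0 Creation (Suc r), Slice 0 Annihilation (Suc r)] @ v))"
    using skein_functional_skein[OF f, of "u @ [Slice 0 Creation (Suc r)]" 1 r "[Slice 0 Annihilation (Suc r)] @ v"]
      u v arcs by (auto simp: composable_append)
  then show ?thesis
    unfolding B Binv using \<open>z \<noteq> 0\<close> by (simp add: field_simps)
qed

text \<open>An inductive predicate stands for the linear span: closure statements become inductions
  in which the linear rules are immediate and \<open>arc\<close> is the essential case. Since
  \<open>arc\<close> leads to levels of at least 2, level 0 holds only multiples of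
  \<open>D\<close>, up to \<open>cong\<close>.\<close>

inductive arc_spanned :: "(diagram \<Rightarrow> 'a::field) \<Rightarrow> nat \<Rightarrow> (diagram \<Rightarrow> 'a) \<Rightarrow> bool" for D where
  base: "arc_spanned D 0 D"
| add: "arc_spanned D m f \<Longrightarrow> arc_spanned D m g \<Longrightarrow> arc_spanned D m (\<lambda>v. f v + g v)"
| scale: "arc_spanned D m f \<Longrightarrow> arc_spanned D m (\<lambda>v. c * f v)"
| arc: "arc_spanned D (k + r) f \<Longrightarrow> arc_spanned D (k + r + 2) (\<lambda>v. f (arc k r @ v))"
| cong: "arc_spanned D m f \<Longrightarrow> (\<And>v. composable m v 0 \<Longrightarrow> f v = g v) \<Longrightarrow> arc_spanned D m g"


section \<open>Closure of the span under all elementary pieces\<close>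

locale kauffman_difference =
  fixes z \<alpha> :: "'a::field" and D :: "diagram \<Rightarrow> 'a"
  assumes z_nonzero: "z \<noteq> 0"
    and skein_functional: "skein_functional z \<alpha> 0 D"
    and empty: "D [] = 0"
    and circle: "D [Slice 0 Creation 0, Slice 0 Annihilation 0] = 0"
begin

abbreviation "spanned \<equiv> arc_spanned D"

lemma spanned_skein_functional: "spanned m f \<Longrightarrow> skein_functional z \<alpha> m f"
proof (induction rule: arc_spanned.induct)
  case (arc k r f)
  then show ?case
    by (intro skein_functional_prefix) (auto simp: composable_arc_iff)
qed (auto intro: skein_functional skein_functional_add skein_functional_scale skein_functional_cong)

lemma spanned_isotopic:
  assumes f: "spanned m f" and "isotopic m x y b" "spanned b (\<lambda>v. f (y @ v))"
  shows "spanned b (\<lambda>v. f (x @ v))"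
  using assms(3)
proof (rule arc_spanned.cong)
  show "f (y @ v) = f (x @ v)" if "composable b v 0" for v
    using skein_functional_isotopic[OF spanned_skein_functional[OF f] _ assms(2) that, of "[]"]
    by simp
qed

lemma spanned_diff:
  assumes "spanned m f" "spanned m g"
  shows "spanned m (\<lambda>v. f v - g v)"
  using arc_spanned.add[OF assms(1) arc_spanned.scale[OF assms(2), of "- 1"]] by simp

text \<open>Below the arc the piece acts on \<open>g\<close>, which has two strands fewer. This is
  how closure at one level is inherited from a lower level.\<close>

lemma spanned_arc_right:
  assumes g: "spanned (k + j + legs_in p + r) g"
    and "spanned (k + j + legs_out p + r) (\<lambda>v. g (Slice (k + j) p r # v))"
  shows "spanned (k + j + legs_out p + r + 2) (\<lambda>v. g (arc k (j + legs_in p + r) @ Slice (k + 2 + j) p r # v))"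
proof -
  have "spanned (k + j + legs_out p + r + 2) (\<lambda>v. g (([Slice (k + j) p r] @ arc k (j + legs_out p + r)) @ v))"
    using arc_spanned.arc[of D k "j + legs_out p + r"] assms(2) by (simp add: add_ac)
  from spanned_isotopic[OF g isotopic_arc_right this] show ?thesis
    by simp
qed

lemma spanned_arc_inside:
  assumes g: "spanned (i + legs_in p + j + r) g"
    and "spanned (i + legs_out p + j + r) (\<lambda>v. g (Slice i p (j + r) # v))"
  shows "spanned (i + legs_out p + j + r + 2)
    (\<lambda>v. g (arc (i + legs_in p + j) r @ Slice (Suc i) p (Suc (j + r)) # v))"
proof -
  have "spanned (i + legs_out p + j + r + 2) (\<lambda>v. g (([Slice i p (j + r)] @ arc (i + legs_out p + j) r) @ v))"
    using arc_spanned.arc[of D "i + legs_out p + j" r] assms(2) by simp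
  from spanned_isotopic[OF g isotopic_arc_inside this] show ?thesis
    by simp
qed

text \<open>At the far left a creation is itself an arc of length 0; anywhere else it is moved below
  the last arc. So this closure holds at all levels before crossings and annihilations are
  considered.\<close>

lemma spanned_creation:
  "spanned m f \<Longrightarrow> i + r = m \<Longrightarrow> spanned (m + 2) (\<lambda>v. f (Slice i Creation r # v))"
proof (induction arbitrary: i r rule: arc_spanned.induct)
  case base
  then show ?case
    using arc_spanned.arc[of D 0 0 D] arc_spanned.base[of D] by simp
next
  case (cong m f g)
  show ?case
    by (rule arc_spanned.cong[OF cong.IH[OF cong.prems]]) (use cong in auto)
next
  case (arc k r0 g)
  \<comment> \<open>A creation just left of the right end of the arc, \<open>i = Suc k\<close>,
    falls under the second alternative with \<open>j = 0\<close>.\<close>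
  consider "i = 0" | i' j where "i = Suc i'" "k = i' + j" | j where "i = k + 2 + j" "r0 = j + r"
  proof -
    have "i = 0 \<or> (\<exists>i' j. i = Suc i' \<and> k = i' + j) \<or> (\<exists>j. i = k + 2 + j \<and> r0 = j + r)"
      using arc.prems by presburger
    then show ?thesis
      using that by blast
  qed
  then show ?case
  proof cases
    case 1
    then show ?thesis
      using arc.prems arc_spanned.arc[of D 0 r "\<lambda>v. g (arc k r0 @ v)"] arc_spanned.arc[OF arc.hyps]
      by simp
  next
    case (2 i' j)
    then have "r = Suc (j + r0)"
      using arc.prems by simp
    with 2 show ?thesis
      using spanned_arc_inside[of i' Creation j r0 g] arc.hyps arc.IH[of i' "j + r0"] by (simp add: add_ac)
  next
    case (3 j)
    then show ?thesis
      using spanned_arc_right[of k j Creation r g] arc.hyps arc.IH[of "k + j" r] by (simp add: add_ac)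
  qed
qed (auto intro: arc_spanned.add arc_spanned.scale)

text \<open>A circle next to a strand contributes a constant factor. On level 0 there may be no such
  strand, but there the functional is a multiple of \<open>D\<close>: the empty diagram gives 0 on
  both sides, and any other diagram starts with a creation.\<close>

lemma spanned_circle:
  assumes "spanned r g"
  shows "spanned r (\<lambda>v. g ([Slice 0 Creation r, Slice 0 Annihilation r] @ v))"
proof (cases r)
  case 0
  have D: "D ([Slice 0 Creation 0, Slice 0 Annihilation 0] @ v) = ((\<alpha> - inverse \<alpha>) / z + 1) * D v"
    if v: "composable 0 v 0" for v
  proof (cases v)
    case Nil
    then show ?thesis
      using empty circle by simp
  next
    case (Cons a v')
    obtain l p r where a: "a = Slice l p r"
      by (cases a)
    with v Cons have "a = Slice 0 Creation 0" and v': "composable 2 v' 0"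
      by (cases p; auto simp: numeral_2_eq_2)+
    \<comment> \<open>Two exchanges lift the circle above the creation that follows it, whose
      strands then serve as neighbours.\<close>
    have "D ([Slice 0 Creation 0, Slice 0 Annihilation 0, Slice 0 Creation 0] @ v') =
      D ([Slice 0 Creation 0] @ [Slice 2 Creation 0, Slice 0 Annihilation 2] @ v')"
      using skein_functional_isotopic[OF skein_functional, of "[Slice 0 Creation 0]" 2
          "[Slice 0 Annihilation 0, Slice 0 Creation 0]" "[Slice 2 Creation 0, Slice 0 Annihilation 2]" 2 v']
        isotopic_exchange[of 0 Annihilation 0 Creation 0] v' by (simp add: numeral_2_eq_2)
    also have "\<dots> = D ([] @ [Slice 0 Creation 0, Slice 0 Creation 2] @ [Slice 0 Annihilation 2] @ v')"
      using skein_functional_isotopic[OF skein_functional, of "[]" 0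
          "[Slice 0 Creation 0, Slice 2 Creation 0]" "[Slice 0 Creation 0, Slice 0 Creation 2]" 4
          "[Slice 0 Annihilation 2] @ v'"]
        isotopic_exchange[of 0 Creation 0 Creation 0] v' by (simp add: numeral_eq_Suc)
    also have "\<dots> = ((\<alpha> - inverse \<alpha>) / z + 1) * D ([Slice 0 Creation 0] @ v')"
      using skein_functional_circle[OF skein_functional z_nonzero, of "[Slice 0 Creation 0]" 1 v'] v'
      by (simp add: numeral_2_eq_2)
    finally show ?thesis
      using Cons \<open>a = Slice 0 Creation 0\<close> by simp
  qed
  have "spanned m f \<Longrightarrow> m = 0 \<Longrightarrow> composable 0 v 0 \<Longrightarrow>
    f ([Slice 0 Creation 0, Slice 0 Annihilation 0] @ v) = ((\<alpha> - inverse \<alpha>) / z + 1) * f v" for m f v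
  proof (induction arbitrary: v rule: arc_spanned.induct)
    case (cong m f g)
    then show ?case
      using cong.hyps(2)[of "[Slice 0 Creation 0, Slice 0 Annihilation 0] @ v"] cong.hyps(2)[of v] by simp
  qed (use D in \<open>auto simp: distrib_left\<close>)
  from this[OF assms 0] show ?thesis
    by (intro arc_spanned.cong[OF arc_spanned.scale[OF assms, of "(\<alpha> - inverse \<alpha>) / z + 1"]]) (simp add: 0)
next
  case (Suc r')
  show ?thesis
    using arc_spanned.scale[OF assms]
  proof (rule arc_spanned.cong)
    show "((\<alpha> - inverse \<alpha>) / z + 1) * g v = g ([Slice 0 Creation r, Slice 0 Annihilation r] @ v)"
      if "composable r v 0" for v
      using skein_functional_circle[OF spanned_skein_functional[OF assms] z_nonzero, of "[]" r' v] that Suc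
      by simp
  qed
qed

definition crossing_closed :: "nat \<Rightarrow> bool" where
  "crossing_closed m \<longleftrightarrow>
     (\<forall>f p i r. spanned m f \<longrightarrow> is_crossing p \<longrightarrow> i + 2 + r = m \<longrightarrow> spanned m (\<lambda>v. f (Slice i p r # v)))"

definition annihilation_closed :: "nat \<Rightarrow> bool" where
  "annihilation_closed m \<longleftrightarrow>
     (\<forall>f i r. spanned m f \<longrightarrow> i + 2 + r = m \<longrightarrow> spanned (i + r) (\<lambda>v. f (Slice i Annihilation r # v)))"

lemma crossing_closedD:
  "crossing_closed m \<Longrightarrow> spanned m f \<Longrightarrow> is_crossing p \<Longrightarrow> i + 2 + r = m \<Longrightarrow>
    spanned m (\<lambda>v. f (Slice i p r # v))"
  unfolding crossing_closed_def by blast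

lemma annihilation_closedD:
  "annihilation_closed m \<Longrightarrow> spanned m f \<Longrightarrow> i + 2 + r = m \<Longrightarrow>
    spanned (i + r) (\<lambda>v. f (Slice i Annihilation r # v))"
  unfolding annihilation_closed_def by blast

text \<open>Joining the right end of the arc to its right neighbour pulls that strand to the far
  left. Sliding the last crossing past the annihilation shortens the arc and leaves a
  \<open>CrossBinv\<close>, which moves below the arc and is absorbed by the closure under crossings
  there. For \<open>k = 0\<close> a zigzag is straightened.\<close>

lemma spanned_arc_annihilation:
  assumes "crossing_closed (Suc (k + r))"
  shows "spanned (Suc (k + r)) g \<Longrightarrow>
    spanned (Suc (k + r)) (\<lambda>v. g (arc k (Suc r) @ Slice (Suc k) Annihilation r # v))"
  using assms
proof (induction k arbitrary: r g)
  case 0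
  have "spanned (1 + r) (\<lambda>v. g ([] @ v))"
    using 0 by simp
  from spanned_isotopic[OF _ _ this, of "Suc r" "[Slice 0 Creation (Suc r), Slice 1 Annihilation r]"]
    0 isotopic_straighten_right[of 0 r] show ?case
    by simp
next
  case (Suc k)
  let ?g = "\<lambda>v. g (Slice k CrossBinv r # v)"
  have "spanned (Suc (k + Suc r)) ?g"
    using crossing_closedD[OF Suc.prems(2,1), of CrossBinv k r] by simp
  then have *: "spanned (Suc (k + Suc r)) (\<lambda>v. ?g (arc k (Suc (Suc r)) @ Slice (Suc k) Annihilation (Suc r) # v))"
    using Suc.prems by (intro Suc.IH) auto
  have "isotopic (Suc (k + Suc r))
      (arc k (Suc (Suc r)) @ [Slice (Suc k) CrossB (Suc r), Slice (Suc (Suc k)) Annihilation r])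
      (arc k (Suc (Suc r)) @ [Slice (Suc (Suc k)) CrossBinv r, Slice (Suc k) Annihilation (Suc r)]) (Suc (k + Suc r))"
    using isotopic_annihilation_slide[of CrossBinv "Suc k" r, THEN isotopic_sym]
    by (intro isotopic_prefix[where b = "Suc k + 3 + r"]) (auto simp: composable_arc_iff)
  also have "isotopic (Suc (k + Suc r))
      ((arc k (0 + legs_in CrossBinv + r) @ [Slice (k + 2 + 0) CrossBinv r]) @ [Slice (Suc k) Annihilation (Suc r)])
      (([Slice (k + 0) CrossBinv r] @ arc k (0 + legs_out CrossBinv + r)) @ [Slice (Suc k) Annihilation (Suc r)])
      (Suc (k + Suc r))"
    using isotopic_arc_right[of k 0 CrossBinv r]
    by (intro isotopic_suffix[where c = "k + r + 4"]) (auto simp: numeral_eq_Suc)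
  then have "isotopic (Suc (k + Suc r))
      (arc k (Suc (Suc r)) @ [Slice (Suc (Suc k)) CrossBinv r, Slice (Suc k) Annihilation (Suc r)])
      ([Slice k CrossBinv r] @ arc k (Suc (Suc r)) @ [Slice (Suc k) Annihilation (Suc r)]) (Suc (k + Suc r))"
    by simp
  finally have "isotopic (Suc (k + Suc r))
      (arc (Suc k) (Suc r) @ [Slice (Suc (Suc k)) Annihilation r])
      ([Slice k CrossBinv r] @ arc k (Suc (Suc r)) @ [Slice (Suc k) Annihilation (Suc r)]) (Suc (k + Suc r))"
    by simp
  from spanned_isotopic[OF _ this, of g] Suc.prems(1) * show ?case
    by simp
qed

text \<open>The left end is joined to the first strand that the arc crosses. With that crossing it
  forms a curl of factor \<open>inverse \<alpha>\<close>, since sliding the creation turns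
  \<open>CrossB\<close> into \<open>CrossBinv\<close>; the later crossings of the arc commute with
  the annihilation and act on what remains.\<close>

lemma spanned_arc_annihilation_left:
  assumes "crossing_closed (Suc k + r)"
  shows "spanned (Suc k + r) g \<Longrightarrow>
    spanned (Suc k + r) (\<lambda>v. g (arc (Suc k) r @ Slice 0 Annihilation (Suc k + r) # v))"
  using assms
proof (induction k arbitrary: r g)
  case 0
  have g: "spanned (Suc r) g"
    using 0 by simp
  note sk = spanned_skein_functional[OF g]
  have "g (arc (Suc 0) r @ Slice 0 Annihilation (Suc 0 + r) # v) = inverse \<alpha> * g v"
    if v: "composable (Suc r) v 0" for v
  proof -
    have "g ([Slice 0 Creation (Suc r), Slice (Suc 0) CrossB r] @ [Slice 0 Annihilation (Suc r)] @ v) =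
      g ([Slice (Suc 0) Creation r, Slice 0 CrossBinv (Suc r)] @ [Slice 0 Annihilation (Suc r)] @ v)"
      using skein_functional_isotopic[OF sk, of "[]" "Suc r" "[Slice 0 Creation (Suc r), Slice (Suc 0) CrossB r]"
          "[Slice (Suc 0) Creation r, Slice 0 CrossBinv (Suc r)]" "3 + r" "[Slice 0 Annihilation (Suc r)] @ v"]
        isotopic_creation_slide[of CrossB 0 r] v by simp
    also have "\<dots> = inverse \<alpha> * g ([Slice (Suc 0) Creation r] @ [Slice 0 Annihilation (Suc r)] @ v)"
      using skein_functional_curl(2)[OF sk, of "[Slice (Suc 0) Creation r]" 0 "Suc r" v] v by simp
    also have "g ([Slice (Suc 0) Creation r] @ [Slice 0 Annihilation (Suc r)] @ v) = g v"
      using skein_functional_isotopic[OF sk, of "[]" "Suc r" "[Slice (Suc 0) Creation r, Slice 0 Annihilation (Suc r)]" "[]" "Suc r" v]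
        isotopic_straighten_left[of 0 r] v by simp
    finally show ?thesis
      by simp
  qed
  then show ?case
    by (intro arc_spanned.cong[OF arc_spanned.scale[OF 0(1), of "inverse \<alpha>"]]) simp
next
  case (Suc k)
  have g: "spanned (Suc k + Suc r) g" and closed: "crossing_closed (Suc k + Suc r)"
    using Suc.prems by simp_all
  have "isotopic (Suc k + Suc r)
      (arc (Suc k) (Suc r) @ [Slice (2 + k) CrossB r, Slice 0 Annihilation (k + 2 + r)])
      (arc (Suc k) (Suc r) @ [Slice 0 Annihilation (k + 2 + r), Slice k CrossB r]) (Suc k + Suc r)"
    using isotopic_exchange[of 0 Annihilation k CrossB r, THEN isotopic_sym]
    by (intro isotopic_prefix[where b = "k + 4 + r"]) (auto simp: composable_arc_iff numeral_eq_Suc simp del: arc.simps)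
  from spanned_isotopic[OF g this] crossing_closedD[OF closed Suc.IH[OF g closed], of CrossB k r]
  show ?case
    by (simp add: numeral_2_eq_2)
qed

text \<open>The annihilation can close the last arc to a circle, meet its left end, meet its right
  end from the right or from the left, lie under it, or lie to its right. Meeting the right end from
  the left gives a curl of factor \<alpha>; the last two positions reduce to an annihilation at
  level \<open>m\<close>.\<close>

lemma annihilation_closed_step:
  assumes "annihilation_closed m" "crossing_closed m"
  shows "annihilation_closed (m + 2)"
proof -
  have "spanned n f \<Longrightarrow> n = m + 2 \<Longrightarrow> i + 2 + r = n \<Longrightarrow> spanned (i + r) (\<lambda>v. f (Slice i Annihilation r # v))"
    for n f i r
  proof (induction rule: arc_spanned.induct)
    case (cong n f g)
    show ?case
      by (rule arc_spanned.cong[OF cong.IH[OF cong.prems]]) (use cong in auto)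
  next
    case (arc k r0 g)
    have g: "spanned m g" "m = k + r0"
      using arc.prems arc.hyps by simp_all
    consider "i = 0" "k = 0" | k' where "i = 0" "k = Suc k'" | "i = Suc k" | k' where "i = Suc k'" "k = Suc k'"
      | i' j where "i = Suc i'" "k = i' + 2 + j" | j where "i = k + 2 + j" "r0 = j + 2 + r"
    proof (cases i)
      case 0
      then show ?thesis
        using that by (cases k) auto
    next
      case (Suc i')
      consider "i' = k" | "k = Suc i'" | "i' + 2 \<le> k" | "k + 2 \<le> i"
        using Suc by linarith
      then show ?thesis
      proof cases
        case 3
        then show ?thesis
          using that(5)[OF Suc] le_Suc_ex by blast
      next
        case 4
        then obtain j where "i = k + 2 + j"
          using le_Suc_ex by blast
        then show ?thesis
          using that(6)[of j] arc.prems by simp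
      qed (use Suc that in auto)
    qed
    then show ?case
    proof cases
      case 1
      then show ?thesis
        using spanned_circle[OF g(1)] g arc.prems by simp
    next
      case (2 k')
      then show ?thesis
        using spanned_arc_annihilation_left[of k' r0 g] g arc.prems assms(2) by simp
    next
      case 3
      then have "r0 = Suc r"
        using arc.prems by simp
      with 3 show ?thesis
        using spanned_arc_annihilation[of k r g] g assms(2) by simp
    next
      case (4 k')
      then have r: "r0 = r"
        using arc.prems by simp
      have *: "spanned (Suc (k' + r)) (\<lambda>v. g (arc k' (Suc r) @ Slice (Suc k') Annihilation r # v))"
        using spanned_arc_annihilation[of k' r g] g 4 r assms(2) by simp
      have "g (arc k r @ Slice i Annihilation r # v) = \<alpha> * g (arc k' (Suc r) @ Slice (Suc k') Annihilation r # v)"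
        if "composable (Suc (k' + r)) v 0" for v
        using skein_functional_curl(1)[OF spanned_skein_functional[OF g(1)], of "arc k' (Suc r)" "Suc k'" r v]
          g 4 r that by (simp add: composable_arc_iff)
      then have "spanned (Suc (k' + r)) (\<lambda>v. g (arc k r @ Slice i Annihilation r # v))"
        by (intro arc_spanned.cong[OF arc_spanned.scale[OF *, of \<alpha>]]) (rule sym)
      then show ?thesis
        using 4 r by simp
    next
      case (5 i' j)
      then have r: "r = Suc (j + r0)"
        using arc.prems by simp
      have "spanned (i' + (j + r0)) (\<lambda>v. g (Slice i' Annihilation (j + r0) # v))"
        using annihilation_closedD[OF assms(1) g(1), of i' "j + r0"] g(2) 5 by simp
      then show ?thesis
        using spanned_arc_inside[of i' Annihilation j r0 g] g 5 r by (simp add: add_ac)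
    next
      case (6 j)
      have "spanned (k + j + r) (\<lambda>v. g (Slice (k + j) Annihilation r # v))"
        using annihilation_closedD[OF assms(1) g(1), of "k + j" r] g(2) 6 by simp
      then show ?thesis
        using spanned_arc_right[of k j Annihilation r g] g 6 by (simp add: add_ac)
    qed
  qed (auto intro: arc_spanned.add arc_spanned.scale)
  then show ?thesis
    unfolding annihilation_closed_def by blast
qed

text \<open>By the skein relation the two signs differ by a multiple of an annihilation followed by
  a creation, minus the identity, and both are available. Hence it is enough to treat the sign that
  suits the arc.\<close>

lemma spanned_switch_crossing:
  assumes f: "spanned m f" and "annihilation_closed m" and m: "i + 2 + r = m" and p: "is_crossing p"
    and opp: "spanned m (\<lambda>v. f (Slice i (opposite p) r # v))"
  shows "spanned m (\<lambda>v. f (Slice i p r # v))"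
proof -
  let ?h = "\<lambda>v. z * (f (Slice i Annihilation r # Slice i Creation r # v) - f v)"
  have "spanned (i + r) (\<lambda>v. f (Slice i Annihilation r # v))"
    using annihilation_closedD assms by blast
  from spanned_creation[OF this, of i r] have h: "spanned m ?h"
    using m f by (intro arc_spanned.scale spanned_diff) (simp_all add: add_ac)
  have skein: "f (Slice i CrossB r # v) - f (Slice i CrossBinv r # v) = ?h v" if "composable m v 0" for v
    using skein_functional_skein[OF spanned_skein_functional[OF f], of "[]" i r v] m that by auto
  show ?thesis
  proof (cases "p = CrossB")
    case True
    with arc_spanned.add[OF opp h] skein show ?thesis
      by (intro arc_spanned.cong[OF arc_spanned.add[OF opp h]]) (simp flip: skein)
  next
    case False
    with p have "p = CrossBinv"
      by simp
    then show ?thesis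
      by (intro arc_spanned.cong[OF spanned_diff[OF opp h]]) (simp flip: skein)
  qed
qed

text \<open>At the right end of the arc one sign is easy: \<open>CrossB\<close> with the right
  neighbour lengthens the arc, and \<open>CrossBinv\<close> with the left neighbour cancels its last
  crossing. The other sign follows by switching. Elsewhere the crossing moves below the arc;
  \<open>Suc i\<close> keeps it off the leftmost strand.\<close>

lemma spanned_crossing_inner:
  assumes closed: "crossing_closed m" "annihilation_closed (m + 2)"
  shows "spanned n f \<Longrightarrow> n = m + 2 \<Longrightarrow> Suc i + 2 + r = n \<Longrightarrow> is_crossing p \<Longrightarrow>
    spanned n (\<lambda>v. f (Slice (Suc i) p r # v))"
proof (induction rule: arc_spanned.induct)
  case (cong n f g)
  show ?case
    by (rule arc_spanned.cong[OF cong.IH[OF cong.prems]]) (use cong in auto)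
next
  case (arc k r0 g)
  have g: "spanned m g" "m = k + r0"
    using arc.prems arc.hyps by simp_all
  let ?f = "\<lambda>v. g (arc k r0 @ v)"
  have f: "spanned (m + 2) ?f"
    using arc_spanned.arc[of D k r0 g] g by simp
  have legs: "legs_in p = 2" "legs_out p = 2"
    using arc.prems by auto
  consider "i = k" | "k = Suc i" | j where "k = i + 2 + j" | j where "Suc i = k + 2 + j" "r0 = j + 2 + r"
  proof -
    consider "i = k" | "k = Suc i" | "i + 2 \<le> k" | "k + 2 \<le> Suc i"
      by linarith
    then show ?thesis
    proof cases
      case 3
      then show ?thesis
        using that(3) le_Suc_ex by blast
    next
      case 4
      then obtain j where "Suc i = k + 2 + j"
        using le_Suc_ex by blast
      then show ?thesis
        using that(4)[of j] arc.prems by simp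
    qed (use that in auto)
  qed
  then show ?case
  proof cases
    case 1
    then have r0: "r0 = Suc r"
      using arc.prems by simp
    have "spanned (m + 2) (\<lambda>v. g (arc (Suc k) r @ v))"
      using arc_spanned.arc[of D "Suc k" r g] g r0 by simp
    then have B: "spanned (m + 2) (\<lambda>v. ?f (Slice (Suc i) CrossB r # v))"
      using 1 r0 by simp
    have "spanned (m + 2) (\<lambda>v. ?f (Slice (Suc i) CrossBinv r # v))"
      by (rule spanned_switch_crossing[OF f closed(2), of _ r]) (use B arc.prems in auto)
    with B show ?thesis
      using arc.prems g by auto
  next
    case 2
    then have r0: "r0 = r"
      using arc.prems by simp
    have "isotopic m (arc i (Suc r) @ [Slice (Suc i) CrossB r, Slice (Suc i) CrossBinv r]) (arc i (Suc r) @ []) (m + 2)"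
      using isotopic_cancel[of CrossB "Suc i" r] g(2) 2 r0
      by (intro isotopic_prefix[where b = "Suc i + 2 + r"]) (auto simp: composable_arc_iff)
    moreover have "spanned (m + 2) (\<lambda>v. g (arc i (Suc r) @ v))"
      using arc_spanned.arc[of D i "Suc r" g] g 2 r0 by simp
    ultimately have Binv: "spanned (m + 2) (\<lambda>v. ?f (Slice (Suc i) CrossBinv r # v))"
      using spanned_isotopic[OF g(1), of "arc i (Suc r) @ [Slice (Suc i) CrossB r, Slice (Suc i) CrossBinv r]"
          "arc i (Suc r) @ []" "m + 2"] 2 r0 by simp
    have "spanned (m + 2) (\<lambda>v. ?f (Slice (Suc i) CrossB r # v))"
      by (rule spanned_switch_crossing[OF f closed(2), of _ r]) (use Binv arc.prems in auto)
    with Binv show ?thesis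
      using arc.prems g by auto
  next
    case (3 j)
    then have r: "r = Suc (j + r0)"
      using arc.prems by simp
    have "spanned m (\<lambda>v. g (Slice i p (j + r0) # v))"
      using crossing_closedD[OF closed(1) g(1) arc.prems(3), of i "j + r0"] g(2) 3 by simp
    then show ?thesis
      using spanned_arc_inside[of i p j r0 g] g 3 r legs by (simp add: add_ac)
  next
    case (4 j)
    have "spanned m (\<lambda>v. g (Slice (k + j) p r # v))"
      using crossing_closedD[OF closed(1) g(1) arc.prems(3), of "k + j" r] g(2) 4 by simp
    then show ?thesis
      using spanned_arc_right[of k j p r g] g 4 legs by (simp add: add_ac)
  qed
qed (auto intro: arc_spanned.add arc_spanned.scale)

text \<open>Sliding the creation turns the first crossing of the arc into a \<open>CrossBinv\<close>
  on the two leftmost strands, which cancels the given \<open>CrossB\<close> and leaves a creation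
  one place further right. The other crossings of the arc commute with it and avoid the leftmost
  strand, so the hypothesis covers them.\<close>

lemma spanned_arc_crossing_left:
  assumes closed: "\<And>f p i r. spanned (k + r0 + 3) f \<Longrightarrow> Suc i + 2 + r = k + r0 + 3 \<Longrightarrow> is_crossing p \<Longrightarrow>
    spanned (k + r0 + 3) (\<lambda>v. f (Slice (Suc i) p r # v))"
  shows "spanned (Suc k + r0) g \<Longrightarrow>
    spanned (k + r0 + 3) (\<lambda>v. g (arc (Suc k) r0 @ Slice 0 CrossB (Suc k + r0) # v))"
  using assms
proof (induction k arbitrary: r0)
  case 0
  then have g: "spanned (Suc r0) g"
    by simp
  have "isotopic (Suc r0) ([Slice 0 Creation (Suc r0), Slice (Suc 0) CrossB r0] @ [Slice 0 CrossB (Suc r0)])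
    ([Slice (Suc 0) Creation r0, Slice 0 CrossBinv (Suc r0)] @ [Slice 0 CrossB (Suc r0)]) (r0 + 3)"
    using isotopic_creation_slide[of CrossB 0 r0]
    by (intro isotopic_suffix[where c = "r0 + 3"]) (auto simp: numeral_eq_Suc)
  moreover have "isotopic (Suc r0) ([Slice (Suc 0) Creation r0] @ [Slice 0 CrossBinv (Suc r0), Slice 0 CrossB (Suc r0)])
    ([Slice (Suc 0) Creation r0] @ []) (r0 + 3)"
    using isotopic_cancel[of CrossBinv 0 "Suc r0"]
    by (intro isotopic_prefix[where b = "r0 + 3"]) (auto simp: numeral_eq_Suc)
  ultimately have *: "isotopic (Suc r0) ([Slice 0 Creation (Suc r0), Slice (Suc 0) CrossB r0] @ [Slice 0 CrossB (Suc r0)])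
    [Slice (Suc 0) Creation r0] (r0 + 3)"
    by (auto intro: isotopic_trans)
  have "spanned (r0 + 3) (\<lambda>v. g ([Slice (Suc 0) Creation r0] @ v))"
    using spanned_creation[OF g, of 1 r0] by (simp add: numeral_3_eq_3)
  from spanned_isotopic[OF g * this] show ?case
    by simp
next
  case (Suc k)
  have g: "spanned (Suc k + Suc r0) g"
    using Suc.prems by simp
  have IH: "spanned (k + Suc r0 + 3) (\<lambda>v. g (arc (Suc k) (Suc r0) @ Slice 0 CrossB (Suc k + Suc r0) # v))"
    using Suc.prems by (intro Suc.IH) auto
  have "isotopic (Suc k + Suc r0)
      (arc (Suc k) (Suc r0) @ [Slice (2 + k) CrossB r0, Slice 0 CrossB (k + 2 + r0)])
      (arc (Suc k) (Suc r0) @ [Slice 0 CrossB (k + 2 + r0), Slice (2 + k) CrossB r0]) (k + Suc r0 + 3)"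
    using isotopic_exchange[of 0 CrossB k CrossB r0, THEN isotopic_sym]
    by (intro isotopic_prefix[where b = "k + 4 + r0"]) (auto simp: composable_arc_iff numeral_eq_Suc simp del: arc.simps)
  from spanned_isotopic[OF g this] Suc.prems(2)[of "\<lambda>v. g (arc (Suc k) (Suc r0) @ Slice 0 CrossB (Suc k + Suc r0) # v)" "Suc k" r0 CrossB] IH
  show ?case
    by (simp add: numeral_2_eq_2)
qed

text \<open>Only the two leftmost strands remain. For \<open>k = 0\<close> the crossing is a curl at
  a creation, with factor \<alpha>; for the other sign the crossing is switched.\<close>

lemma crossing_closed_step:
  assumes closed: "crossing_closed m" "annihilation_closed (m + 2)"
  shows "crossing_closed (m + 2)"
proof -
  have "spanned n f \<Longrightarrow> n = m + 2 \<Longrightarrow> spanned n (\<lambda>v. f (Slice 0 CrossB m # v))" for n f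
  proof (induction rule: arc_spanned.induct)
    case (cong n f g)
    show ?case
      by (rule arc_spanned.cong[OF cong.IH[OF cong.prems]]) (use cong in auto)
  next
    case (arc k r g)
    have g: "spanned (k + r) g" "m = k + r"
      using arc.prems arc.hyps by simp_all
    show ?case
    proof (cases k)
      case 0
      have "\<alpha> * g (arc 0 r @ v) = g (arc 0 r @ Slice 0 CrossB r # v)" if "composable (r + 2) v 0" for v
        using skein_functional_creation_curl[OF spanned_skein_functional, of r g v] that g 0 by simp
      then have "spanned (k + r + 2) (\<lambda>v. g (arc k r @ Slice 0 CrossB r # v))"
        using 0 by (intro arc_spanned.cong[OF arc_spanned.scale[OF arc_spanned.arc[OF g(1)], of \<alpha>]]) simp
      with 0 g show ?thesis
        by simp
    next
      case (Suc k')
      have "spanned (k' + r + 3) (\<lambda>v. g (arc (Suc k') r @ Slice 0 CrossB (Suc k' + r) # v))"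
        using g Suc spanned_crossing_inner[OF closed]
        by (intro spanned_arc_crossing_left) (auto simp: numeral_eq_Suc)
      with Suc g show ?thesis
        by (simp add: numeral_eq_Suc)
    qed
  qed (auto intro: arc_spanned.add arc_spanned.scale)
  then have B: "spanned (m + 2) (\<lambda>v. f (Slice 0 CrossB m # v))" if "spanned (m + 2) f" for f
    using that by blast
  have "spanned (m + 2) (\<lambda>v. f (Slice 0 p m # v))" if "spanned (m + 2) f" "is_crossing p" for f p
    using B[OF that(1)] spanned_switch_crossing[OF that(1) closed(2) _ that(2), of 0 m] that(2) by auto
  then have "spanned (m + 2) (\<lambda>v. f (Slice i p r # v))"
    if "spanned (m + 2) f" "is_crossing p" "i + 2 + r = m + 2" for f p i r
    using that spanned_crossing_inner[OF closed that(1) refl] by (cases i) auto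
  then show ?thesis
    unfolding crossing_closed_def by blast
qed

text \<open>Annihilations at level \<open>m + 2\<close> rest on both closures at level
  \<open>m\<close>. Crossings at level \<open>m + 2\<close> come afterwards, because switching one
  introduces an annihilation at its own level.\<close>

lemma closed: "annihilation_closed m \<and> crossing_closed m"
proof (induction m rule: less_induct)
  case (less m)
  show ?case
  proof (cases "m < 2")
    case True
    then show ?thesis
      by (auto simp: annihilation_closed_def crossing_closed_def)
  next
    case False
    then obtain m' where "m = m' + 2"
      by (metis add.commute le_add_diff_inverse not_less)
    then show ?thesis
      using less[of m'] annihilation_closed_step[of m'] crossing_closed_step[of m'] by simp
  qed
qed

lemma spanned_diagram: "composable 0 w m \<Longrightarrow> spanned m (\<lambda>v. D (w @ v))"
proof (induction w arbitrary: m rule: rev_induct)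
  case Nil
  then show ?case
    by (simp add: arc_spanned.base)
next
  case (snoc s w)
  obtain l p r where s: "s = Slice l p r"
    by (cases s)
  with snoc have f: "spanned (l + legs_in p + r) (\<lambda>v. D (w @ v))" and m: "m = l + legs_out p + r"
    by (auto simp: composable_append)
  show ?case
  proof (cases p)
    case Creation
    then show ?thesis
      using spanned_creation[OF f, of l r] s m by simp
  next
    case Annihilation
    then show ?thesis
      using annihilation_closedD[OF _ f, of l r] closed s m by simp
  qed (use crossing_closedD[OF _ f, of p l r] closed s m in auto)
qed

text \<open>The functional \<open>v \<mapsto> D (w @ v)\<close> has level 0, so it is a multiple of
  \<open>D\<close>; its value at the empty list is therefore a multiple of
  \<open>D [] = 0\<close>.\<close>

lemma vanishes:
  assumes "composable 0 w 0"
  shows "D w = 0"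
proof -
  have "spanned m f \<Longrightarrow> m = 0 \<Longrightarrow> f [] = 0" for m f
    by (induction rule: arc_spanned.induct) (auto simp: empty)
  from this[OF spanned_diagram[OF assms]] show ?thesis
    by simp
qed

end


section \<open>From Kauffman invariants to skein functionals\<close>

lemma kauffman_invariant_isotopic:
  assumes A: "kauffman_invariant z \<alpha> A"
  shows "isotopic a x y b \<Longrightarrow> composable 0 u a \<Longrightarrow> composable b v 0 \<Longrightarrow>
    (if u @ x @ v = [] then 0 else A (u @ x @ v)) = (if u @ y @ v = [] then 0 else A (u @ y @ v))"
proof (induction arbitrary: u v rule: isotopic.induct)
  case (isotopic_move x y a b)
  \<comment> \<open>A move that produces the empty list takes place on at least one strand, so the
    surrounding diagram is not empty.\<close>
  have "u @ x @ v \<noteq> []" "u @ y @ v \<noteq> []"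
    using isotopic_move by (auto elim!: local_move.cases)
  then have "link_diagram (u @ x @ v)" "link_diagram (u @ y @ v)"
    using isotopic_move by (auto simp: link_diagram_def composable_append)
  moreover from this have "regularly_isotopic (u @ x @ v) (u @ y @ v)"
    unfolding regularly_isotopic_def regular_isotopy_step_def using isotopic_move.hyps(1) by blast
  ultimately show ?case
    using A \<open>u @ x @ v \<noteq> []\<close> \<open>u @ y @ v \<noteq> []\<close> unfolding kauffman_invariant_def by auto
next
  case (isotopic_append a x y b x' y' c)
  have "composable b (x' @ v) 0" "composable 0 (u @ y) b"
    using isotopic_append.prems isotopic_composable[OF isotopic_append.hyps(1)] isotopic_composable[OF isotopic_append.hyps(2)]
    by (auto simp: composable_append)
  then show ?case
    using isotopic_append.IH(1)[of u "x' @ v"] isotopic_append.IH(2)[of "u @ y" v] isotopic_append.prems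
    by (simp only: append_assoc)
qed auto

lemma kauffman_invariant_skein_functional:
  assumes A: "kauffman_invariant z \<alpha> A"
  shows "skein_functional z \<alpha> 0 (\<lambda>K. if K = [] then 0 else A K)"
  unfolding skein_functional_def
proof (intro conjI allI impI)
  fix u a x y b v
  assume "composable 0 u a" "isotopic a x y b" "composable b v 0"
  then show "(if u @ x @ v = [] then 0 else A (u @ x @ v)) = (if u @ y @ v = [] then 0 else A (u @ y @ v))"
    by (intro kauffman_invariant_isotopic[OF A])
next
  fix u l r v
  assume *: "composable 0 u (l + 2 + r)" "composable (l + 2 + r) v 0"
  then have "u \<noteq> []" "link_diagram (u @ [Slice l CrossB r] @ v)"
    by (auto simp: link_diagram_def composable_append)
  with A show "(if u @ [Slice l CrossB r] @ v = [] then 0 else A (u @ [Slice l CrossB r] @ v))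
      - (if u @ [Slice l CrossBinv r] @ v = [] then 0 else A (u @ [Slice l CrossBinv r] @ v)) =
    z * ((if u @ [Slice l Annihilation r, Slice l Creation r] @ v = [] then 0
          else A (u @ [Slice l Annihilation r, Slice l Creation r] @ v))
      - (if u @ v = [] then 0 else A (u @ v)))"
    unfolding kauffman_invariant_def by simp
next
  fix u l r v
  assume *: "composable 0 u (l + 2 + r)" "composable (l + r) v 0"
  then have "link_diagram (u @ [Slice l Annihilation r] @ v)"
    by (auto simp: link_diagram_def composable_append)
  with A show "(if u @ [Slice l CrossB r, Slice l Annihilation r] @ v = [] then 0
        else A (u @ [Slice l CrossB r, Slice l Annihilation r] @ v)) =
      \<alpha> * (if u @ [Slice l Annihilation r] @ v = [] then 0 else A (u @ [Slice l Annihilation r] @ v))"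
    "(if u @ [Slice l CrossBinv r, Slice l Annihilation r] @ v = [] then 0
        else A (u @ [Slice l CrossBinv r, Slice l Annihilation r] @ v)) =
      inverse \<alpha> * (if u @ [Slice l Annihilation r] @ v = [] then 0 else A (u @ [Slice l Annihilation r] @ v))"
    unfolding kauffman_invariant_def by simp_all
qed

lemma kauffman_invariant_unique:
  assumes z: "z \<noteq> 0" and A: "kauffman_invariant z \<alpha> A" and B: "kauffman_invariant z \<alpha> B"
    and K: "link_diagram K"
  shows "A K = B K"
proof -
  let ?D = "\<lambda>K. (if K = [] then 0 else A K) + - 1 * (if K = [] then 0 else B K)"
  interpret kauffman_difference z \<alpha> ?D
  proof
    show "skein_functional z \<alpha> 0 ?D"
      by (intro skein_functional_add skein_functional_scale kauffman_invariant_skein_functional A B)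
  qed (use z A B in \<open>auto simp: kauffman_invariant_def\<close>)
  show ?thesis
    using vanishes[of K] K by (auto simp: link_diagram_def)
qed


section \<open>The Yang--Baxter equation\<close>

text \<open>
  The label \<open>a\<close> is represented by the integer \<open>2 a - N\<close>, so that complementary labels are negatives of
  each other. If \<open>0\<close> is not in \<open>J\<close> (types C and D), then \<open>\<zeta> 0\<close> is a dummy value.
\<close>

locale braiding_data =
  fixes J :: "int set" and s \<alpha> :: "'a::field" and \<zeta> :: "int \<Rightarrow> 'a"
  assumes finite_J: "finite J"
    and uminus_J: "a \<in> J \<Longrightarrow> - a \<in> J"
    and positive: "\<exists>a\<in>J. 0 < a"
    and s_nonzero: "s \<noteq> 0"
    and zeta_uminus: "a \<in> J \<Longrightarrow> \<zeta> a * \<zeta> (- a) = 1"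
    and zeta_0: "\<zeta> 0 = 1"
    and zeta_partial_sum: "a \<in> J \<Longrightarrow> (s - inverse s) * (\<Sum>e | e \<in> J \<and> e < a. \<zeta> e ^ 2) =
      \<alpha> + (if 0 < a then s - inverse s else 0) - (if a = 0 then 1 else s) * \<zeta> a ^ 2"
begin

section \<open>The braiding matrix in uniform notation\<close>

definition z :: 'a where "z = s - inverse s"

definition g :: "int \<Rightarrow> int \<Rightarrow> 'a" where
  "g u v = (if u = v then if u = 0 then 1 else inverse s else if u + v = 0 then s else 1)"

text \<open>A sum of three contributions that may overlap: for complementary \<open>u\<close>,
  \<open>v\<close> the diagonal \<open>- z\<close> meets the pair term, and this overlap is the
  Kronecker delta in the coefficients \<open>beta\<close>.\<close>

definition R :: "int \<Rightarrow> int \<Rightarrow> int \<Rightarrow> int \<Rightarrow> 'a" where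
  "R u v p q = (if p = v \<and> q = u then g u v else 0) - (if u < v \<and> p = u \<and> q = v then z else 0)
    + (if u + v = 0 \<and> p + q = 0 \<and> u < q then z * \<zeta> u * \<zeta> p else 0)"

lemma zeta_nonzero: "a \<in> J \<Longrightarrow> \<zeta> a \<noteq> 0"
  using zeta_uminus by fastforce

lemma zeta_uminus_inverse: "a \<in> J \<Longrightarrow> \<zeta> (- a) = inverse (\<zeta> a)"
  using zeta_uminus[of a] by (metis inverse_unique)

lemma g_commute: "g u v = g v u"
  by (simp add: g_def add.commute)

lemma g_uminus: "g (- u) (- v) = g u v"
proof -
  have "- u + - v = 0 \<longleftrightarrow> u + v = 0"
    by linarith
  then show ?thesis
    by (simp add: g_def)
qed

lemma R_transpose: "R u v p q = R p q u v"
proof -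
  have "u + v = 0 \<and> p + q = 0 \<and> u < q \<longleftrightarrow> p + q = 0 \<and> u + v = 0 \<and> p < v"
    by linarith
  moreover have "(if p = v \<and> q = u then g u v else 0) = (if u = q \<and> v = p then g p q else 0)"
    by (simp add: g_commute)
  moreover have "u < v \<and> p = u \<and> q = v \<longleftrightarrow> p < q \<and> u = p \<and> v = q"
    by blast
  ultimately show ?thesis
    unfolding R_def by (simp only: mult.assoc mult.commute[of "\<zeta> u"])
qed

text \<open>Reversing the order of the labels and taking complements preserves each of the three
  contributions. On triples of labels this interchanges the two sides of the Yang--Baxter
  equation.\<close>

lemma R_flip: "R u v p q = R (- v) (- u) (- q) (- p)"
proof -
  have "u + v = 0 \<and> p + q = 0 \<and> u < q \<longleftrightarrow> - v + - u = 0 \<and> - q + - p = 0 \<and> - v < - p"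
    by linarith
  moreover have "(if p = v \<and> q = u then g u v else 0) = (if - q = - u \<and> - p = - v then g (- v) (- u) else 0)"
    by (simp add: g_uminus g_commute conj_commute)
  moreover have "u < v \<and> p = u \<and> q = v \<longleftrightarrow> - v < - u \<and> - q = - v \<and> - p = - u"
    by linarith
  moreover have "\<zeta> a = \<zeta> (- b)" if "a + b = 0" for a b
    using that by (simp add: eq_neg_iff_add_eq_0[symmetric])
  ultimately show ?thesis
    unfolding R_def by (smt (verit, best))
qed

lemma uminus_mem_J [simp]: "- a \<in> J \<longleftrightarrow> a \<in> J"
  using uminus_J by fastforce

section \<open>Sums against the braiding matrix\<close>

lemma sum_R:
  assumes "u \<in> J" "v \<in> J"
  shows "(\<Sum>i\<in>J. \<Sum>j\<in>J. R u v i j * F i j) =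
    g u v * F v u - (if u < v then z * F u v else 0)
    + (if u + v = 0 then z * \<zeta> u * (\<Sum>j | j \<in> J \<and> u < j. \<zeta> (- j) * F (- j) j) else 0)"
proof -
  have "(\<Sum>i\<in>J. \<Sum>j\<in>J. R u v i j * F i j) =
      (\<Sum>j\<in>J. \<Sum>i\<in>J. (if i = v then if j = u then g u v * F i j else 0 else 0))
    - (\<Sum>j\<in>J. \<Sum>i\<in>J. (if i = u then if u < v \<and> j = v then z * F i j else 0 else 0))
    + (\<Sum>j\<in>J. \<Sum>i\<in>J. (if i = - j then if u + v = 0 \<and> u < j then z * \<zeta> u * \<zeta> i * F i j else 0 else 0))"
    unfolding sum_subtractf[symmetric] sum.distrib[symmetric]
    by (subst sum.swap, intro sum.cong refl) (auto simp: R_def algebra_simps)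
  also have "\<dots> = g u v * F v u - (if u < v then z * F u v else 0)
    + (\<Sum>j\<in>J. if u + v = 0 \<and> u < j then z * \<zeta> u * \<zeta> (- j) * F (- j) j else 0)"
    using assms by (simp add: sum.delta finite_J)
  also have "(\<Sum>j\<in>J. if u + v = 0 \<and> u < j then z * \<zeta> u * \<zeta> (- j) * F (- j) j else 0) =
    (if u + v = 0 then z * \<zeta> u * (\<Sum>j | j \<in> J \<and> u < j. \<zeta> (- j) * F (- j) j) else 0)"
    by (auto simp: sum_distrib_left finite_J mult.assoc intro!: sum.mono_neutral_cong_right split: if_splits)
  finally show ?thesis .
qed

lemma sum_R_left:
  assumes "u \<in> J" "v \<in> J" "q \<in> J"
  shows "(\<Sum>i\<in>J. R u v i q * F i) =
    (if q = u then g u v * F v else 0) - (if u < v \<and> q = v then z * F u else 0)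
    + (if u + v = 0 \<and> u < q then z * \<zeta> u * \<zeta> (- q) * F (- q) else 0)"
proof -
  have "(\<Sum>i\<in>J. R u v i q * F i) =
      (\<Sum>i\<in>J. (if i = v then if q = u then g u v * F i else 0 else 0))
    - (\<Sum>i\<in>J. (if i = u then if u < v \<and> q = v then z * F i else 0 else 0))
    + (\<Sum>i\<in>J. (if i = - q then if u + v = 0 \<and> u < q then z * \<zeta> u * \<zeta> i * F i else 0 else 0))"
    unfolding sum_subtractf[symmetric] sum.distrib[symmetric]
    by (intro sum.cong refl) (auto simp: R_def algebra_simps)
  then show ?thesis
    using assms by (simp add: sum.delta finite_J)
qed

lemma sum_R_right:
  assumes "u \<in> J" "v \<in> J" "p \<in> J"
  shows "(\<Sum>j\<in>J. R u v p j * F j) =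
    (if p = v then g u v * F u else 0) - (if u < v \<and> p = u then z * F v else 0)
    + (if u + v = 0 \<and> u < - p then z * \<zeta> u * \<zeta> p * F (- p) else 0)"
proof -
  have "(\<Sum>j\<in>J. R u v p j * F j) =
      (\<Sum>j\<in>J. (if j = u then if p = v then g u v * F j else 0 else 0))
    - (\<Sum>j\<in>J. (if j = v then if u < v \<and> p = u then z * F j else 0 else 0))
    + (\<Sum>j\<in>J. (if j = - p then if u + v = 0 \<and> u < j then z * \<zeta> u * \<zeta> p * F j else 0 else 0))"
    unfolding sum_subtractf[symmetric] sum.distrib[symmetric]
    by (intro sum.cong refl) (auto simp: R_def algebra_simps)
  then show ?thesis
    using assms by (simp add: sum.delta finite_J)
qed

text \<open>Closed form of \<open>z\<close> times the sum of \<open>\<zeta> (- j) ^ 2\<close> over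
  the labels strictly between \<open>l\<close> and \<open>h\<close>, obtained as a difference of two
  partial sums. Leaving out the end point \<open>h\<close> changes its coefficient from
  \<open>s\<close> to \<open>s - z = inverse s\<close>, or from 1 to \<open>1 - z\<close> at the
  label 0.\<close>

definition W :: "int \<Rightarrow> int \<Rightarrow> 'a" where
  "W l h = (if l < h then (if l < 0 then z else 0) - (if h < 0 then z else 0)
     - (if l = 0 then 1 else s) * \<zeta> (- l) ^ 2 + (if h = 0 then 1 - z else inverse s) * \<zeta> (- h) ^ 2 else 0)"

lemma sum_zeta_between:
  assumes "l \<in> J" "h \<in> J"
  shows "z * (\<Sum>j | j \<in> J \<and> l < j \<and> j < h. \<zeta> (- j) ^ 2) = W l h"
proof (cases "l < h")
  case True
  have "(\<Sum>e | e \<in> J \<and> e < - l. \<zeta> e ^ 2) =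
    (\<Sum>e \<in> {e \<in> J. e < - h} \<union> ({- h} \<union> {e \<in> J. - h < e \<and> e < - l}). \<zeta> e ^ 2)"
    using True assms by (intro sum.cong) auto
  also have "\<dots> = (\<Sum>e | e \<in> J \<and> e < - h. \<zeta> e ^ 2) + (\<zeta> (- h) ^ 2 + (\<Sum>e | e \<in> J \<and> - h < e \<and> e < - l. \<zeta> e ^ 2))"
    by (subst sum.union_disjoint; (subst sum.union_disjoint)?) (auto simp: finite_J)
  also have "(\<Sum>e | e \<in> J \<and> - h < e \<and> e < - l. \<zeta> e ^ 2) = (\<Sum>j | j \<in> J \<and> l < j \<and> j < h. \<zeta> (- j) ^ 2)"
    by (rule sum.reindex_bij_witness[of _ uminus uminus]) auto
  finally have "z * (\<Sum>j | j \<in> J \<and> l < j \<and> j < h. \<zeta> (- j) ^ 2) =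
    z * (\<Sum>e | e \<in> J \<and> e < - l. \<zeta> e ^ 2) - z * (\<Sum>e | e \<in> J \<and> e < - h. \<zeta> e ^ 2)
    - z * \<zeta> (- h) ^ 2"
    by (simp add: algebra_simps)
  also have "\<dots> = W l h"
    using True assms
    by (simp add: zeta_partial_sum[folded z_def] W_def) (simp add: z_def algebra_simps)
  finally show ?thesis .
next
  case False
  then have "{j \<in> J. l < j \<and> j < h} = {}"
    by auto
  with False show ?thesis
    by (simp only: W_def if_False sum.empty mult_zero_right)
qed

text \<open>Value of the sum in \<open>sum_R_between\<close>. In the pair term of
  \<open>R (- j) j p q\<close> the order condition reads \<open>p < j\<close>; together with
  \<open>l < j\<close> it gives the lower bound \<open>max l p\<close>.\<close>

definition T :: "int \<Rightarrow> int \<Rightarrow> int \<Rightarrow> int \<Rightarrow> 'a" where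
  "T l h p q = (if p + q = 0 then
     (if l < p \<and> p < h then \<zeta> (- p) * g p (- p) else 0) - (if l < q \<and> q < h \<and> 0 < q then z * \<zeta> p else 0)
     + \<zeta> p * W (max l p) h else 0)"

lemma sum_R_between:
  assumes "l \<in> J" "h \<in> J" "p \<in> J" "q \<in> J"
  shows "(\<Sum>j | j \<in> J \<and> l < j \<and> j < h. \<zeta> (- j) * R (- j) j p q) = T l h p q"
proof (cases "p + q = 0")
  case True
  then have q: "q = - p"
    by simp
  have "(\<Sum>j | j \<in> J \<and> l < j \<and> j < h. \<zeta> (- j) * R (- j) j p q) =
    (\<Sum>j | j \<in> J \<and> l < j \<and> j < h. (if j = p then \<zeta> (- p) * g p (- p) else 0)
      - (if j = q then if 0 < q then z * \<zeta> p else 0 else 0)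
      + \<zeta> p * (z * (if p < j then \<zeta> (- j) ^ 2 else 0)))"
    by (intro sum.cong refl) (auto simp: R_def q power2_eq_square algebra_simps g_def)
  also have "\<dots> = (if l < p \<and> p < h then \<zeta> (- p) * g p (- p) else 0)
    - (if l < q \<and> q < h \<and> 0 < q then z * \<zeta> p else 0)
    + \<zeta> p * (z * (\<Sum>j | j \<in> J \<and> l < j \<and> j < h. (if p < j then \<zeta> (- j) ^ 2 else 0)))"
    using assms by (simp add: sum.distrib sum_subtractf sum_distrib_left[symmetric] finite_J sum.delta)
  also have "(\<Sum>j | j \<in> J \<and> l < j \<and> j < h. (if p < j then \<zeta> (- j) ^ 2 else 0)) =
    (\<Sum>j | j \<in> J \<and> max l p < j \<and> j < h. \<zeta> (- j) ^ 2)"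
    by (rule sum.mono_neutral_cong_right) (auto simp: finite_J)
  also have "z * \<dots> = W (max l p) h"
    using assms by (intro sum_zeta_between) (auto simp: max_def)
  finally show ?thesis
    using True by (simp add: T_def)
next
  case False
  then have "R (- j) j p q = 0" for j
    by (auto simp: R_def)
  with False show ?thesis
    by (simp add: T_def)
qed

section \<open>The two sides of the Yang--Baxter equation\<close>

definition YB_left :: "int \<Rightarrow> int \<Rightarrow> int \<Rightarrow> int \<Rightarrow> int \<Rightarrow> int \<Rightarrow> 'a" where
  "YB_left u v w p q r = (\<Sum>i\<in>J. \<Sum>j\<in>J. R u v i j * (\<Sum>k\<in>J. R j w k r * R i k p q))"

definition YB_right :: "int \<Rightarrow> int \<Rightarrow> int \<Rightarrow> int \<Rightarrow> int \<Rightarrow> int \<Rightarrow> 'a" where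
  "YB_right u v w p q r = (\<Sum>i\<in>J. \<Sum>j\<in>J. R v w i j * (\<Sum>k\<in>J. R u i p k * R k j q r))"

text \<open>The sum over \<open>k\<close> in \<open>YB_left\<close>: since \<open>j\<close>,
  \<open>w\<close> and \<open>r\<close> are fixed in its first factor, only \<open>k = w\<close>,
  \<open>k = j\<close> and \<open>k = - r\<close> can contribute.\<close>

definition left_inner where
  "left_inner w p q r i j = (if r = j then g j w * R i w p q else 0) - (if j < w \<and> r = w then z * R i j p q else 0)
     + (if j + w = 0 \<and> j < r then z * \<zeta> j * \<zeta> (- r) * R i (- r) p q else 0)"

definition right_inner where
  "right_inner u p q r i j = (if p = i then g u i * R u j q r else 0) - (if u < i \<and> p = u then z * R i j q r else 0)
     + (if u + i = 0 \<and> u < - p then z * \<zeta> u * \<zeta> p * R (- p) j q r else 0)"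

text \<open>A sum over a label survives only if \<open>u\<close> and \<open>v\<close> are
  complementary. Two of its parts are concentrated at a single label, and the third is a bounded sum
  of the kind evaluated by \<open>T\<close>.\<close>

lemma YB_left_eq:
  assumes "u \<in> J" "v \<in> J" "w \<in> J" "p \<in> J" "q \<in> J" "r \<in> J"
  shows "YB_left u v w p q r = g u v * left_inner w p q r v u - (if u < v then z * left_inner w p q r u v else 0)
    + (if u + v = 0 then z * \<zeta> u * ((if u < r then \<zeta> (- r) * g r w * R (- r) w p q else 0)
         - (if r = w then z * T u w p q else 0)
         + (if u < - w \<and> - w < r then z * \<zeta> (- r) * R w (- r) p q else 0)) else 0)"
proof -
  have "YB_left u v w p q r = (\<Sum>i\<in>J. \<Sum>j\<in>J. R u v i j * left_inner w p q r i j)"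
    unfolding YB_left_def using assms by (intro sum.cong refl) (simp add: sum_R_left left_inner_def)
  also have "\<dots> = g u v * left_inner w p q r v u - (if u < v then z * left_inner w p q r u v else 0)
    + (if u + v = 0 then z * \<zeta> u * (\<Sum>j | j \<in> J \<and> u < j. \<zeta> (- j) * left_inner w p q r (- j) j) else 0)"
    using assms(1,2) by (rule sum_R)
  also have "(\<Sum>j | j \<in> J \<and> u < j. \<zeta> (- j) * left_inner w p q r (- j) j) =
     (\<Sum>j | j \<in> J \<and> u < j. (if j = r then \<zeta> (- r) * g r w * R (- r) w p q else 0)
       - (if r = w then z * (if j < w then \<zeta> (- j) * R (- j) j p q else 0) else 0)
       + (if j = - w then if - w < r then z * \<zeta> (- r) * R w (- r) p q else 0 else 0))"
  proof (intro sum.cong refl)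
    fix j
    have "j + w = 0 \<longleftrightarrow> j = - w"
      by linarith
    \<comment> \<open>Two pair terms meet at the label \<open>j = - w\<close>, where their values of
      \<zeta> cancel.\<close>
    moreover have "\<zeta> w * (\<zeta> (- w) * x) = x" for x
      using zeta_uminus[of w] assms by (simp flip: mult.assoc)
    ultimately show "\<zeta> (- j) * left_inner w p q r (- j) j =
       (if j = r then \<zeta> (- r) * g r w * R (- r) w p q else 0)
       - (if r = w then z * (if j < w then \<zeta> (- j) * R (- j) j p q else 0) else 0)
       + (if j = - w then if - w < r then z * \<zeta> (- r) * R w (- r) p q else 0 else 0)"
      by (auto simp: left_inner_def algebra_simps)
  qed
  also have "\<dots> = (if u < r then \<zeta> (- r) * g r w * R (- r) w p q else 0)
     - (if r = w then z * (\<Sum>j | j \<in> J \<and> u < j. (if j < w then \<zeta> (- j) * R (- j) j p q else 0)) else 0)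
     + (if u < - w \<and> - w < r then z * \<zeta> (- r) * R w (- r) p q else 0)"
    using assms by (simp add: sum.distrib sum_subtractf sum_distrib_left[symmetric] finite_J sum.delta)
  also have "(\<Sum>j | j \<in> J \<and> u < j. (if j < w then \<zeta> (- j) * R (- j) j p q else 0)) =
    (\<Sum>j | j \<in> J \<and> u < j \<and> j < w. \<zeta> (- j) * R (- j) j p q)"
    by (rule sum.mono_neutral_cong_right) (auto simp: finite_J)
  also have "\<dots> = T u w p q"
    using assms by (intro sum_R_between)
  finally show ?thesis .
qed

lemma YB_right_eq:
  assumes "u \<in> J" "v \<in> J" "w \<in> J" "p \<in> J" "q \<in> J" "r \<in> J"
  shows "YB_right u v w p q r = g v w * right_inner u p q r w v - (if v < w then z * right_inner u p q r v w else 0)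
    + (if v + w = 0 then z * \<zeta> v * ((if v < - p then \<zeta> p * g u p * R u (- p) q r else 0)
         - (if p = u then z * T v (- u) q r else 0)
         + (if v < u \<and> u < - p then z * \<zeta> p * R (- p) u q r else 0)) else 0)"
proof -
  have "YB_right u v w p q r = (\<Sum>i\<in>J. \<Sum>j\<in>J. R v w i j * right_inner u p q r i j)"
    unfolding YB_right_def using assms by (intro sum.cong refl) (simp add: sum_R_right right_inner_def)
  also have "\<dots> = g v w * right_inner u p q r w v - (if v < w then z * right_inner u p q r v w else 0)
    + (if v + w = 0 then z * \<zeta> v * (\<Sum>j | j \<in> J \<and> v < j. \<zeta> (- j) * right_inner u p q r (- j) j) else 0)"
    using assms(2,3) by (rule sum_R)
  also have "(\<Sum>j | j \<in> J \<and> v < j. \<zeta> (- j) * right_inner u p q r (- j) j) =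
     (\<Sum>j | j \<in> J \<and> v < j. (if j = - p then \<zeta> p * g u p * R u (- p) q r else 0)
       - (if p = u then z * (if j < - u then \<zeta> (- j) * R (- j) j q r else 0) else 0)
       + (if j = u then if u < - p then z * \<zeta> p * R (- p) u q r else 0 else 0))"
    using zeta_uminus[of u] assms
    by (intro sum.cong refl) (auto simp: right_inner_def algebra_simps)
  also have "\<dots> = (if v < - p then \<zeta> p * g u p * R u (- p) q r else 0)
     - (if p = u then z * (\<Sum>j | j \<in> J \<and> v < j. (if j < - u then \<zeta> (- j) * R (- j) j q r else 0)) else 0)
     + (if v < u \<and> u < - p then z * \<zeta> p * R (- p) u q r else 0)"
    using assms by (simp add: sum.distrib sum_subtractf sum_distrib_left[symmetric] finite_J sum.delta)
  also have "(\<Sum>j | j \<in> J \<and> v < j. (if j < - u then \<zeta> (- j) * R (- j) j q r else 0)) =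
    (\<Sum>j | j \<in> J \<and> v < j \<and> j < - u. \<zeta> (- j) * R (- j) j q r)"
    by (rule sum.mono_neutral_cong_right) (auto simp: finite_J)
  also have "\<dots> = T v (- u) q r"
    using assms by (intro sum_R_between) auto
  finally show ?thesis .
qed

lemma R_no_pair:
  "u + v \<noteq> 0 \<Longrightarrow> R u v p q = g u v * delta p v * delta q u - (if u < v then z * delta p u * delta q v else 0)"
  by (simp add: R_def delta_def)

lemma left_inner_no_pair:
  "j + w \<noteq> 0 \<Longrightarrow> left_inner w p q r i j = delta r j * g j w * R i w p q - (if j < w then z * delta r w * R i j p q else 0)"
  by (simp add: left_inner_def delta_def)

lemma right_inner_no_pair:
  "u + i \<noteq> 0 \<Longrightarrow> right_inner u p q r i j = delta p i * g u i * R u j q r - (if u < i then z * delta p u * R i j q r else 0)"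
  by (simp add: right_inner_def delta_def)

text \<open>Without complementary incoming labels no pair term ever contributes, and the matrix is
  that of type A. With \<open>delta\<close> in place of conditionals the outgoing labels stay
  symbolic, so only the order of \<open>u\<close>, \<open>v\<close>, \<open>w\<close> is
  split.\<close>

lemma YB_without_pairs:
  assumes "u \<in> J" "v \<in> J" "w \<in> J" "p \<in> J" "q \<in> J" "r \<in> J"
    and "u + v \<noteq> 0" "v + w \<noteq> 0" "u + w \<noteq> 0"
  shows "YB_left u v w p q r = YB_right u v w p q r"
proof -
  have *: "v + u \<noteq> 0" "w + v \<noteq> 0" "w + u \<noteq> 0"
    using assms by linarith+
  have s: "s * inverse s = 1" "s * (inverse s * x) = x" for x
    using s_nonzero by simp_all
  show ?thesis
    using assms(7-9) *
    apply (cases rule: linorder_cases[of u v]; cases rule: linorder_cases[of v w]; cases rule: linorder_cases[of u w]; (linarith | -)?)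
    apply (simp_all add: YB_left_eq YB_right_eq assms(1-6) left_inner_no_pair right_inner_no_pair R_no_pair)
    apply (simp_all add: g_def z_def algebra_simps s)
    done
qed

text \<open>
  The four lemmas below are checked for every relative position of \<open>u\<close>, \<open>w\<close>, \<open>p\<close> and their negatives;
  the remaining positions of the pairs follow by transposition and by the symmetry \<open>R_flip\<close>.
\<close>

lemma YB_pair_left_left:
  assumes J: "u \<in> J" "w \<in> J" "p \<in> J"
  shows "YB_left u (- u) w p (- p) w = YB_right u (- u) w p (- p) w"
proof -
  note inv = J[THEN zeta_uminus_inverse]
  have mem: "u \<in> J" "- u \<in> J" "w \<in> J" "p \<in> J" "- p \<in> J" "w \<in> J"
    using J by simp_all
  show ?thesis
    unfolding YB_left_eq[OF mem] YB_right_eq[OF mem]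
    by (cases rule: linorder_cases[of u 0]; cases rule: linorder_cases[of w 0]; cases rule: linorder_cases[of p 0];
        cases rule: linorder_cases[of u w]; (linarith | -)?;
        cases rule: linorder_cases[of u "- w"]; (linarith | -)?;
        cases rule: linorder_cases[of u p]; (linarith | -)?;
        cases rule: linorder_cases[of u "- p"]; (linarith | -)?;
        cases rule: linorder_cases[of w p]; (linarith | -)?;
        cases rule: linorder_cases[of w "- p"]; (linarith | -)?)
      (simp_all add: left_inner_def right_inner_def R_def T_def W_def g_def max_def inv zeta_0,
       simp_all add: z_def field_simps power2_eq_square J[THEN zeta_nonzero] s_nonzero)
qed

lemma YB_pair_left_right:
  assumes J: "u \<in> J" "w \<in> J" "p \<in> J"
  shows "YB_left u (- u) w w p (- p) = YB_right u (- u) w w p (- p)"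
proof -
  note inv = J[THEN zeta_uminus_inverse]
  have mem: "u \<in> J" "- u \<in> J" "w \<in> J" "w \<in> J" "p \<in> J" "- p \<in> J"
    using J by simp_all
  show ?thesis
    unfolding YB_left_eq[OF mem] YB_right_eq[OF mem]
    by (cases rule: linorder_cases[of u 0]; cases rule: linorder_cases[of w 0]; cases rule: linorder_cases[of p 0];
        cases rule: linorder_cases[of u w]; (linarith | -)?;
        cases rule: linorder_cases[of u "- w"]; (linarith | -)?;
        cases rule: linorder_cases[of u p]; (linarith | -)?;
        cases rule: linorder_cases[of u "- p"]; (linarith | -)?;
        cases rule: linorder_cases[of w p]; (linarith | -)?;
        cases rule: linorder_cases[of w "- p"]; (linarith | -)?)
      (simp_all add: left_inner_def right_inner_def R_def T_def W_def g_def max_def inv zeta_0,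
       simp_all add: z_def field_simps power2_eq_square J[THEN zeta_nonzero] s_nonzero)
qed

lemma YB_pair_left_outer:
  assumes J: "u \<in> J" "w \<in> J" "p \<in> J"
  shows "YB_left u (- u) w p w (- p) = YB_right u (- u) w p w (- p)"
proof -
  note inv = J[THEN zeta_uminus_inverse]
  have mem: "u \<in> J" "- u \<in> J" "w \<in> J" "p \<in> J" "w \<in> J" "- p \<in> J"
    using J by simp_all
  show ?thesis
    unfolding YB_left_eq[OF mem] YB_right_eq[OF mem]
    by (cases rule: linorder_cases[of u 0]; cases rule: linorder_cases[of w 0]; cases rule: linorder_cases[of p 0];
        cases rule: linorder_cases[of u w]; (linarith | -)?;
        cases rule: linorder_cases[of u "- w"]; (linarith | -)?;
        cases rule: linorder_cases[of u p]; (linarith | -)?;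
        cases rule: linorder_cases[of u "- p"]; (linarith | -)?;
        cases rule: linorder_cases[of w p]; (linarith | -)?;
        cases rule: linorder_cases[of w "- p"]; (linarith | -)?)
      (simp_all add: left_inner_def right_inner_def R_def T_def W_def g_def max_def inv zeta_0,
       simp_all add: z_def field_simps power2_eq_square J[THEN zeta_nonzero] s_nonzero)
qed

lemma YB_pair_outer_outer:
  assumes J: "u \<in> J" "w \<in> J" "p \<in> J"
  shows "YB_left u w (- u) p w (- p) = YB_right u w (- u) p w (- p)"
proof -
  note inv = J[THEN zeta_uminus_inverse]
  have mem: "u \<in> J" "w \<in> J" "- u \<in> J" "p \<in> J" "w \<in> J" "- p \<in> J"
    using J by simp_all
  show ?thesis
    unfolding YB_left_eq[OF mem] YB_right_eq[OF mem]
    by (cases rule: linorder_cases[of u 0]; cases rule: linorder_cases[of w 0]; cases rule: linorder_cases[of p 0];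
        cases rule: linorder_cases[of u w]; (linarith | -)?;
        cases rule: linorder_cases[of u "- w"]; (linarith | -)?;
        cases rule: linorder_cases[of u p]; (linarith | -)?;
        cases rule: linorder_cases[of u "- p"]; (linarith | -)?;
        cases rule: linorder_cases[of w p]; (linarith | -)?;
        cases rule: linorder_cases[of w "- p"]; (linarith | -)?)
      (simp_all add: left_inner_def right_inner_def R_def T_def W_def g_def max_def inv zeta_0,
       simp_all add: z_def field_simps power2_eq_square J[THEN zeta_nonzero] s_nonzero)
qed

section \<open>Symmetries and conservation of weight\<close>

lemma YB_left_transpose: "YB_left u v w p q r = YB_left p q r u v w"
proof -
  have "YB_left u v w p q r = (\<Sum>i\<in>J. \<Sum>j\<in>J. \<Sum>k\<in>J. R u v i j * (R j w k r * R i k p q))"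
    by (simp add: YB_left_def sum_distrib_left)
  also have "\<dots> = (\<Sum>i\<in>J. \<Sum>k\<in>J. \<Sum>j\<in>J. R p q i k * (R k r j w * R i j u v))"
    by (subst sum.swap[of _ J J], intro sum.cong refl)
      (simp add: R_transpose[of u v] R_transpose[of _ w] R_transpose[of _ _ p q] mult_ac)
  finally show ?thesis
    by (simp add: YB_left_def sum_distrib_left)
qed

lemma YB_right_transpose: "YB_right u v w p q r = YB_right p q r u v w"
proof -
  have "YB_right u v w p q r = (\<Sum>i\<in>J. \<Sum>j\<in>J. \<Sum>k\<in>J. R v w i j * (R u i p k * R k j q r))"
    by (simp add: YB_right_def sum_distrib_left)
  also have "\<dots> = (\<Sum>i\<in>J. \<Sum>k\<in>J. \<Sum>j\<in>J. R v w i j * (R u i p k * R k j q r))"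
    by (intro sum.cong refl sum.swap)
  also have "\<dots> = (\<Sum>k\<in>J. \<Sum>i\<in>J. \<Sum>j\<in>J. R v w i j * (R u i p k * R k j q r))"
    by (rule sum.swap)
  also have "\<dots> = (\<Sum>k\<in>J. \<Sum>j\<in>J. \<Sum>i\<in>J. R v w i j * (R u i p k * R k j q r))"
    by (intro sum.cong refl sum.swap)
  also have "\<dots> = (\<Sum>k\<in>J. \<Sum>j\<in>J. \<Sum>i\<in>J. R q r k j * (R p k u i * R i j v w))"
    by (intro sum.cong refl)
      (simp add: R_transpose[of v w] R_transpose[of u] R_transpose[of _ _ q r] mult_ac)
  finally show ?thesis
    by (simp add: YB_right_def sum_distrib_left)
qed

lemma sum_uminus_J: "(\<Sum>i\<in>J. f (- i)) = (\<Sum>i\<in>J. f i)"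
  by (rule sum.reindex_bij_witness[of _ uminus uminus]) auto

lemma YB_left_flip: "YB_left (- w) (- v) (- u) (- r) (- q) (- p) = YB_right u v w p q r"
proof -
  have "YB_left (- w) (- v) (- u) (- r) (- q) (- p) =
    (\<Sum>i\<in>J. \<Sum>j\<in>J. R (- w) (- v) (- i) (- j) * (\<Sum>k\<in>J. R (- j) (- u) (- k) (- p) * R (- i) (- k) (- r) (- q)))"
    unfolding YB_left_def
    by (subst sum_uminus_J[symmetric], subst (2) sum_uminus_J[symmetric], subst (3) sum_uminus_J[symmetric]) (rule refl)
  also have "\<dots> = (\<Sum>i\<in>J. \<Sum>j\<in>J. R v w j i * (\<Sum>k\<in>J. R u j p k * R k i q r))"
    by (simp add: R_flip[of v w] R_flip[of u] R_flip[of _ _ q r])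
  finally show ?thesis
    unfolding YB_right_def by (subst sum.swap) simp
qed

lemma YB_flip:
  assumes "YB_left (- w) (- v) (- u) (- r) (- q) (- p) = YB_right (- w) (- v) (- u) (- r) (- q) (- p)"
  shows "YB_left u v w p q r = YB_right u v w p q r"
  using assms YB_left_flip[of w v u r q p] YB_left_flip[of "- u" "- v" "- w" "- p" "- q" "- r"] by simp

text \<open>One coordinate of the weight of a label: complementary labels have opposite weights and
  0 has weight 0. Since \<open>R\<close> either keeps or exchanges its labels or replaces one
  complementary pair by another, the total weight is conserved.\<close>

definition label_weight :: "int \<Rightarrow> int \<Rightarrow> int" where
  "label_weight x u = of_bool (u = x) - of_bool (u = - x)"

lemma label_weight_uminus: "label_weight x (- u) = - label_weight x u"
  by (auto simp: label_weight_def)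

lemma label_weight_eq_imp:
  assumes "\<And>x. label_weight x u = label_weight x v"
  shows "u = v"
proof (cases "u = 0")
  case True
  then have "label_weight v v = 0"
    using assms[of v] by (simp add: label_weight_def)
  then show ?thesis
    using True by (simp add: label_weight_def of_bool_def split: if_splits)
next
  case False
  then have "label_weight u v = 1"
    using assms[of u] by (simp add: label_weight_def)
  then show ?thesis
    by (cases "v = u"; cases "v = - u") (simp_all add: label_weight_def)
qed

lemma R_conserves: "R u v p q \<noteq> 0 \<Longrightarrow> label_weight x u + label_weight x v = label_weight x p + label_weight x q"
proof -
  assume nz: "R u v p q \<noteq> 0"
  have "p = v \<and> q = u \<or> p = u \<and> q = v \<or> u + v = 0 \<and> p + q = 0"
  proof (rule ccontr)
    assume "\<not> ?thesis"
    then have "\<not> (p = v \<and> q = u)" "\<not> (u < v \<and> p = u \<and> q = v)" "\<not> (u + v = 0 \<and> p + q = 0 \<and> u < q)"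
      by blast+
    then show False
      using nz unfolding R_def by (simp only: if_False) simp
  qed
  then consider "p = v" "q = u" | "p = u" "q = v" | "u + v = 0" "p + q = 0"
    by blast
  then show ?thesis
  proof cases
    case 3
    then have "v = - u" "q = - p"
      by simp_all
    then show ?thesis
      by (simp add: label_weight_uminus)
  qed auto
qed

lemma YB_left_conserves:
  assumes "YB_left u v w p q r \<noteq> 0"
  shows "label_weight x u + label_weight x v + label_weight x w = label_weight x p + label_weight x q + label_weight x r"
proof -
  have "\<exists>i j k. R u v i j \<noteq> 0 \<and> R j w k r \<noteq> 0 \<and> R i k p q \<noteq> 0"
  proof (rule ccontr)
    assume "\<not> ?thesis"
    then have "R u v i j * (R j w k r * R i k p q) = 0" for i j k
      by (metis mult_eq_0_iff)
    then have "YB_left u v w p q r = 0"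
      unfolding YB_left_def sum_distrib_left by (simp only: sum.neutral_const)
    with assms show False
      by contradiction
  qed
  then obtain i j k where "R u v i j \<noteq> 0" "R j w k r \<noteq> 0" "R i k p q \<noteq> 0"
    by blast
  from this[THEN R_conserves[of _ _ _ _ x]] show ?thesis
    by simp
qed

lemma YB_right_conserves:
  assumes "YB_right u v w p q r \<noteq> 0"
  shows "label_weight x u + label_weight x v + label_weight x w = label_weight x p + label_weight x q + label_weight x r"
  using YB_left_conserves[of "- w" "- v" "- u" "- r" "- q" "- p" x] assms
  by (simp add: YB_left_flip label_weight_uminus)

text \<open>The skein relation solved for the opposite crossing: the bracket holds the entries of an
  annihilation followed by a creation, minus those of the identity.\<close>

definition Rinv :: "int \<Rightarrow> int \<Rightarrow> int \<Rightarrow> int \<Rightarrow> 'a" where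
  "Rinv u v p q = R u v p q - z * ((if u + v = 0 \<and> p + q = 0 then \<zeta> u * \<zeta> p else 0)
     - (if p = u \<and> q = v then 1 else 0))"

lemma Rinv_transpose: "Rinv u v p q = Rinv p q u v"
proof -
  have "p = u \<and> q = v \<longleftrightarrow> u = p \<and> v = q" "u + v = 0 \<and> p + q = 0 \<longleftrightarrow> p + q = 0 \<and> u + v = 0"
    by blast+
  then show ?thesis
    unfolding Rinv_def R_transpose[of u v] by (simp only: mult.commute)
qed

lemma Rinv_flip: "Rinv u v p q = Rinv (- v) (- u) (- q) (- p)"
proof -
  have *: "- q = - v \<and> - p = - u \<longleftrightarrow> p = u \<and> q = v" "- v + - u = 0 \<and> - q + - p = 0 \<longleftrightarrow> u + v = 0 \<and> p + q = 0"
    by linarith+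
  have "\<zeta> a = \<zeta> (- b)" if "a + b = 0" for a b
    using that by (simp add: eq_neg_iff_add_eq_0[symmetric])
  from this[of u v] this[of p q]
  have "(if u + v = 0 \<and> p + q = 0 then \<zeta> u * \<zeta> p else 0) =
    (if u + v = 0 \<and> p + q = 0 then \<zeta> (- v) * \<zeta> (- q) else 0)"
    by simp
  then show ?thesis
    unfolding Rinv_def R_flip[of u v] by (simp only: *)
qed

text \<open>The result is \<open>R\<close> with the order of labels reversed and \<open>s\<close>
  inverted, which changes the sign of \<open>z\<close>; \<open>g u (- v)\<close> is the inverse of
  \<open>g u v\<close>.\<close>

lemma Rinv_eq:
  assumes "u \<in> J" "v \<in> J"
  shows "Rinv u v p q = (if p = v \<and> q = u then g u (- v) else 0) + (if v < u \<and> p = u \<and> q = v then z else 0)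
    - (if u + v = 0 \<and> p + q = 0 \<and> q < u then z * \<zeta> u * \<zeta> p else 0)"
proof (cases "u + v = 0 \<and> p + q = 0")
  case True
  then have "v = - u" "q = - p"
    by simp_all
  then show ?thesis
    using s_nonzero
    by (cases rule: linorder_cases[of u 0]; cases rule: linorder_cases[of p u]; (linarith | -)?;
        cases rule: linorder_cases[of p "- u"]; (linarith | -)?)
      (simp_all add: Rinv_def R_def g_def assms zeta_0 zeta_uminus_inverse,
       simp_all add: z_def field_simps zeta_nonzero assms)
next
  case False
  then show ?thesis
    by (cases rule: linorder_cases[of u v]) (auto simp: Rinv_def R_def g_def z_def)
qed

section \<open>Curls, the circle, and the inverse matrix\<close>

lemma sum_zeta_above:
  assumes "u \<in> J"
  shows "z * (\<Sum>j | j \<in> J \<and> u < j. \<zeta> (- j) ^ 2) =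
    \<alpha> + (if u < 0 then z else 0) - (if u = 0 then 1 else s) * \<zeta> (- u) ^ 2"
proof -
  have "(\<Sum>j | j \<in> J \<and> u < j. \<zeta> (- j) ^ 2) = (\<Sum>e | e \<in> J \<and> e < - u. \<zeta> e ^ 2)"
    by (rule sum.reindex_bij_witness[of _ uminus uminus]) auto
  then show ?thesis
    using zeta_partial_sum[of "- u"] assms by (simp add: z_def)
qed

text \<open>The transposition and diagonal terms cancel all of the partial sum except its constant
  \<alpha>.\<close>

lemma R_curl:
  assumes "u \<in> J" "v \<in> J"
  shows "(\<Sum>i\<in>J. \<Sum>j\<in>J. R u v i j * (if i + j = 0 then \<zeta> i else 0)) = \<alpha> * (if u + v = 0 then \<zeta> u else 0)"
proof (cases "u + v = 0")
  case True
  then have v: "v = - u"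
    by simp
  have "(\<Sum>i\<in>J. \<Sum>j\<in>J. R u v i j * (if i + j = 0 then \<zeta> i else 0)) =
      g u (- u) * \<zeta> (- u) - (if u < 0 then z * \<zeta> u else 0)
      + \<zeta> u * (z * (\<Sum>j | j \<in> J \<and> u < j. \<zeta> (- j) ^ 2))"
    unfolding sum_R[OF assms] by (simp add: v power2_eq_square mult_ac)
  also have "\<dots> = \<alpha> * \<zeta> u"
    unfolding sum_zeta_above[OF assms(1)] using zeta_nonzero[OF assms(1)]
    by (cases rule: linorder_cases[of u 0])
      (simp_all add: g_def zeta_uminus_inverse assms zeta_0 power2_eq_square field_simps)
  finally show ?thesis
    by (simp add: v)
next
  case False
  then show ?thesis
    unfolding sum_R[OF assms] by (simp add: add.commute)
qed

text \<open>At the smallest label the partial sum is empty, which gives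
  \<open>\<alpha> = s * \<zeta> (- m) ^ 2\<close>. At the largest label \<open>m\<close> it lacks
  only the last summand, and \<open>\<zeta> m\<close> is the inverse of
  \<open>\<zeta> (- m)\<close>.\<close>

lemma sum_zeta: "z * (\<Sum>j\<in>J. \<zeta> j ^ 2) = \<alpha> - inverse \<alpha> + z"
proof -
  define m where "m = Max J"
  obtain a where "a \<in> J" "0 < a"
    using positive by blast
  then have m: "m \<in> J" "0 < m"
    unfolding m_def using finite_J by (auto intro: Max_in Max_ge less_le_trans)
  have max: "j \<le> m" if "j \<in> J" for j
    unfolding m_def using finite_J that by simp
  have "\<not> e < - m" if "e \<in> J" for e
    using max[of "- e"] that by simp
  then have "{e \<in> J. e < - m} = {}"
    by blast
  with zeta_partial_sum[of "- m"] m have alpha: "\<alpha> = s * \<zeta> (- m) ^ 2"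
    by simp
  have "J = insert m {e \<in> J. e < m}"
    using m max by force
  then have "(\<Sum>j\<in>J. \<zeta> j ^ 2) = \<zeta> m ^ 2 + (\<Sum>e | e \<in> J \<and> e < m. \<zeta> e ^ 2)"
    using finite_J sum.insert[of "{e \<in> J. e < m}" m "\<lambda>j. \<zeta> j ^ 2"] by simp
  then have "z * (\<Sum>j\<in>J. \<zeta> j ^ 2) = z * \<zeta> m ^ 2 + (\<alpha> + z - s * \<zeta> m ^ 2)"
    using zeta_partial_sum[of m] m by (simp add: z_def algebra_simps)
  also have "\<dots> = \<alpha> - inverse s * \<zeta> m ^ 2 + z"
    by (simp add: z_def algebra_simps)
  also have "inverse s * \<zeta> m ^ 2 = inverse \<alpha>"
    using m by (simp add: alpha zeta_uminus_inverse power_inverse)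
  finally show "z * (\<Sum>j\<in>J. \<zeta> j ^ 2) = \<alpha> - inverse \<alpha> + z" .
qed

lemma sum_cap:
  assumes "i \<in> J"
  shows "(\<Sum>j\<in>J. if i + j = 0 then F j else 0) = F (- i)"
proof -
  have "i + j = 0 \<longleftrightarrow> j = - i" for j
    by linarith
  then show ?thesis
    using assms by (simp add: finite_J sum.delta)
qed

text \<open>By the skein relation the factor is
  \<open>\<alpha> - (\<alpha> - inverse \<alpha> + z) + z\<close>, where the bracket is
  \<open>z\<close> times the value of the circle.\<close>

lemma Rinv_curl:
  assumes "u \<in> J" "v \<in> J"
  shows "(\<Sum>i\<in>J. \<Sum>j\<in>J. Rinv u v i j * (if i + j = 0 then \<zeta> i else 0)) = inverse \<alpha> * (if u + v = 0 then \<zeta> u else 0)"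
proof -
  have "(\<Sum>i\<in>J. \<Sum>j\<in>J. Rinv u v i j * (if i + j = 0 then \<zeta> i else 0)) =
      (\<Sum>i\<in>J. \<Sum>j\<in>J. R u v i j * (if i + j = 0 then \<zeta> i else 0))
    - (if u + v = 0 then \<zeta> u else 0) * (z * (\<Sum>i\<in>J. \<Sum>j\<in>J. if i + j = 0 then \<zeta> i ^ 2 else 0))
    + z * (\<Sum>i\<in>J. \<Sum>j\<in>J. if i = u then if j = v then if i + j = 0 then \<zeta> i else 0 else 0 else 0)"
    unfolding sum_distrib_left sum_subtractf[symmetric] sum.distrib[symmetric]
    by (intro sum.cong refl) (auto simp: Rinv_def power2_eq_square algebra_simps)
  also have "(\<Sum>i\<in>J. \<Sum>j\<in>J. if i + j = 0 then \<zeta> i ^ 2 else 0) = (\<Sum>i\<in>J. \<zeta> i ^ 2)"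
    by (intro sum.cong refl sum_cap)
  also have "(\<Sum>i\<in>J. \<Sum>j\<in>J. if i = u then if j = v then if i + j = 0 then \<zeta> i else 0 else 0 else 0) =
    (if u + v = 0 then \<zeta> u else 0)"
    using assms by (subst sum.swap) (simp add: finite_J sum.delta)
  finally show ?thesis
    unfolding R_curl[OF assms] sum_zeta by (simp add: algebra_simps)
qed

text \<open>The sum that survives in the product of \<open>R\<close> and \<open>Rinv\<close>. The
  order condition in the pair term of \<open>Rinv\<close> bounds \<open>j\<close> above by
  \<open>p\<close>, so that \<open>W\<close> applies.\<close>

lemma sum_Rinv_above:
  assumes "u \<in> J" "p \<in> J" "q \<in> J"
  shows "(\<Sum>j | j \<in> J \<and> u < j. \<zeta> (- j) * Rinv (- j) j p q) =
    (if p + q = 0 then (if u < p then \<zeta> (- p) * g p p else 0)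
      + (if u < q \<and> q < 0 then z * \<zeta> p else 0) - \<zeta> p * W u p else 0)"
proof (cases "p + q = 0")
  case True
  then have q: "q = - p"
    by simp
  have "(\<Sum>j | j \<in> J \<and> u < j. \<zeta> (- j) * Rinv (- j) j p q) =
    (\<Sum>j | j \<in> J \<and> u < j. (if j = p then \<zeta> (- p) * g p p else 0)
      + (if j = q then if q < 0 then z * \<zeta> p else 0 else 0)
      - \<zeta> p * (z * (if j < p then \<zeta> (- j) ^ 2 else 0)))"
    by (intro sum.cong refl) (auto simp: Rinv_eq q power2_eq_square algebra_simps g_def)
  also have "\<dots> = (if u < p then \<zeta> (- p) * g p p else 0)
    + (if u < q \<and> q < 0 then z * \<zeta> p else 0)
    - \<zeta> p * (z * (\<Sum>j | j \<in> J \<and> u < j. (if j < p then \<zeta> (- j) ^ 2 else 0)))"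
    using assms by (simp add: sum.distrib sum_subtractf sum_distrib_left[symmetric] finite_J sum.delta)
  also have "(\<Sum>j | j \<in> J \<and> u < j. (if j < p then \<zeta> (- j) ^ 2 else 0)) =
    (\<Sum>j | j \<in> J \<and> u < j \<and> j < p. \<zeta> (- j) ^ 2)"
    by (rule sum.mono_neutral_cong_right) (auto simp: finite_J)
  also have "z * \<dots> = W u p"
    using assms by (intro sum_zeta_between)
  finally show ?thesis
    using True by simp
next
  case False
  then have "Rinv (- j) j p q = 0" if "j \<in> J" for j
    using that by (auto simp: Rinv_eq)
  with False show ?thesis
    by simp
qed

lemma R_Rinv:
  assumes "u \<in> J" "v \<in> J" "p \<in> J" "q \<in> J"
  shows "(\<Sum>i\<in>J. \<Sum>j\<in>J. R u v i j * Rinv i j p q) = (if p = u \<and> q = v then 1 else 0)"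
proof (cases "u + v = 0 \<and> p + q = 0")
  case True
  then have v: "v = - u" "q = - p"
    by simp_all
  note J = \<open>u \<in> J\<close> \<open>p \<in> J\<close>
  show ?thesis
    unfolding sum_R[OF assms(1,2)] sum_Rinv_above[OF assms(1,3,4)]
    unfolding v Rinv_eq[OF J(1) uminus_J[OF J(1)]] Rinv_eq[OF uminus_J[OF J(1)] J(1)]
    by (cases rule: linorder_cases[of u 0]; cases rule: linorder_cases[of p 0];
        cases rule: linorder_cases[of p u]; (linarith | -)?; cases rule: linorder_cases[of p "- u"]; (linarith | -)?)
      (simp_all add: Rinv_eq J W_def g_def zeta_0 J[THEN zeta_uminus_inverse],
       (simp_all add: z_def field_simps power2_eq_square J[THEN zeta_nonzero] s_nonzero)?)
next
  case False
  show ?thesis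
  proof (cases "u + v = 0")
    case True
    then have v: "v = - u" and "p + q \<noteq> 0"
      using False by simp_all
    then have "Rinv a (- a) p q = 0" if "a \<in> J" for a
      using that by (auto simp: Rinv_eq)
    from this[of u] this[of "- u"] show ?thesis
      unfolding sum_R[OF assms(1,2)] sum_Rinv_above[OF assms(1,3,4)]
      using \<open>p + q \<noteq> 0\<close> v assms by auto
  next
    case False
    then have "v + u \<noteq> 0"
      by linarith
    with False show ?thesis
      unfolding sum_R[OF assms(1,2)] using s_nonzero
      by (cases rule: linorder_cases[of u v]) (simp_all add: Rinv_eq assms g_def z_def field_simps)
  qed
qed

lemma Rinv_R:
  assumes "u \<in> J" "v \<in> J" "p \<in> J" "q \<in> J"
  shows "(\<Sum>i\<in>J. \<Sum>j\<in>J. Rinv u v i j * R i j p q) = (if p = u \<and> q = v then 1 else 0)"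
proof -
  have "(\<Sum>i\<in>J. \<Sum>j\<in>J. Rinv u v i j * R i j p q) = (\<Sum>i\<in>J. \<Sum>j\<in>J. R p q i j * Rinv i j u v)"
    by (intro sum.cong refl) (simp only: R_transpose[of p q] Rinv_transpose[of u v] mult.commute)
  then show ?thesis
    using R_Rinv[OF assms(3,4,1,2)] by auto
qed

text \<open>A quarter turn matches the diagonal term of one matrix with the pair term of the other
  and the transposition terms with each other. This is why a crossing that slides past an extremum
  changes its kind.\<close>

lemma slide_R:
  assumes "a \<in> J" "b \<in> J" "c \<in> J"
  shows "\<zeta> a * R b c (- a) d' = \<zeta> (- c) * Rinv a b d' (- c)"
proof -
  have "\<zeta> a * (if - a = c \<and> d' = b then g b c else 0) = \<zeta> (- c) * (if d' = b \<and> - c = a then g a (- b) else 0)"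
    using g_uminus[of b "- a"] by (auto simp: g_commute)
  moreover have "\<zeta> a * (if b < c \<and> - a = b \<and> d' = c then z else 0) =
    \<zeta> (- c) * (if a + b = 0 \<and> d' + - c = 0 \<and> - c < a then z * \<zeta> a * \<zeta> d' else 0)"
  proof -
    have "b < c \<and> - a = b \<and> d' = c \<longleftrightarrow> a + b = 0 \<and> d' + - c = 0 \<and> - c < a"
      by linarith
    then show ?thesis
      using zeta_uminus[of c] assms by (simp add: mult_ac)
  qed
  moreover have "\<zeta> a * (if b + c = 0 \<and> - a + d' = 0 \<and> b < d' then z * \<zeta> b * \<zeta> (- a) else 0) =
    \<zeta> (- c) * (if b < a \<and> d' = a \<and> - c = b then z else 0)"
  proof -
    have "b + c = 0 \<and> - a + d' = 0 \<and> b < d' \<longleftrightarrow> b < a \<and> d' = a \<and> - c = b"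
      by linarith
    then show ?thesis
      using zeta_uminus[of a] assms by (auto simp: mult_ac)
  qed
  ultimately show ?thesis
    unfolding R_def Rinv_eq[OF assms(1,2)] by (simp add: algebra_simps)
qed

lemma slide_Rinv:
  assumes "a \<in> J" "b \<in> J" "c \<in> J"
  shows "\<zeta> a * Rinv b c (- a) d' = \<zeta> (- c) * R a b d' (- c)"
proof -
  have "\<zeta> (- c) * R (- b) (- a) c (- d') = \<zeta> a * Rinv (- c) (- b) (- d') a"
    using slide_R[of "- c" "- b" "- a" "- d'"] assms by simp
  then show ?thesis
    by (simp add: R_flip[of a b] Rinv_flip[of b c])
qed

lemma YB_transpose:
  assumes "YB_left p q r u v w = YB_right p q r u v w"
  shows "YB_left u v w p q r = YB_right u v w p q r"
  using assms YB_left_transpose YB_right_transpose by metis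

text \<open>If the incoming or the outgoing labels contain no complementary pair, the generic case
  applies, possibly after transposition. Otherwise each triple is a pair and one further label.
  Pairs have weight 0, so both sides vanish unless the further labels agree.\<close>

lemma yang_baxter:
  assumes J: "u \<in> J" "v \<in> J" "w \<in> J" "p \<in> J" "q \<in> J" "r \<in> J"
  shows "YB_left u v w p q r = YB_right u v w p q r"
proof -
  have pair: "(\<exists>a x. a \<in> J \<and> x \<in> J \<and> (u = a \<and> v = - a \<and> w = x \<or> u = x \<and> v = a \<and> w = - a \<or> u = a \<and> v = x \<and> w = - a))"
    if "u + v = 0 \<or> v + w = 0 \<or> u + w = 0" "u \<in> J" "v \<in> J" "w \<in> J" for u v w
  proof -
    have "v = - u \<or> w = - v \<or> w = - u"
      using that(1) by presburger
    then show ?thesis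
      using that(2-4) by blast
  qed
  consider "u + v \<noteq> 0" "v + w \<noteq> 0" "u + w \<noteq> 0" | "p + q \<noteq> 0" "q + r \<noteq> 0" "p + r \<noteq> 0"
    | "u + v = 0 \<or> v + w = 0 \<or> u + w = 0" "p + q = 0 \<or> q + r = 0 \<or> p + r = 0"
    by blast
  then show ?thesis
  proof cases
    case 1
    then show ?thesis
      using J by (intro YB_without_pairs)
  next
    case 2
    then show ?thesis
      using J by (intro YB_transpose[OF YB_without_pairs])
  next
    case 3
    obtain a x where x: "a \<in> J" "x \<in> J"
      and uvw: "u = a \<and> v = - a \<and> w = x \<or> u = x \<and> v = a \<and> w = - a \<or> u = a \<and> v = x \<and> w = - a"
      using pair[OF 3(1) J(1-3)] by blast
    obtain b y where y: "b \<in> J" "y \<in> J"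
      and pqr: "p = b \<and> q = - b \<and> r = y \<or> p = y \<and> q = b \<and> r = - b \<or> p = b \<and> q = y \<and> r = - b"
      using pair[OF 3(2) J(4-6)] by blast
    have weights: "label_weight t u + label_weight t v + label_weight t w = label_weight t x" "label_weight t p + label_weight t q + label_weight t r = label_weight t y" for t
      using uvw pqr by (auto simp: label_weight_uminus)
    show ?thesis
    proof (cases "x = y")
      case False
      then have "\<exists>t. label_weight t x \<noteq> label_weight t y"
        using label_weight_eq_imp by blast
      then have "\<exists>t. label_weight t u + label_weight t v + label_weight t w \<noteq> label_weight t p + label_weight t q + label_weight t r"
        by (simp add: weights)
      then have "YB_left u v w p q r = 0" "YB_right u v w p q r = 0"
        using YB_left_conserves YB_right_conserves by blast+
      then show ?thesis
        by simp
    next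
      case True
      \<comment> \<open>Pairs on the right are reflected to pairs on the left, with the third label
        replaced by its complement.\<close>
      have right_right: "YB_left x a (- a) x b (- b) = YB_right x a (- a) x b (- b)"
        using YB_pair_left_left[of a "- x" b] YB_flip[of "- a" a x "- b" b x] x y by simp
      have right_outer: "YB_left x a (- a) b x (- b) = YB_right x a (- a) b x (- b)"
        if "a \<in> J" "b \<in> J" for a b
        using YB_pair_left_outer[of a "- x" b] YB_flip[of "- a" a x "- b" x b] x that by simp
      note YB_pairs = YB_pair_left_left[of a x b] YB_pair_left_right[of a x b] YB_pair_left_outer[of a x b]
        YB_pair_left_right[of b x a, THEN YB_transpose] right_right right_outer[of a b]
        YB_pair_left_outer[of b x a, THEN YB_transpose] right_outer[of b a, THEN YB_transpose]
        YB_pair_outer_outer[of a x b]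
      show ?thesis
        using uvw pqr True x y YB_pairs by (elim disjE conjE) simp_all
    qed
  qed
qed

end


section \<open>Invariance of the state sum\<close>

definition label_lists :: "lie_type \<Rightarrow> nat \<Rightarrow> nat \<Rightarrow> nat list set" where
  "label_lists X n k = {xs. length xs = k \<and> set xs \<subseteq> index_set X n}"

text \<open>Functions of the labels above the slice are pulled back to functions of the labels
  below. A local move thus becomes an equality of operators, whatever the rest of the
  diagram.\<close>

definition transfer :: "lie_type \<Rightarrow> nat \<Rightarrow> slice \<Rightarrow> (nat list \<Rightarrow> K0) \<Rightarrow> nat list \<Rightarrow> K0" where
  "transfer X n s f xs = (\<Sum>ys\<in>label_lists X n (strands_above s). slice_weight X n s xs ys * f ys)"

fun evaluate :: "lie_type \<Rightarrow> nat \<Rightarrow> diagram \<Rightarrow> (nat list \<Rightarrow> K0) \<Rightarrow> nat list \<Rightarrow> K0" where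
  "evaluate X n [] f = f"
| "evaluate X n (s # w) f = transfer X n s (evaluate X n w f)"

lemma evaluate_append: "evaluate X n (u @ v) f = evaluate X n u (evaluate X n v f)"
  by (induction u) auto

lemma finite_label_lists [simp]: "finite (label_lists X n k)"
  using finite_lists_length_eq[of "index_set X n" k]
  by (simp add: label_lists_def index_set_def conj_commute)

lemma finite_index_set [simp]: "finite (index_set X n)"
  by (simp add: index_set_def)

lemma evaluate_cong:
  assumes "composable a u b" "xs \<in> label_lists X n a" "\<And>ys. ys \<in> label_lists X n b \<Longrightarrow> f ys = g ys"
  shows "evaluate X n u f xs = evaluate X n u g xs"
  using assms
proof (induction u arbitrary: a xs)
  case (Cons s u)
  then show ?case
    by (auto simp: transfer_def intro!: sum.cong)
qed auto

lemma evaluate_linear: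
  "evaluate X n u (\<lambda>xs. c * f xs + d * g xs) = (\<lambda>xs. c * evaluate X n u f xs + d * evaluate X n u g xs)"
  by (induction u)
    (auto simp: transfer_def sum.distrib[symmetric] sum_distrib_left algebra_simps intro!: ext sum.cong)

lemma sum_label_lists_Suc:
  "(\<Sum>xs\<in>label_lists X n (Suc k). F xs) = (\<Sum>a\<in>index_set X n. \<Sum>xs\<in>label_lists X n k. F (a # xs))"
proof -
  have "label_lists X n (Suc k) = (\<lambda>(a, xs). a # xs) ` (index_set X n \<times> label_lists X n k)"
    by (auto simp: label_lists_def length_Suc_conv image_iff)
  moreover have "inj_on (\<lambda>(a, xs). a # xs) (index_set X n \<times> label_lists X n k)"
    by (auto intro: inj_onI)
  ultimately show ?thesis
    by (simp add: sum.reindex sum.cartesian_product case_prod_unfold)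
qed

lemma label_lists_0: "label_lists X n 0 = {[]}"
  by (auto simp: label_lists_def)

lemma sum_label_lists_2:
  "(\<Sum>xs\<in>label_lists X n 2. F xs) = (\<Sum>a\<in>index_set X n. \<Sum>b\<in>index_set X n. F [a, b])"
  by (simp add: numeral_2_eq_2 sum_label_lists_Suc label_lists_0)

text \<open>The open lower level and the factor \<open>g\<close> make the induction work: the weight
  of the first slice, as a function of the next level, becomes part of the new
  \<open>g\<close>.\<close>

lemma state_sum_levels:
  "(\<Sum>ls | list_all2 (\<lambda>xs m. xs \<in> label_lists X n m) ls (m # map strands_above K).
      g (hd ls) * (\<Prod>i<length K. slice_weight X n (K ! i) (ls ! i) (ls ! Suc i))) =
    (\<Sum>xs\<in>label_lists X n m. g xs * evaluate X n K (\<lambda>_. 1) xs)"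
proof (induction K arbitrary: m g)
  case Nil
  have "{ls. list_all2 (\<lambda>xs m. xs \<in> label_lists X n m) ls [m]} = (\<lambda>xs. [xs]) ` label_lists X n m"
    by (auto simp: list_all2_Cons2)
  then show ?case
    by (simp add: sum.reindex inj_on_def)
next
  case (Cons s K)
  let ?A = "\<lambda>m K. {ls. list_all2 (\<lambda>xs m. xs \<in> label_lists X n m) ls (m # map strands_above K)}"
  let ?w = "\<lambda>K ls. \<Prod>i<length K. slice_weight X n (K ! i) (ls ! i) (ls ! Suc i)"
  have A: "?A m (s # K) = (\<lambda>(xs, ls). xs # ls) ` (label_lists X n m \<times> ?A (strands_above s) K)"
    by (auto simp: list_all2_Cons2 image_iff)
  have "(\<Sum>ls\<in>?A m (s # K). g (hd ls) * ?w (s # K) ls) =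
    (\<Sum>(xs, ls)\<in>label_lists X n m \<times> ?A (strands_above s) K. g xs * ?w (s # K) (xs # ls))"
    unfolding A by (subst sum.reindex) (auto simp: case_prod_unfold intro!: inj_onI)
  also have "\<dots> = (\<Sum>xs\<in>label_lists X n m. \<Sum>ls\<in>?A (strands_above s) K.
      g xs * slice_weight X n s xs (hd ls) * ?w K ls)"
    unfolding sum.cartesian_product[symmetric]
  proof (intro sum.cong refl)
    fix xs ls
    assume "ls \<in> ?A (strands_above s) K"
    then have "ls ! 0 = hd ls"
      by (cases ls) auto
    then show "g xs * ?w (s # K) (xs # ls) = g xs * slice_weight X n s xs (hd ls) * ?w K ls"
      by (simp add: prod.lessThan_Suc_shift mult.assoc del: prod.lessThan_Suc)
  qed
  also have "\<dots> = (\<Sum>xs\<in>label_lists X n m. g xs * evaluate X n (s # K) (\<lambda>_. 1) xs)"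
    using Cons.IH[where g = "\<lambda>ys. g xs * slice_weight X n s xs ys" and m = "strands_above s" for xs]
    by (simp add: transfer_def sum_distrib_left mult.assoc)
  finally show ?case .
qed

lemma state_sum_eq_evaluate: "state_sum X n K = evaluate X n K (\<lambda>_. 1) []"
proof -
  have "labellings X n K = {ls. list_all2 (\<lambda>xs m. xs \<in> label_lists X n m) ls (0 # map strands_above K)}"
    by (simp add: labellings_def label_lists_def)
  then show ?thesis
    using state_sum_levels[where X = X and n = n and m = 0 and K = K and g = "\<lambda>_. 1"] by (simp add: state_sum_def label_lists_0)
qed

lemma prod_delta:
  "length xs = k \<Longrightarrow> length ys = k \<Longrightarrow> (\<Prod>j<k. delta (xs ! j) (ys ! j)) = (if xs = ys then 1 else (0::'a::field))"
proof -
  assume len: "length xs = k" "length ys = k"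
  show ?thesis
  proof (cases "xs = ys")
    case False
    then obtain j where "j < k" "xs ! j \<noteq> ys ! j"
      using len nth_equalityI[of xs ys] by auto
    then have "\<exists>j\<in>{..<k}. delta (xs ! j) (ys ! j) = (0::'a)"
      by (auto simp: delta_def)
    then show ?thesis
      using False prod_zero[of "{..<k}"] by simp
  qed (simp add: delta_def)
qed

lemma piece_weight_append:
  assumes "length bs = legs_in p" "length es = legs_out p"
  shows "piece_weight X n p (bs @ cs) (es @ ds) = piece_weight X n p bs es"
  using assms by (cases p) (auto simp: nth_append)

lemma slice_weight_split:
  assumes "length as = l" "length bs = legs_in p" "length cs = r"
    and "length as' = l" "length es = legs_out p" "length cs' = r"
  shows "slice_weight X n (Slice l p r) (as @ bs @ cs) (as' @ es @ cs') =
    (if as = as' \<and> cs = cs' then piece_weight X n p bs es else 0)"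
proof -
  have "(\<Prod>j<l. delta ((as @ bs @ cs) ! j) ((as' @ es @ cs') ! j)) = (if as = as' then 1 else (0::K0))"
    using prod_delta[of as l as'] assms by (simp add: nth_append)
  moreover have "(\<Prod>j<r. delta ((as @ bs @ cs) ! (l + legs_in p + j)) ((as' @ es @ cs') ! (l + legs_out p + j))) =
      (if cs = cs' then 1 else (0::K0))"
    using prod_delta[of cs r cs'] assms by (simp add: nth_append)
  ultimately show ?thesis
    using assms by (simp add: piece_weight_append)
qed

text \<open>Vertical strands copy their labels, so the sum over the upper level collapses to the
  outgoing labels of the piece.\<close>

lemma transfer_eq:
  assumes "as \<in> label_lists X n l" "length bs = legs_in p" "cs \<in> label_lists X n r"
  shows "transfer X n (Slice l p r) f (as @ bs @ cs) =
    (\<Sum>es\<in>label_lists X n (legs_out p). piece_weight X n p bs es * f (as @ es @ cs))"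
proof -
  let ?S = "(\<lambda>es. as @ es @ cs) ` label_lists X n (legs_out p)"
  have "transfer X n (Slice l p r) f (as @ bs @ cs) =
    (\<Sum>ys\<in>?S. slice_weight X n (Slice l p r) (as @ bs @ cs) ys * f ys)"
    unfolding transfer_def
  proof (rule sum.mono_neutral_right)
    show "?S \<subseteq> label_lists X n (strands_above (Slice l p r))"
      using assms by (auto simp: label_lists_def)
    show "\<forall>ys\<in>label_lists X n (strands_above (Slice l p r)) - ?S.
      slice_weight X n (Slice l p r) (as @ bs @ cs) ys * f ys = 0"
    proof
      fix ys
      assume ys: "ys \<in> label_lists X n (strands_above (Slice l p r)) - ?S"
      define as' es cs' where "as' = take l ys" and "es = take (legs_out p) (drop l ys)"
        and "cs' = drop (legs_out p) (drop l ys)"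
      have eq: "ys = as' @ es @ cs'"
        unfolding as'_def es_def cs'_def by (simp only: append_take_drop_id)
      have "length as' = l" "length es = legs_out p" "length cs' = r" and es: "es \<in> label_lists X n (legs_out p)"
        using ys by (auto simp: as'_def es_def cs'_def label_lists_def dest!: in_set_takeD in_set_dropD)
      moreover from this have "\<not> (as = as' \<and> cs = cs')"
        using ys eq by auto
      ultimately show "slice_weight X n (Slice l p r) (as @ bs @ cs) ys * f ys = 0"
        using assms unfolding eq by (subst slice_weight_split) (auto simp: label_lists_def)
    qed
  qed simp
  also have "\<dots> = (\<Sum>es\<in>label_lists X n (legs_out p).
      slice_weight X n (Slice l p r) (as @ bs @ cs) (as @ es @ cs) * f (as @ es @ cs))"
    by (subst sum.reindex) (auto simp: inj_on_def)
  also have "\<dots> = (\<Sum>es\<in>label_lists X n (legs_out p). piece_weight X n p bs es * f (as @ es @ cs))"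
    using assms by (intro sum.cong refl, subst slice_weight_split) (auto simp: label_lists_def)
  finally show ?thesis .
qed

lemma label_lists_appendE:
  assumes "xs \<in> label_lists X n (k + m)"
  obtains as bs where "xs = as @ bs" "as \<in> label_lists X n k" "bs \<in> label_lists X n m"
proof
  show "xs = take k xs @ drop k xs"
    by simp
  show "take k xs \<in> label_lists X n k" "drop k xs \<in> label_lists X n m"
    using assms by (auto simp: label_lists_def dest: in_set_takeD in_set_dropD)
qed

lemma label_lists_Cons:
  "a \<in> index_set X n \<Longrightarrow> bs \<in> label_lists X n m \<Longrightarrow> a # bs \<in> label_lists X n (Suc m)"
  by (auto simp: label_lists_def)

text \<open>Compared on admissible label lists only, because the matrix identities concern labels in
  the index set. The arbitrary \<open>f\<close> stands for everything above.\<close>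

definition same_operator :: "lie_type \<Rightarrow> nat \<Rightarrow> nat \<Rightarrow> diagram \<Rightarrow> diagram \<Rightarrow> bool" where
  "same_operator X n m x y \<longleftrightarrow>
     (\<forall>f. \<forall>xs\<in>label_lists X n m. evaluate X n x f xs = evaluate X n y f xs)"

lemma same_operatorI:
  assumes "\<And>f xs. xs \<in> label_lists X n m \<Longrightarrow> evaluate X n x f xs = evaluate X n y f xs"
  shows "same_operator X n m x y"
  using assms by (simp add: same_operator_def)

lemma same_operator_trans [trans]:
  "same_operator X n m x y \<Longrightarrow> same_operator X n m y w \<Longrightarrow> same_operator X n m x w"
  by (simp add: same_operator_def)

lemma same_operator_sym: "same_operator X n m x y \<Longrightarrow> same_operator X n m y x"
  by (simp add: same_operator_def)

lemma same_operator_context: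
  assumes "same_operator X n b x y" "composable a u b"
  shows "same_operator X n a (u @ x @ v) (u @ y @ v)"
  using assms evaluate_cong[of a u b _ X n "evaluate X n (x @ v) f" "evaluate X n (y @ v) f" for f]
  by (auto simp: same_operator_def evaluate_append)

text \<open>The two pieces act on disjoint groups of labels, so the two heights differ only in the
  order of summation.\<close>

lemma same_operator_exchange:
  "same_operator X n (l + legs_in p + m + legs_in p' + r)
     [Slice l p (m + legs_in p' + r), Slice (l + legs_out p + m) p' r]
     [Slice (l + legs_in p + m) p' r, Slice l p (m + legs_out p' + r)]"
proof (rule same_operatorI)
  fix f xs
  assume "xs \<in> label_lists X n (l + legs_in p + m + legs_in p' + r)"
  then obtain as bs ms bs' cs where xs: "xs = as @ bs @ ms @ bs' @ cs"
    and mem: "as \<in> label_lists X n l" "bs \<in> label_lists X n (legs_in p)" "ms \<in> label_lists X n m"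
      "bs' \<in> label_lists X n (legs_in p')" "cs \<in> label_lists X n r"
    by (elim label_lists_appendE) auto
  have len: "length bs = legs_in p" "length bs' = legs_in p'"
    using mem by (auto simp: label_lists_def)
  have "evaluate X n [Slice l p (m + legs_in p' + r), Slice (l + legs_out p + m) p' r] f xs =
    (\<Sum>es\<in>label_lists X n (legs_out p). piece_weight X n p bs es *
      transfer X n (Slice (l + legs_out p + m) p' r) f ((as @ es @ ms) @ bs' @ cs))"
    unfolding xs using transfer_eq[OF mem(1) len(1), of "ms @ bs' @ cs" "m + legs_in p' + r"] mem
    by (simp add: label_lists_def)
  also have "\<dots> = (\<Sum>es\<in>label_lists X n (legs_out p). \<Sum>es'\<in>label_lists X n (legs_out p').
      piece_weight X n p bs es * (piece_weight X n p' bs' es' * f (as @ es @ ms @ es' @ cs)))"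
  proof (intro sum.cong refl)
    fix es
    assume "es \<in> label_lists X n (legs_out p)"
    then have "as @ es @ ms \<in> label_lists X n (l + legs_out p + m)"
      using mem by (simp add: label_lists_def)
    from transfer_eq[OF this len(2) mem(5)]
    show "piece_weight X n p bs es * transfer X n (Slice (l + legs_out p + m) p' r) f ((as @ es @ ms) @ bs' @ cs) =
      (\<Sum>es'\<in>label_lists X n (legs_out p').
        piece_weight X n p bs es * (piece_weight X n p' bs' es' * f (as @ es @ ms @ es' @ cs)))"
      by (simp add: sum_distrib_left)
  qed
  also have "\<dots> = (\<Sum>es'\<in>label_lists X n (legs_out p'). \<Sum>es\<in>label_lists X n (legs_out p).
      piece_weight X n p' bs' es' * (piece_weight X n p bs es * f (as @ es @ ms @ es' @ cs)))"
    by (subst sum.swap) (simp add: mult.left_commute)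
  also have "\<dots> = (\<Sum>es'\<in>label_lists X n (legs_out p'). piece_weight X n p' bs' es' *
      transfer X n (Slice l p (m + legs_out p' + r)) f (as @ bs @ ms @ es' @ cs))"
  proof (intro sum.cong refl)
    fix es'
    assume "es' \<in> label_lists X n (legs_out p')"
    then have "ms @ es' @ cs \<in> label_lists X n (m + legs_out p' + r)"
      using mem by (simp add: label_lists_def)
    from transfer_eq[OF mem(1) len(1) this]
    show "(\<Sum>es\<in>label_lists X n (legs_out p).
        piece_weight X n p' bs' es' * (piece_weight X n p bs es * f (as @ es @ ms @ es' @ cs))) =
      piece_weight X n p' bs' es' * transfer X n (Slice l p (m + legs_out p' + r)) f (as @ bs @ ms @ es' @ cs)"
      by (simp add: sum_distrib_left)
  qed
  also have "\<dots> = evaluate X n [Slice (l + legs_in p + m) p' r, Slice l p (m + legs_out p' + r)] f xs"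
    unfolding xs using transfer_eq[OF _ len(2) mem(5), of "as @ bs @ ms" "l + legs_in p + m"] mem
    by (simp add: label_lists_def)
  finally show "evaluate X n [Slice l p (m + legs_in p' + r), Slice (l + legs_out p + m) p' r] f xs =
    evaluate X n [Slice (l + legs_in p + m) p' r, Slice l p (m + legs_out p' + r)] f xs" .
qed

lemma sum_delta_left: "finite S \<Longrightarrow> a \<in> S \<Longrightarrow> (\<Sum>c\<in>S. delta a c * F c) = (F a :: 'a::field)"
  by (simp add: delta_def if_distrib[of "\<lambda>x. x * _"] cong: if_cong)

lemma sum_delta_right: "finite S \<Longrightarrow> a \<in> S \<Longrightarrow> (\<Sum>c\<in>S. delta c a * F c) = (F a :: 'a::field)"
  by (simp add: delta_def if_distrib[of "\<lambda>x. x * _"] cong: if_cong)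

text \<open>Brings the outgoing labels \<open>p\<close>, \<open>q\<close>, \<open>r\<close> of a
  triple of crossings to the outside, so that the Yang--Baxter equation applies to the sum over the
  inner ones.\<close>

lemma sum_rotate_left:
  "(\<Sum>i\<in>S. \<Sum>j\<in>S. \<Sum>k\<in>S. \<Sum>r\<in>S. \<Sum>p\<in>S. \<Sum>q\<in>S. F i j k p q r) =
   (\<Sum>p\<in>S. \<Sum>q\<in>S. \<Sum>r\<in>S. \<Sum>i\<in>S. \<Sum>j\<in>S. \<Sum>k\<in>S. F i j k p q r)"
  by (simp only: sum.cartesian_product)
    (rule sum.reindex_bij_witness[of _ "\<lambda>(p, q, r, i, j, k). (i, j, k, r, p, q)" "\<lambda>(i, j, k, r, p, q). (p, q, r, i, j, k)"];
      auto)

lemma sum_rotate_right: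
  "(\<Sum>i\<in>S. \<Sum>j\<in>S. \<Sum>p\<in>S. \<Sum>k\<in>S. \<Sum>q\<in>S. \<Sum>r\<in>S. F i j k p q r) =
   (\<Sum>p\<in>S. \<Sum>q\<in>S. \<Sum>r\<in>S. \<Sum>i\<in>S. \<Sum>j\<in>S. \<Sum>k\<in>S. F i j k p q r)"
  by (simp only: sum.cartesian_product)
    (rule sum.reindex_bij_witness[of _ "\<lambda>(p, q, r, i, j, k). (i, j, p, k, q, r)" "\<lambda>(i, j, p, k, q, r). (p, q, r, i, j, k)"];
      auto)

definition crossing_weight :: "lie_type \<Rightarrow> nat \<Rightarrow> piece \<Rightarrow> nat \<Rightarrow> nat \<Rightarrow> nat \<Rightarrow> nat \<Rightarrow> K0" where
  "crossing_weight X n x a b p q = piece_weight X n x [a, b] [p, q]"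

lemma transfer_creation:
  assumes "as \<in> label_lists X n l" "cs \<in> label_lists X n r"
  shows "transfer X n (Slice l Creation r) f (as @ cs) =
    (\<Sum>a\<in>index_set X n. \<Sum>b\<in>index_set X n. fusion_inv X n a b * f (as @ a # b # cs))"
  using transfer_eq[OF assms(1) _ assms(2), of "[]" Creation f] by (simp add: sum_label_lists_2)

lemma transfer_annihilation:
  assumes "as \<in> label_lists X n l" "cs \<in> label_lists X n r"
  shows "transfer X n (Slice l Annihilation r) f (as @ a # b # cs) = fusion X n a b * f (as @ cs)"
  using transfer_eq[OF assms(1) _ assms(2), of "[a, b]" Annihilation f] by (simp add: label_lists_0)

lemma transfer_crossing:
  assumes "is_crossing x" "as \<in> label_lists X n l" "cs \<in> label_lists X n r"
  shows "transfer X n (Slice l x r) f (as @ a # b # cs) =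
    (\<Sum>p\<in>index_set X n. \<Sum>q\<in>index_set X n. crossing_weight X n x a b p q * f (as @ p # q # cs))"
proof -
  have "legs_in x = 2" "legs_out x = 2"
    using assms(1) by auto
  then show ?thesis
    using transfer_eq[OF assms(2) _ assms(3), of "[a, b]" x f]
    by (simp add: sum_label_lists_2 crossing_weight_def)
qed

lemma transfer_creation_Suc:
  assumes "as \<in> label_lists X n l" "cs \<in> label_lists X n r" "a \<in> index_set X n"
  shows "transfer X n (Slice (Suc l) Creation r) f (as @ a # cs) =
    (\<Sum>b\<in>index_set X n. \<Sum>c\<in>index_set X n. fusion_inv X n b c * f (as @ a # b # c # cs))"
  using transfer_creation[of "as @ [a]" X n "Suc l" cs r f] assms by (simp add: label_lists_def)

lemma transfer_annihilation_Suc: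
  assumes "as \<in> label_lists X n l" "cs \<in> label_lists X n r" "a \<in> index_set X n"
  shows "transfer X n (Slice (Suc l) Annihilation r) f (as @ a # b # c # cs) = fusion X n b c * f (as @ a # cs)"
  using transfer_annihilation[of "as @ [a]" X n "Suc l" cs r f] assms by (simp add: label_lists_def)

lemma transfer_crossing_Suc:
  assumes "is_crossing x" "as \<in> label_lists X n l" "cs \<in> label_lists X n r" "a \<in> index_set X n"
  shows "transfer X n (Slice (Suc l) x r) f (as @ a # b # c # cs) =
    (\<Sum>p\<in>index_set X n. \<Sum>q\<in>index_set X n. crossing_weight X n x b c p q * f (as @ a # p # q # cs))"
  using transfer_crossing[of x "as @ [a]" X n "Suc l" cs r f] assms by (simp add: label_lists_def)

lemma label_lists_1E:
  assumes "xs \<in> label_lists X n (l + 1 + r)"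
  obtains as a cs where "xs = as @ a # cs" "as \<in> label_lists X n l" "a \<in> index_set X n" "cs \<in> label_lists X n r"
proof -
  obtain as bs cs where "xs = as @ bs @ cs" "as \<in> label_lists X n l" "bs \<in> label_lists X n 1" "cs \<in> label_lists X n r"
    using assms by (elim label_lists_appendE) auto
  then show ?thesis
    using that[of as _ cs] by (auto simp: label_lists_def length_Suc_conv)
qed

lemma label_lists_SucE:
  assumes "xs \<in> label_lists X n (Suc r)"
  obtains a cs where "xs = a # cs" "a \<in> index_set X n" "cs \<in> label_lists X n r"
  using assms by (auto simp: label_lists_def length_Suc_conv)

lemma label_lists_2E:
  assumes "xs \<in> label_lists X n (l + 2 + r)"
  obtains as a b cs where "xs = as @ a # b # cs" "as \<in> label_lists X n l"
    "a \<in> index_set X n" "b \<in> index_set X n" "cs \<in> label_lists X n r"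
proof -
  have "xs \<in> label_lists X n (l + 1 + Suc r)"
    using assms by simp
  then obtain as a cs where "xs = as @ a # cs" "as \<in> label_lists X n l" "a \<in> index_set X n" "cs \<in> label_lists X n (Suc r)"
    by (rule label_lists_1E)
  then show ?thesis
    using that by (auto elim: label_lists_SucE)
qed

lemma label_lists_3E:
  assumes "xs \<in> label_lists X n (l + 3 + r)"
  obtains as a b c cs where "xs = as @ a # b # c # cs" "as \<in> label_lists X n l"
    "a \<in> index_set X n" "b \<in> index_set X n" "c \<in> index_set X n" "cs \<in> label_lists X n r"
proof -
  have "xs \<in> label_lists X n (l + 2 + Suc r)"
    using assms by (simp add: numeral_eq_Suc)
  then obtain as a b cs where "xs = as @ a # b # cs" "as \<in> label_lists X n l" "a \<in> index_set X n"
    "b \<in> index_set X n" "cs \<in> label_lists X n (Suc r)"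
    by (rule label_lists_2E)
  then show ?thesis
    using that by (auto elim: label_lists_SucE)
qed

text \<open>The identities of weights behind the moves and the skein rules, without reference to the
  type. The braid relation is required for \<open>CrossB\<close> alone; cancellation of opposite
  crossings yields the other signs.\<close>

locale skein_weights =
  fixes X :: lie_type and n :: nat and z \<alpha> :: K0
  assumes fusion_fusion_inv: "a \<in> index_set X n \<Longrightarrow> c \<in> index_set X n \<Longrightarrow>
      (\<Sum>b\<in>index_set X n. fusion X n a b * fusion_inv X n b c) = delta a c"
    and fusion_inv_fusion: "a \<in> index_set X n \<Longrightarrow> c \<in> index_set X n \<Longrightarrow>
      (\<Sum>b\<in>index_set X n. fusion_inv X n a b * fusion X n b c) = delta a c"
    and slide_fusion: "is_crossing x \<Longrightarrow> {a, b, c, d} \<subseteq> index_set X n \<Longrightarrow>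
      (\<Sum>p\<in>index_set X n. crossing_weight X n x b c p d * fusion X n a p) =
      (\<Sum>p\<in>index_set X n. crossing_weight X n (opposite x) a b d p * fusion X n p c)"
    and slide_fusion_inv: "is_crossing x \<Longrightarrow> {a, e, p, q} \<subseteq> index_set X n \<Longrightarrow>
      (\<Sum>b\<in>index_set X n. fusion_inv X n e b * crossing_weight X n x b a p q) =
      (\<Sum>b\<in>index_set X n. fusion_inv X n b q * crossing_weight X n (opposite x) a b e p)"
    and crossing_cancel: "is_crossing x \<Longrightarrow> {a, b, p, q} \<subseteq> index_set X n \<Longrightarrow>
      (\<Sum>i\<in>index_set X n. \<Sum>j\<in>index_set X n.
        crossing_weight X n x a b i j * crossing_weight X n (opposite x) i j p q) = delta a p * delta b q"
    and crossing_braid: "{a, b, c, p, q, r} \<subseteq> index_set X n \<Longrightarrow>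
      (\<Sum>i\<in>index_set X n. \<Sum>j\<in>index_set X n. \<Sum>k\<in>index_set X n.
        crossing_weight X n CrossB a b i j * (crossing_weight X n CrossB j c k r * crossing_weight X n CrossB i k p q)) =
      (\<Sum>i\<in>index_set X n. \<Sum>j\<in>index_set X n. \<Sum>k\<in>index_set X n.
        crossing_weight X n CrossB b c i j * (crossing_weight X n CrossB a i p k * crossing_weight X n CrossB k j q r))"
    and crossing_skein: "{a, b, p, q} \<subseteq> index_set X n \<Longrightarrow>
      crossing_weight X n CrossB a b p q - crossing_weight X n CrossBinv a b p q =
      z * (fusion X n a b * fusion_inv X n p q - delta a p * delta b q)"
    and curl_CrossB: "{a, b} \<subseteq> index_set X n \<Longrightarrow>
      (\<Sum>i\<in>index_set X n. \<Sum>j\<in>index_set X n. crossing_weight X n CrossB a b i j * fusion X n i j) =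
      \<alpha> * fusion X n a b"
    and curl_CrossBinv: "{a, b} \<subseteq> index_set X n \<Longrightarrow>
      (\<Sum>i\<in>index_set X n. \<Sum>j\<in>index_set X n. crossing_weight X n CrossBinv a b i j * fusion X n i j) =
      inverse \<alpha> * fusion X n a b"
    and circle: "(\<Sum>a\<in>index_set X n. \<Sum>b\<in>index_set X n. fusion_inv X n a b * fusion X n a b) =
      (\<alpha> - inverse \<alpha>) / z + 1"
begin

abbreviation I where "I \<equiv> index_set X n"
abbreviation labels where "labels \<equiv> label_lists X n"
abbreviation same where "same \<equiv> same_operator X n"

section \<open>Invariance under the local moves\<close>

lemma same_straighten_left:
  "same (l + 1 + r) [Slice (l + 1) Creation r, Slice l Annihilation (r + 1)] []"
proof (rule same_operatorI)
  fix f xs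
  assume "xs \<in> labels (l + 1 + r)"
  then obtain as a cs where xs: "xs = as @ a # cs" and mem: "as \<in> labels l" "a \<in> I" "cs \<in> labels r"
    by (elim label_lists_1E)
  have "evaluate X n [Slice (l + 1) Creation r, Slice l Annihilation (r + 1)] f xs =
    (\<Sum>b\<in>I. \<Sum>c\<in>I. fusion_inv X n b c * (fusion X n a b * f (as @ c # cs)))"
    using mem by (simp add: xs transfer_creation_Suc transfer_annihilation label_lists_Cons)
  also have "\<dots> = (\<Sum>c\<in>I. (\<Sum>b\<in>I. fusion X n a b * fusion_inv X n b c) * f (as @ c # cs))"
    by (subst sum.swap) (simp add: sum_distrib_left sum_distrib_right mult_ac)
  also have "\<dots> = f xs"
    using mem by (simp add: fusion_fusion_inv sum_delta_left xs)
  finally show "evaluate X n [Slice (l + 1) Creation r, Slice l Annihilation (r + 1)] f xs = evaluate X n [] f xs"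
    by simp
qed

lemma same_straighten_right:
  "same (l + 1 + r) [Slice l Creation (r + 1), Slice (l + 1) Annihilation r] []"
proof (rule same_operatorI)
  fix f xs
  assume "xs \<in> labels (l + 1 + r)"
  then obtain as a cs where xs: "xs = as @ a # cs" and mem: "as \<in> labels l" "a \<in> I" "cs \<in> labels r"
    by (elim label_lists_1E)
  have "evaluate X n [Slice l Creation (r + 1), Slice (l + 1) Annihilation r] f xs =
    (\<Sum>b\<in>I. \<Sum>c\<in>I. fusion_inv X n b c * (fusion X n c a * f (as @ b # cs)))"
    using mem by (simp add: xs transfer_creation transfer_annihilation_Suc label_lists_Cons)
  also have "\<dots> = (\<Sum>b\<in>I. (\<Sum>c\<in>I. fusion_inv X n b c * fusion X n c a) * f (as @ b # cs))"
    by (simp add: sum_distrib_right mult.assoc)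
  also have "\<dots> = f xs"
    using mem by (simp add: fusion_inv_fusion sum_delta_right xs)
  finally show "evaluate X n [Slice l Creation (r + 1), Slice (l + 1) Annihilation r] f xs = evaluate X n [] f xs"
    by simp
qed

lemma is_crossing_opposite: "is_crossing (opposite x) = is_crossing x"
  by (cases x) auto

lemma same_slide_annihilation:
  assumes "is_crossing x"
  shows "same (l + 3 + r) [Slice (l + 1) x r, Slice l Annihilation (r + 1)]
    [Slice l (opposite x) (r + 1), Slice (l + 1) Annihilation r]"
proof (rule same_operatorI)
  fix f xs
  assume "xs \<in> labels (l + 3 + r)"
  then obtain as a b c cs where xs: "xs = as @ a # b # c # cs"
    and mem: "as \<in> labels l" "a \<in> I" "b \<in> I" "c \<in> I" "cs \<in> labels r"
    by (elim label_lists_3E)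
  have x': "is_crossing (opposite x)"
    using assms is_crossing_opposite by blast
  have "evaluate X n [Slice (l + 1) x r, Slice l Annihilation (r + 1)] f xs =
    (\<Sum>p\<in>I. \<Sum>d\<in>I. crossing_weight X n x b c p d * (fusion X n a p * f (as @ d # cs)))"
    using mem by (simp add: xs transfer_crossing_Suc[OF assms] transfer_annihilation label_lists_Cons)
  also have "\<dots> = (\<Sum>d\<in>I. (\<Sum>p\<in>I. crossing_weight X n x b c p d * fusion X n a p) * f (as @ d # cs))"
    by (subst sum.swap) (simp add: sum_distrib_left sum_distrib_right mult_ac)
  also have "\<dots> = (\<Sum>d\<in>I. (\<Sum>p\<in>I. crossing_weight X n (opposite x) a b d p * fusion X n p c) * f (as @ d # cs))"
    using mem by (intro sum.cong refl arg_cong2[where f = "(*)"] slide_fusion[OF assms]) auto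
  also have "\<dots> = (\<Sum>d\<in>I. \<Sum>p\<in>I. crossing_weight X n (opposite x) a b d p * (fusion X n p c * f (as @ d # cs)))"
    by (simp add: sum_distrib_left sum_distrib_right mult_ac)
  also have "\<dots> = evaluate X n [Slice l (opposite x) (r + 1), Slice (l + 1) Annihilation r] f xs"
    using mem by (simp add: xs transfer_crossing[OF x'] transfer_annihilation_Suc label_lists_Cons)
  finally show "evaluate X n [Slice (l + 1) x r, Slice l Annihilation (r + 1)] f xs =
    evaluate X n [Slice l (opposite x) (r + 1), Slice (l + 1) Annihilation r] f xs" .
qed

lemma same_slide_creation:
  assumes "is_crossing x"
  shows "same (l + 1 + r) [Slice l Creation (r + 1), Slice (l + 1) x r]
    [Slice (l + 1) Creation r, Slice l (opposite x) (r + 1)]"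
proof (rule same_operatorI)
  fix f xs
  assume "xs \<in> labels (l + 1 + r)"
  then obtain as a cs where xs: "xs = as @ a # cs" and mem: "as \<in> labels l" "a \<in> I" "cs \<in> labels r"
    by (elim label_lists_1E)
  have x': "is_crossing (opposite x)"
    using assms is_crossing_opposite by blast
  have "evaluate X n [Slice l Creation (r + 1), Slice (l + 1) x r] f xs =
    (\<Sum>e\<in>I. \<Sum>b\<in>I. \<Sum>p\<in>I. \<Sum>q\<in>I. (fusion_inv X n e b * crossing_weight X n x b a p q) * f (as @ e # p # q # cs))"
    using mem by (simp add: xs transfer_creation transfer_crossing_Suc[OF assms] label_lists_Cons sum_distrib_left mult.assoc)
  also have "\<dots> = (\<Sum>e\<in>I. \<Sum>p\<in>I. \<Sum>q\<in>I. (\<Sum>b\<in>I. fusion_inv X n e b * crossing_weight X n x b a p q) * f (as @ e # p # q # cs))"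
    unfolding sum_distrib_right sum.cartesian_product
    by (rule sum.reindex_bij_witness[of _ "\<lambda>(e, p, q, b). (e, b, p, q)" "\<lambda>(e, b, p, q). (e, p, q, b)"]) auto
  also have "\<dots> = (\<Sum>e\<in>I. \<Sum>p\<in>I. \<Sum>q\<in>I. (\<Sum>b\<in>I. fusion_inv X n b q * crossing_weight X n (opposite x) a b e p) * f (as @ e # p # q # cs))"
    using mem by (intro sum.cong refl arg_cong2[where f = "(*)"] slide_fusion_inv[OF assms]) auto
  also have "\<dots> = (\<Sum>b\<in>I. \<Sum>q\<in>I. \<Sum>e\<in>I. \<Sum>p\<in>I. (fusion_inv X n b q * crossing_weight X n (opposite x) a b e p) * f (as @ e # p # q # cs))"
    unfolding sum_distrib_right sum.cartesian_product
    by (rule sum.reindex_bij_witness[of _ "\<lambda>(b, q, e, p). (e, p, q, b)" "\<lambda>(e, p, q, b). (b, q, e, p)"]) auto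
  also have "\<dots> = evaluate X n [Slice (l + 1) Creation r, Slice l (opposite x) (r + 1)] f xs"
    using mem by (simp add: xs transfer_creation_Suc transfer_crossing[OF x'] label_lists_Cons sum_distrib_left mult.assoc)
  finally show "evaluate X n [Slice l Creation (r + 1), Slice (l + 1) x r] f xs =
    evaluate X n [Slice (l + 1) Creation r, Slice l (opposite x) (r + 1)] f xs" .
qed

lemma same_cancel:
  assumes "is_crossing x"
  shows "same (l + 2 + r) [Slice l x r, Slice l (opposite x) r] []"
proof (rule same_operatorI)
  fix f xs
  assume "xs \<in> labels (l + 2 + r)"
  then obtain as a b cs where xs: "xs = as @ a # b # cs"
    and mem: "as \<in> labels l" "a \<in> I" "b \<in> I" "cs \<in> labels r"
    by (elim label_lists_2E)
  have x': "is_crossing (opposite x)"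
    using assms is_crossing_opposite by blast
  have "evaluate X n [Slice l x r, Slice l (opposite x) r] f xs =
    (\<Sum>i\<in>I. \<Sum>j\<in>I. \<Sum>p\<in>I. \<Sum>q\<in>I. (crossing_weight X n x a b i j * crossing_weight X n (opposite x) i j p q)
      * f (as @ p # q # cs))"
    using mem by (simp add: xs transfer_crossing[OF assms] transfer_crossing[OF x'] sum_distrib_left mult.assoc)
  also have "\<dots> = (\<Sum>p\<in>I. \<Sum>q\<in>I. (\<Sum>i\<in>I. \<Sum>j\<in>I. crossing_weight X n x a b i j * crossing_weight X n (opposite x) i j p q)
      * f (as @ p # q # cs))"
    unfolding sum_distrib_right sum.cartesian_product
    by (rule sum.reindex_bij_witness[of _ "\<lambda>(p, q, i, j). (i, j, p, q)" "\<lambda>(i, j, p, q). (p, q, i, j)"]) auto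
  also have "\<dots> = (\<Sum>p\<in>I. delta a p * (\<Sum>q\<in>I. delta b q * f (as @ p # q # cs)))"
    using mem by (simp add: crossing_cancel[OF assms] sum_distrib_left mult.assoc)
  also have "\<dots> = f xs"
    using mem by (simp add: sum_delta_left xs)
  finally show "evaluate X n [Slice l x r, Slice l (opposite x) r] f xs = evaluate X n [] f xs"
    by simp
qed

section \<open>The third Reidemeister move for all admissible signs\<close>

definition braid_relation :: "piece \<Rightarrow> piece \<Rightarrow> piece \<Rightarrow> bool" where
  "braid_relation x y w \<longleftrightarrow> (\<forall>l r. same (l + 3 + r)
     [Slice l x (r + 1), Slice (l + 1) y r, Slice l w (r + 1)]
     [Slice (l + 1) w r, Slice l y (r + 1), Slice (l + 1) x r])"

lemma braid_relation_CrossB: "braid_relation CrossB CrossB CrossB"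
  unfolding braid_relation_def
proof (intro allI, rule same_operatorI)
  fix l r f xs
  assume "xs \<in> labels (l + 3 + r)"
  then obtain as a b c cs where xs: "xs = as @ a # b # c # cs"
    and mem: "as \<in> labels l" "a \<in> I" "b \<in> I" "c \<in> I" "cs \<in> labels r"
    by (elim label_lists_3E)
  let ?B = "crossing_weight X n CrossB"
  have B: "is_crossing CrossB"
    by simp
  have "evaluate X n [Slice l CrossB (r + 1), Slice (l + 1) CrossB r, Slice l CrossB (r + 1)] f xs =
    (\<Sum>i\<in>I. \<Sum>j\<in>I. \<Sum>k\<in>I. \<Sum>t\<in>I. \<Sum>p\<in>I. \<Sum>q\<in>I.
      (?B a b i j * (?B j c k t * ?B i k p q)) * f (as @ p # q # t # cs))"
    using mem by (simp add: xs transfer_crossing[OF B] transfer_crossing_Suc[OF B] label_lists_Cons sum_distrib_left mult.assoc)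
  also have "\<dots> = (\<Sum>p\<in>I. \<Sum>q\<in>I. \<Sum>t\<in>I. (\<Sum>i\<in>I. \<Sum>j\<in>I. \<Sum>k\<in>I. ?B a b i j * (?B j c k t * ?B i k p q)) * f (as @ p # q # t # cs))"
    unfolding sum_distrib_right by (rule sum_rotate_left)
  also have "\<dots> = (\<Sum>p\<in>I. \<Sum>q\<in>I. \<Sum>t\<in>I. (\<Sum>i\<in>I. \<Sum>j\<in>I. \<Sum>k\<in>I. ?B b c i j * (?B a i p k * ?B k j q t)) * f (as @ p # q # t # cs))"
    using mem by (intro sum.cong refl arg_cong2[where f = "(*)"] crossing_braid) auto
  also have "\<dots> = (\<Sum>i\<in>I. \<Sum>j\<in>I. \<Sum>p\<in>I. \<Sum>k\<in>I. \<Sum>q\<in>I. \<Sum>t\<in>I.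
      (?B b c i j * (?B a i p k * ?B k j q t)) * f (as @ p # q # t # cs))"
    unfolding sum_distrib_right by (rule sum_rotate_right[symmetric])
  also have "\<dots> = evaluate X n [Slice (l + 1) CrossB r, Slice l CrossB (r + 1), Slice (l + 1) CrossB r] f xs"
    using mem by (simp add: xs transfer_crossing[OF B] transfer_crossing_Suc[OF B] label_lists_Cons sum_distrib_left mult.assoc)
  finally show "evaluate X n [Slice l CrossB (r + 1), Slice (l + 1) CrossB r, Slice l CrossB (r + 1)] f xs =
    evaluate X n [Slice (l + 1) CrossB r, Slice l CrossB (r + 1), Slice (l + 1) CrossB r] f xs" .
qed

lemma opposite_opposite: "opposite (opposite x) = x"
  by (cases x) auto

lemma same_cancel_opposite:
  assumes "is_crossing x"
  shows "same (l + 2 + r) [Slice l (opposite x) r, Slice l x r] []"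
  using same_cancel[of "opposite x" l r] assms unfolding is_crossing_opposite opposite_opposite .

lemma legs_crossing:
  assumes "is_crossing x"
  shows "legs_in x = 2" "legs_out x = 2" "legs_in (opposite x) = 2" "legs_out (opposite x) = 2"
  using assms by auto

text \<open>Multiplying both sides by the inverses of \<open>w\<close>, or of \<open>x\<close>,
  carries that crossing to the other side and gives the relation for another sign pattern.\<close>

lemma braid_relation_swap:
  assumes cr: "is_crossing x" "is_crossing y" "is_crossing w" and "braid_relation x y w"
  shows "braid_relation y x (opposite w)" and "braid_relation (opposite x) w y"
proof -
  let ?l = "\<lambda>x l r. Slice l x (r + 1)" and ?r = "\<lambda>x l r. Slice (l + 1) x r"
  note comp = legs_crossing[OF cr(1)] legs_crossing[OF cr(2)] legs_crossing[OF cr(3)]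
  have R: "same (l + 3 + r) [?l x l r, ?r y l r, ?l w l r] [?r w l r, ?l y l r, ?r x l r]" for l r
    using assms(4) by (simp add: braid_relation_def)
  have cancel: "same (l + 3 + r) [?l x l r, ?l (opposite x) l r] []" "same (l + 3 + r) [?l (opposite x) l r, ?l x l r] []"
    "same (l + 3 + r) [?r x l r, ?r (opposite x) l r] []" "same (l + 3 + r) [?r (opposite x) l r, ?r x l r] []"
    if "is_crossing x" for x l r
    using same_cancel[OF that, of l "r + 1"] same_cancel_opposite[OF that, of l "r + 1"]
      same_cancel[OF that, of "l + 1" r] same_cancel_opposite[OF that, of "l + 1" r]
    by (simp_all add: numeral_eq_Suc)
  show "braid_relation y x (opposite w)"
    unfolding braid_relation_def
  proof (intro allI)
    fix l r
    have "same (l + 3 + r) ([] @ [] @ [?l y l r, ?r x l r, ?l (opposite w) l r])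
      ([] @ [?r (opposite w) l r, ?r w l r] @ [?l y l r, ?r x l r, ?l (opposite w) l r])"
      by (rule same_operator_context[OF cancel(4)[OF cr(3), THEN same_operator_sym]]) simp
    also have "same (l + 3 + r) ([] @ [?r (opposite w) l r, ?r w l r] @ [?l y l r, ?r x l r, ?l (opposite w) l r])
      ([?r (opposite w) l r] @ [?l x l r, ?r y l r, ?l w l r] @ [?l (opposite w) l r])"
      using same_operator_context[OF R[THEN same_operator_sym], of "l + 3 + r" "[?r (opposite w) l r]" l r "[?l (opposite w) l r]"]
      by (simp add: comp)
    also have "same (l + 3 + r) ([?r (opposite w) l r] @ [?l x l r, ?r y l r, ?l w l r] @ [?l (opposite w) l r])
      ([?r (opposite w) l r, ?l x l r, ?r y l r] @ [] @ [])"
      using same_operator_context[OF cancel(1)[OF cr(3)], of "l + 3 + r" "[?r (opposite w) l r, ?l x l r, ?r y l r]" l r "[]"]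
      by (simp add: comp)
    finally show "same (l + 3 + r) [?l y l r, ?r x l r, ?l (opposite w) l r] [?r (opposite w) l r, ?l x l r, ?r y l r]"
      by simp
  qed
  show "braid_relation (opposite x) w y"
    unfolding braid_relation_def
  proof (intro allI)
    fix l r
    have "same (l + 3 + r) ([?l (opposite x) l r, ?r w l r, ?l y l r] @ [] @ [])
      ([?l (opposite x) l r, ?r w l r, ?l y l r] @ [?r x l r, ?r (opposite x) l r] @ [])"
      using same_operator_context[OF cancel(3)[OF cr(1), THEN same_operator_sym], of "l + 3 + r"
          "[?l (opposite x) l r, ?r w l r, ?l y l r]" l r "[]"]
      by (simp add: comp)
    also have "same (l + 3 + r) ([?l (opposite x) l r, ?r w l r, ?l y l r] @ [?r x l r, ?r (opposite x) l r] @ [])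
      ([?l (opposite x) l r] @ [?l x l r, ?r y l r, ?l w l r] @ [?r (opposite x) l r])"
      using same_operator_context[OF R[THEN same_operator_sym], of "l + 3 + r" "[?l (opposite x) l r]" l r "[?r (opposite x) l r]"]
      by (simp add: comp)
    also have "same (l + 3 + r) ([?l (opposite x) l r] @ [?l x l r, ?r y l r, ?l w l r] @ [?r (opposite x) l r])
      ([] @ [] @ [?r y l r, ?l w l r, ?r (opposite x) l r])"
      using same_operator_context[OF cancel(2)[OF cr(1)], of "l + 3 + r" "[]" l r "[?r y l r, ?l w l r, ?r (opposite x) l r]"]
      by (simp add: comp)
    finally show "same (l + 3 + r) [?l (opposite x) l r, ?r w l r, ?l y l r] [?r y l r, ?l w l r, ?r (opposite x) l r]"
      by simp
  qed
qed

text \<open>Five swaps that start from three \<open>CrossB\<close> produce the five other admissible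
  sign patterns.\<close>

lemma braid_relation_crossings:
  assumes "is_crossing x" "is_crossing y" "is_crossing w" "\<not> (x = w \<and> y = opposite x)"
  shows "braid_relation x y w"
proof -
  note swap = braid_relation_swap[of CrossB CrossB CrossB, OF _ _ _ braid_relation_CrossB, simplified]
  have "braid_relation CrossBinv CrossBinv CrossB" "braid_relation CrossB CrossBinv CrossBinv"
    using braid_relation_swap(2)[OF _ _ _ swap(1)] braid_relation_swap(1)[OF _ _ _ swap(2)] by simp_all
  moreover from this(1) have "braid_relation CrossBinv CrossBinv CrossBinv"
    using braid_relation_swap(1)[of CrossBinv CrossBinv CrossB] by simp
  ultimately show ?thesis
    using assms swap braid_relation_CrossB by auto
qed

lemma local_move_same:
  assumes "local_move x y" "composable m x k" "composable m y k'"
  shows "same m x y"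
  using assms(1)
proof (cases rule: local_move.cases)
  case (exchange l p m' p' r)
  then show ?thesis
    using same_operator_exchange[of X n l p m' p' r] assms(2) by (simp add: add_ac)
next
  case (straighten_left l r)
  then show ?thesis
    using same_straighten_left[of l r] assms(2) by simp
next
  case (straighten_right l r)
  then show ?thesis
    using same_straighten_right[of l r] assms(2) by simp
next
  case (slide_annihilation x' l r)
  then have "m = l + 3 + r"
    using assms(2) by auto
  then show ?thesis
    using same_slide_annihilation slide_annihilation by simp
next
  case (slide_creation x' l r)
  then show ?thesis
    using same_slide_creation[of x' l r] assms(2) by simp
next
  case (reidemeister_II x' l r)
  then have "m = l + 2 + r"
    using assms(2) by auto
  then show ?thesis
    using same_cancel reidemeister_II by simp
next
  case (reidemeister_III x' y' w l r)
  then have "m = l + 3 + r"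
    using assms(2) by auto
  then show ?thesis
    using braid_relation_crossings[of x' y' w] reidemeister_III by (simp add: braid_relation_def)
qed

lemma state_sum_same:
  assumes "same m x y" "composable 0 u m"
  shows "state_sum X n (u @ x @ v) = state_sum X n (u @ y @ v)"
  using same_operator_context[OF assms, of v]
  by (simp add: state_sum_eq_evaluate same_operator_def label_lists_0)

lemma state_sum_regularly_isotopic:
  assumes "regularly_isotopic K K'"
  shows "state_sum X n K = state_sum X n K'"
proof -
  have invariant: "state_sum X n K = state_sum X n K'" if step: "regular_isotopy_step K K'" for K K'
  proof -
    obtain u v x y where K: "K = u @ x @ v" "K' = u @ y @ v" "local_move x y"
      using step unfolding regular_isotopy_step_def by (elim conjE exE)
    have "composable 0 K 0" "composable 0 K' 0"
      using step by (simp_all add: regular_isotopy_step_def link_diagram_def)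
    obtain m k where x: "composable 0 u m" "composable m x k"
      using \<open>composable 0 K 0\<close> K by (auto simp: composable_append)
    obtain k' where "composable m y k'"
      using \<open>composable 0 K' 0\<close> K composable_unique[OF x(1)] by (auto simp: composable_append)
    with x K show ?thesis
      using local_move_same state_sum_same by blast
  qed
  show ?thesis
    using assms unfolding regularly_isotopic_def
    by (induction rule: equivclp_induct) (auto dest: invariant)
qed


section \<open>Skein relation, curls and circle for the state sum\<close>

lemma state_sum_skein:
  assumes "composable 0 u (l + 2 + r)"
  shows "state_sum X n (u @ [Slice l CrossB r] @ v) - state_sum X n (u @ [Slice l CrossBinv r] @ v) =
    z * (state_sum X n (u @ [Slice l Annihilation r, Slice l Creation r] @ v) - state_sum X n (u @ v))"
proof -
  let ?g = "evaluate X n v (\<lambda>_. 1)"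
  let ?E = "\<lambda>w. evaluate X n w ?g"
  \<comment> \<open>Both sides are put into the form \<open>c * f + d * g\<close> of
    \<open>evaluate_linear\<close>, so that the lower part of the diagram can be applied to
    them.\<close>
  have local: "1 * ?E [Slice l CrossB r] xs + - 1 * ?E [Slice l CrossBinv r] xs =
      z * ?E [Slice l Annihilation r, Slice l Creation r] xs + - z * ?g xs"
    if level: "xs \<in> labels (l + 2 + r)" for xs
  proof -
    obtain as a b cs where xs: "xs = as @ a # b # cs"
      and mem: "as \<in> labels l" "a \<in> I" "b \<in> I" "cs \<in> labels r"
      using level by (elim label_lists_2E)
    have "?E [Slice l CrossB r] xs - ?E [Slice l CrossBinv r] xs =
      (\<Sum>p\<in>I. \<Sum>q\<in>I. (crossing_weight X n CrossB a b p q - crossing_weight X n CrossBinv a b p q) * ?g (as @ p # q # cs))"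
      using mem by (simp add: xs transfer_crossing sum_subtractf left_diff_distrib)
    also have "\<dots> = (\<Sum>p\<in>I. \<Sum>q\<in>I. z * (fusion X n a b * fusion_inv X n p q - delta a p * delta b q) * ?g (as @ p # q # cs))"
      using mem by (intro sum.cong refl arg_cong2[where f = "(*)"] crossing_skein) auto
    also have "\<dots> = z * (fusion X n a b * (\<Sum>p\<in>I. \<Sum>q\<in>I. fusion_inv X n p q * ?g (as @ p # q # cs)))
      - z * (\<Sum>p\<in>I. delta a p * (\<Sum>q\<in>I. delta b q * ?g (as @ p # q # cs)))"
      by (simp add: sum_distrib_left sum_subtractf algebra_simps)
    also have "(\<Sum>p\<in>I. delta a p * (\<Sum>q\<in>I. delta b q * ?g (as @ p # q # cs))) = ?g xs"
      using mem by (simp add: sum_delta_left xs)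
    also have "fusion X n a b * (\<Sum>p\<in>I. \<Sum>q\<in>I. fusion_inv X n p q * ?g (as @ p # q # cs)) =
      ?E [Slice l Annihilation r, Slice l Creation r] xs"
      using mem by (simp add: xs transfer_annihilation transfer_creation)
    finally show ?thesis
      by simp
  qed
  have "evaluate X n u (\<lambda>xs. 1 * ?E [Slice l CrossB r] xs + - 1 * ?E [Slice l CrossBinv r] xs) [] =
    evaluate X n u (\<lambda>xs. z * ?E [Slice l Annihilation r, Slice l Creation r] xs + - z * ?g xs) []"
    by (rule evaluate_cong[OF assms]) (simp add: label_lists_0, rule local)
  then show ?thesis
    unfolding evaluate_linear by (simp add: state_sum_eq_evaluate evaluate_append right_diff_distrib)
qed

lemma state_sum_curl:
  assumes u: "composable 0 u (l + 2 + r)" and x: "is_crossing x"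
    and curl: "\<And>a b. {a, b} \<subseteq> I \<Longrightarrow> (\<Sum>i\<in>I. \<Sum>j\<in>I. crossing_weight X n x a b i j * fusion X n i j) = c * fusion X n a b"
  shows "state_sum X n (u @ [Slice l x r, Slice l Annihilation r] @ v) = c * state_sum X n (u @ [Slice l Annihilation r] @ v)"
proof -
  let ?g = "evaluate X n v (\<lambda>_. 1)"
  have "evaluate X n [Slice l x r, Slice l Annihilation r] ?g xs = c * evaluate X n [Slice l Annihilation r] ?g xs + 0 * ?g xs"
    if level: "xs \<in> labels (l + 2 + r)" for xs
  proof -
    obtain as a b cs where xs: "xs = as @ a # b # cs"
      and mem: "as \<in> labels l" "a \<in> I" "b \<in> I" "cs \<in> labels r"
      using level by (elim label_lists_2E)
    have "evaluate X n [Slice l x r, Slice l Annihilation r] ?g xs =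
      (\<Sum>i\<in>I. \<Sum>j\<in>I. crossing_weight X n x a b i j * fusion X n i j) * ?g (as @ cs)"
      using mem by (simp add: xs transfer_crossing[OF x] transfer_annihilation sum_distrib_right mult.assoc)
    then show ?thesis
      using mem by (simp add: curl xs transfer_annihilation)
  qed
  then have "evaluate X n u (evaluate X n [Slice l x r, Slice l Annihilation r] ?g) [] =
    evaluate X n u (\<lambda>xs. c * evaluate X n [Slice l Annihilation r] ?g xs + 0 * ?g xs) []"
    by (intro evaluate_cong[OF u]) (simp_all only: label_lists_0 singleton_iff)
  then show ?thesis
    unfolding evaluate_linear by (simp add: state_sum_eq_evaluate evaluate_append)
qed

lemma state_sum_circle: "state_sum X n [Slice 0 Creation 0, Slice 0 Annihilation 0] = (\<alpha> - inverse \<alpha>) / z + 1"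
  using transfer_creation[of "[]" X n 0 "[]" 0] transfer_annihilation[of "[]" X n 0 "[]" 0] circle
  by (simp add: state_sum_eq_evaluate label_lists_0)

lemma kauffman_invariant_state_sum:
  "kauffman_invariant z \<alpha> (restrict (state_sum X n) {K. link_diagram K})"
proof -
  have diagrams: "link_diagram (u @ [Slice l CrossBinv r] @ v) \<and>
      link_diagram (u @ [Slice l Annihilation r, Slice l Creation r] @ v) \<and> link_diagram (u @ v) \<and> composable 0 u (l + 2 + r)"
    if "link_diagram (u @ [Slice l CrossB r] @ v)" for u v l r
    using that by (auto simp: link_diagram_def composable_append)
  have curl_diagrams: "link_diagram (u @ [Slice l x r, Slice l Annihilation r] @ v) \<and> composable 0 u (l + 2 + r)"
    if "link_diagram (u @ [Slice l Annihilation r] @ v)" "is_crossing x" for u v l r x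
    using that by (auto simp: link_diagram_def composable_append)
  show ?thesis
    unfolding kauffman_invariant_def
  proof (intro conjI allI impI)
    fix K K'
    assume "link_diagram K" "link_diagram K'" "regularly_isotopic K K'"
    then show "restrict (state_sum X n) {K. link_diagram K} K = restrict (state_sum X n) {K. link_diagram K} K'"
      using state_sum_regularly_isotopic by simp
  next
    fix u v l r
    assume "link_diagram (u @ [Slice l CrossB r] @ v)"
    then show "restrict (state_sum X n) {K. link_diagram K} (u @ [Slice l CrossB r] @ v)
        - restrict (state_sum X n) {K. link_diagram K} (u @ [Slice l CrossBinv r] @ v) =
      z * (restrict (state_sum X n) {K. link_diagram K} (u @ [Slice l Annihilation r, Slice l Creation r] @ v)
        - restrict (state_sum X n) {K. link_diagram K} (u @ v))"
      using diagrams[of u l r v] state_sum_skein[of u l r v] by simp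
  next
    show "restrict (state_sum X n) {K. link_diagram K} [Slice 0 Creation 0, Slice 0 Annihilation 0] =
      (\<alpha> - inverse \<alpha>) / z + 1"
      by (simp add: link_diagram_def state_sum_circle)
  next
    fix u v l r
    assume K: "link_diagram (u @ [Slice l Annihilation r] @ v)"
    show "restrict (state_sum X n) {K. link_diagram K} (u @ [Slice l CrossB r, Slice l Annihilation r] @ v) =
      \<alpha> * restrict (state_sum X n) {K. link_diagram K} (u @ [Slice l Annihilation r] @ v)"
      using K curl_diagrams[OF K, of CrossB] state_sum_curl[of u l r CrossB \<alpha> v] curl_CrossB by simp
    show "restrict (state_sum X n) {K. link_diagram K} (u @ [Slice l CrossBinv r, Slice l Annihilation r] @ v) =
      inverse \<alpha> * restrict (state_sum X n) {K. link_diagram K} (u @ [Slice l Annihilation r] @ v)"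
      using K curl_diagrams[OF K, of CrossBinv] state_sum_curl[of u l r CrossBinv "inverse \<alpha>" v] curl_CrossBinv by simp
  qed
qed

end


section \<open>The matrices of types B, C and D\<close>

lemma t_var_nonzero: "t_var \<noteq> 0"
  by (simp add: t_var_def Zero_fract_def eq_fract)

lemma q4_add: "q4 (x + y) = q4 x * q4 y"
  by (simp add: q4_def power_int_add t_var_nonzero)

lemma q4_0: "q4 0 = 1"
  by (simp add: q4_def)

lemma q4_minus: "q4 (- x) = inverse (q4 x)"
  by (simp add: q4_def power_int_minus)

lemma q4_nonzero: "q4 x \<noteq> 0"
  by (simp add: q4_def t_var_nonzero)

lemma q4_power2: "q4 x ^ 2 = q4 (2 * x)"
  by (simp add: power2_eq_square flip: q4_add)

lemma imag_K0_square: "imag_K0 * imag_K0 = - 1"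
  by (simp add: imag_K0_def One_fract_def one_pCons)

lemma imag_K0_square_left: "imag_K0 * (imag_K0 * x) = - x"
  by (simp add: imag_K0_square flip: mult.assoc)

text \<open>A degree comparison: the indeterminate is not a root of unity. This is what keeps
  \<open>z\<close> from vanishing.\<close>

lemma q4_eq_1_iff: "q4 (int k) = 1 \<longleftrightarrow> k = 0"
proof
  assume "q4 (int k) = 1"
  moreover have "t_var ^ k = Fract ([:0, 1:] ^ k) 1"
    by (induction k) (simp_all add: t_var_def One_fract_def)
  ultimately have "[:0, 1:] ^ k = (1 :: complex poly)"
    by (simp add: q4_def One_fract_def eq_fract)
  then have "degree ([:0, 1:] ^ k :: complex poly) = 0"
    by simp
  then show "k = 0"
    by (simp add: degree_power_eq)
qed (simp add: q4_0)

fun root_q :: "lie_type \<Rightarrow> K0" where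
  "root_q TypeB = q4 2"
| "root_q TypeC = q4 1"
| "root_q TypeD = q4 2"

lemma root_q_nonzero: "root_q X \<noteq> 0"
  by (cases X) (simp_all add: q4_nonzero)

lemma gam_eq: "gam X = inverse (root_q X)"
  by (cases X) (simp_all flip: q4_minus)

lemma param_z_eq: "param_z X = root_q X - inverse (root_q X)"
  by (cases X) (simp_all flip: q4_minus)

lemma param_z_nonzero: "param_z X \<noteq> 0"
proof
  assume "param_z X = 0"
  then have "root_q X * root_q X = 1"
    using root_q_nonzero[of X] by (simp add: param_z_eq field_simps)
  then have "q4 (int (case X of TypeC \<Rightarrow> 2 | _ \<Rightarrow> 4)) = 1"
    by (cases X) (simp_all flip: q4_add)
  then show False
    by (simp only: q4_eq_1_iff) (simp split: lie_type.splits)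
qed

section \<open>Labels and weights of the three types\<close>

definition label :: "lie_type \<Rightarrow> nat \<Rightarrow> nat \<Rightarrow> int" where
  "label X n a = 2 * int a - int (top_index X n)"

definition weight_fun :: "lie_type \<Rightarrow> nat \<Rightarrow> int \<Rightarrow> K0" where
  "weight_fun X n u = (if u = 0 then 1 else zeta X (int n) ((u + int (top_index X n)) div 2))"

lemma weight_fun_label:
  assumes "rank_ok X n"
  shows "weight_fun X n (label X n a) = zeta X (int n) (int a)"
proof (cases "label X n a = 0")
  case True
  then have "X = TypeB \<and> a = n"
    using assms by (cases X; simp add: label_def) presburger+
  with True show ?thesis
    by (simp add: weight_fun_def)
next
  case False
  then show ?thesis
    by (simp add: weight_fun_def label_def)
qed

lemma label_complement: "a \<in> index_set X n \<Longrightarrow> label X n (top_index X n - a) = - label X n a"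
  by (auto simp: label_def index_set_def)

lemma label_eq_iff [simp]: "label X n a = label X n b \<longleftrightarrow> a = b"
  by (simp add: label_def)

lemma label_less_iff [simp]: "label X n a < label X n b \<longleftrightarrow> a < b"
  by (simp add: label_def)

lemma label_add_eq_0 [simp]: "label X n a + label X n b = 0 \<longleftrightarrow> a + b = top_index X n"
  by (auto simp: label_def)

lemma zeta_complement:
  assumes "rank_ok X n" "a \<le> top_index X n"
  shows "zeta X (int n) (int a) * zeta X (int n) (int (top_index X n) - int a) = 1"
  using assms imag_K0_square
  by (cases X) (auto simp: of_nat_diff q4_0 mult_ac simp flip: q4_add)

text \<open>In type C the square of the imaginary unit gives the minus sign that reappears in
  \<alpha>.\<close>

lemma zeta_square:
  "zeta TypeB n a ^ 2 = (if a < n then q4 (4 * (n - a) - 2) else if a = n then 1 else q4 (4 * (n - a) + 2))"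
  "zeta TypeC n a ^ 2 = (if a \<le> n - 1 then - q4 (2 * (n - a)) else - q4 (2 * (n - 1 - a)))"
  "zeta TypeD n a ^ 2 = (if a \<le> n - 1 then q4 (4 * (n - 1 - a)) else q4 (4 * (n - a)))"
  using imag_K0_square by (simp_all add: power_mult_distrib q4_power2 power2_eq_square[of imag_K0] algebra_simps)

text \<open>Telescoping: each step raises the right-hand side by \<open>z\<close> times one square.
  Within a half this is the ratio of consecutive powers of \<open>q\<close>. The jump of the
  conditional terms accounts for the passage through the middle, which takes two steps in type B and
  one otherwise.\<close>

lemma zeta_partial_sum:
  assumes "rank_ok X n" "a \<le> top_index X n"
  shows "param_z X * (\<Sum>e<a. zeta X (int n) (int e) ^ 2) = param_\<alpha> X n
    + (if 0 < label X n a then param_z X else 0) - (if label X n a = 0 then 1 else root_q X) * zeta X (int n) (int a) ^ 2"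
  using assms(2)
proof (induction a)
  case 0
  show ?case
    using assms(1) by (cases X) (auto simp: label_def zeta_square add.commute[of 1] simp del: zeta.simps simp flip: q4_add)
next
  case (Suc a)
  then have IH: "param_z X * (\<Sum>e<a. zeta X (int n) (int e) ^ 2) = param_\<alpha> X n
    + (if 0 < label X n a then param_z X else 0) - (if label X n a = 0 then 1 else root_q X) * zeta X (int n) (int a) ^ 2"
    by simp
  have "(if 0 < label X n (Suc a) then param_z X else 0) - (if label X n (Suc a) = 0 then 1 else root_q X) * zeta X (int n) (int (Suc a)) ^ 2
    = (if 0 < label X n a then param_z X else 0) - (if label X n a = 0 then 1 else root_q X) * zeta X (int n) (int a) ^ 2
      + param_z X * zeta X (int n) (int a) ^ 2"
  proof (cases X)
    case TypeB
    consider "a + 1 < n" | "a + 1 = n" | "a = n" | "n < a"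
      by linarith
    then show ?thesis
      by cases (auto simp: TypeB label_def zeta_square algebra_simps q4_0 simp del: zeta.simps simp flip: q4_add)
  next
    case TypeC
    consider "a + 1 < n" | "a + 1 = n" | "n \<le> a"
      by linarith
    then show ?thesis
      using assms(1) by cases (auto simp: TypeC label_def zeta_square algebra_simps q4_0 simp del: zeta.simps simp flip: q4_add)
  next
    case TypeD
    consider "a + 1 < n" | "a + 1 = n" | "n \<le> a"
      by linarith
    then show ?thesis
      using assms(1) by cases (auto simp: TypeD label_def zeta_square algebra_simps q4_0 simp del: zeta.simps simp flip: q4_add)
  qed
  with IH show ?case
    by (simp add: distrib_left)
qed

text \<open>The shifts of the exponents between the cases come from the different normalisation of
  \<open>zeta\<close> in the two halves. In type C equal halves of \<open>a\<close> and
  \<open>N - d\<close> contribute the square of an imaginary unit, hence the sign change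
  there.\<close>

lemma beta_eq:
  assumes "rank_ok X n" "a < d" "d \<le> top_index X n"
  shows "beta X (int n) (int a) (int d) =
    param_z X * zeta X (int n) (int a) * zeta X (int n) (int (top_index X n) - int d)
    - (if a + d = top_index X n then param_z X else 0)"
proof (cases X)
  case TypeB
  let ?sign = "(int a - int n) * (int d - int n)"
  \<comment> \<open>The sign of the product is recorded with each position because the definition of
    \<open>beta\<close> branches on it.\<close>
  consider "d < n" "0 < ?sign" | "d = n" | "a < n" "n < d" "?sign < 0" | "a = n" | "n < a" "0 < ?sign"
  proof -
    have "d < n \<Longrightarrow> 0 < ?sign" "a < n \<Longrightarrow> n < d \<Longrightarrow> ?sign < 0" "n < a \<Longrightarrow> 0 < ?sign"
      using assms(2) by (auto intro: mult_neg_neg mult_neg_pos mult_pos_pos)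
    then show ?thesis
      using that by linarith
  qed
  then show ?thesis
    using assms(2,3)
    by cases (simp_all add: TypeB, auto simp: delta_def algebra_simps simp flip: q4_add)
next
  case TypeC
  let ?sign = "(2 * int a - 2 * int n + 1) * (2 * int d - 2 * int n + 1)"
  consider "d < n" "0 < ?sign" | "a < n" "n \<le> d" "?sign < 0" | "n \<le> a" "0 < ?sign"
  proof -
    have "d < n \<Longrightarrow> 0 < ?sign" "a < n \<Longrightarrow> n \<le> d \<Longrightarrow> ?sign < 0" "n \<le> a \<Longrightarrow> 0 < ?sign"
      using assms(2) by (auto intro: mult_neg_neg mult_neg_pos mult_pos_pos)
    then show ?thesis
      using that by linarith
  qed
  then show ?thesis
    using assms
    by cases (simp_all add: TypeC, auto simp: imag_K0_square_left delta_def algebra_simps of_nat_diff simp flip: q4_add)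
next
  case TypeD
  let ?sign = "(2 * int a - 2 * int n + 1) * (2 * int d - 2 * int n + 1)"
  consider "d < n" "0 < ?sign" | "a < n" "n \<le> d" "?sign < 0" | "n \<le> a" "0 < ?sign"
  proof -
    have "d < n \<Longrightarrow> 0 < ?sign" "a < n \<Longrightarrow> n \<le> d \<Longrightarrow> ?sign < 0" "n \<le> a \<Longrightarrow> 0 < ?sign"
      using assms(2) by (auto intro: mult_neg_neg mult_neg_pos mult_pos_pos)
    then show ?thesis
      using that by linarith
  qed
  then show ?thesis
    using assms
    by cases (simp_all add: TypeD, auto simp: delta_def algebra_simps of_nat_diff simp flip: q4_add)
qed

text \<open>A two-sided inverse is unique on \<open>S\<close>, and the zero condition settles the
  entries outside.\<close>

lemma matrix_inverse_on_eq:
  fixes A C :: "'i \<Rightarrow> 'i \<Rightarrow> 'a::field"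
  assumes S: "finite S" and zero: "\<And>i j. i \<notin> S \<or> j \<notin> S \<Longrightarrow> C i j = 0"
    and AC: "\<And>i j. i \<in> S \<Longrightarrow> j \<in> S \<Longrightarrow> (\<Sum>k\<in>S. A i k * C k j) = delta i j"
    and CA: "\<And>i j. i \<in> S \<Longrightarrow> j \<in> S \<Longrightarrow> (\<Sum>k\<in>S. C i k * A k j) = delta i j"
  shows "matrix_inverse_on S A = C"
  unfolding matrix_inverse_on_def
proof (rule the_equality)
  fix D
  assume D: "(\<forall>i j. i \<notin> S \<or> j \<notin> S \<longrightarrow> D i j = 0) \<and>
    (\<forall>i\<in>S. \<forall>j\<in>S. (\<Sum>k\<in>S. A i k * D k j) = delta i j \<and> (\<Sum>k\<in>S. D i k * A k j) = delta i j)"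
  show "D = C"
  proof (intro ext)
    fix i j
    show "D i j = C i j"
    proof (cases "i \<in> S \<and> j \<in> S")
      case True
      have "D i j = (\<Sum>k\<in>S. D i k * delta k j)"
        using True S by (simp add: delta_def if_distrib cong: if_cong)
      also have "\<dots> = (\<Sum>k\<in>S. D i k * (\<Sum>l\<in>S. A k l * C l j))"
        using True by (simp add: AC)
      also have "\<dots> = (\<Sum>l\<in>S. (\<Sum>k\<in>S. D i k * A k l) * C l j)"
        unfolding sum_distrib_left sum_distrib_right by (subst sum.swap) (simp add: mult.assoc)
      also have "\<dots> = (\<Sum>l\<in>S. delta i l * C l j)"
        using True D by simp
      also have "\<dots> = C i j"
        using True S by (simp add: sum_delta_left)
      finally show ?thesis .
    qed (use D zero in auto)
  qed
qed (use assms in auto)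

section \<open>Verification of the abstract identities for the given matrices\<close>

context
  fixes X :: lie_type and n :: nat
  assumes rank: "rank_ok X n"
begin

private abbreviation (input) "N \<equiv> top_index X n"
private abbreviation (input) "idx \<equiv> index_set X n"
private abbreviation (input) "lab \<equiv> label X n"

lemma sum_label: "(\<Sum>u\<in>lab ` idx. F u) = (\<Sum>a\<in>idx. F (lab a))"
  by (subst sum.reindex) (auto simp: inj_on_def)

lemma top_index_pos: "0 < N"
  using rank by (cases X) auto

interpretation braiding_data "lab ` idx" "root_q X" "param_\<alpha> X n" "weight_fun X n"
  rewrites "braiding_data.z (root_q X) = param_z X"
proof -
  show "braiding_data (lab ` idx) (root_q X) (param_\<alpha> X n) (weight_fun X n)"
  proof
    fix u
    assume "u \<in> lab ` idx"
    then obtain a where a: "a \<in> idx" "u = lab a"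
      by blast
    have c: "N - a \<in> idx" "lab (N - a) = - u"
      using a by (auto simp: index_set_def label_def)
    then show "- u \<in> lab ` idx"
      by (metis image_eqI)
    show "weight_fun X n u * weight_fun X n (- u) = 1"
      using a zeta_complement[OF rank, of a] weight_fun_label[OF rank, of "N - a"] weight_fun_label[OF rank, of a]
      by (simp add: c(2) index_set_def of_nat_diff)
    have "{e \<in> lab ` idx. e < u} = lab ` {..<a}"
      using a by (auto simp: index_set_def image_iff)
    then have "(\<Sum>e | e \<in> lab ` idx \<and> e < u. weight_fun X n e ^ 2) = (\<Sum>e<a. zeta X (int n) (int e) ^ 2)"
      by (simp add: sum.reindex inj_on_def weight_fun_label[OF rank])
    then show "(root_q X - inverse (root_q X)) * (\<Sum>e | e \<in> lab ` idx \<and> e < u. weight_fun X n e ^ 2) =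
      param_\<alpha> X n + (if 0 < u then root_q X - inverse (root_q X) else 0) - (if u = 0 then 1 else root_q X) * weight_fun X n u ^ 2"
      using zeta_partial_sum[OF rank, of a] a by (simp add: param_z_eq weight_fun_label[OF rank] index_set_def)
  next
    show "\<exists>u\<in>lab ` idx. 0 < u"
      using top_index_pos by (intro bexI[of _ "lab N"]) (auto simp: index_set_def label_def)
  qed (simp_all add: root_q_nonzero weight_fun_def)
  then show "braiding_data.z (root_q X) = param_z X"
    by (simp add: braiding_data.z_def param_z_eq)
qed

lemma zeta_mult_complement: "a \<in> idx \<Longrightarrow> zeta X (int n) (int a) * zeta X (int n) (int (N - a)) = 1"
  using zeta_complement[OF rank, of a] by (simp add: index_set_def of_nat_diff)

lemma sum_complement:
  assumes "a \<in> idx"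
  shows "(\<Sum>b\<in>idx. if a + b = N then F b else 0) = (F (N - a) :: K0)" "(\<Sum>b\<in>idx. if b + a = N then F b else 0) = (F (N - a) :: K0)"
proof -
  have "a + b = N \<longleftrightarrow> b = N - a" "b + a = N \<longleftrightarrow> b = N - a" for b
    using assms by (auto simp: index_set_def)
  then show "(\<Sum>b\<in>idx. if a + b = N then F b else 0) = F (N - a)" "(\<Sum>b\<in>idx. if b + a = N then F b else 0) = F (N - a)"
    using assms by (simp_all add: index_set_def)
qed

lemma complement_mem: "a \<in> idx \<Longrightarrow> N - a \<in> idx"
  by (simp add: index_set_def)

lemma fusion_eq: "fusion X n a c = (if a + c = N then weight_fun X n (lab a) else 0)"
  by (simp add: fusion_def weight_fun_label[OF rank])

lemma fusion_square:
  assumes "a \<in> idx" "c \<in> idx"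
  shows "(\<Sum>b\<in>idx. fusion X n a b * fusion X n b c) = delta a c"
proof -
  have "(\<Sum>b\<in>idx. fusion X n a b * fusion X n b c) =
    (\<Sum>b\<in>idx. if a + b = N then zeta X (int n) (int a) * fusion X n b c else 0)"
    by (intro sum.cong) (auto simp: fusion_def)
  also have "\<dots> = zeta X (int n) (int a) * fusion X n (N - a) c"
    using assms by (simp add: sum_complement)
  also have "\<dots> = delta a c"
    using zeta_mult_complement[OF assms(1)] assms by (auto simp: fusion_def delta_def index_set_def)
  finally show ?thesis .
qed

lemma fusion_inv_eq: "fusion_inv X n = (\<lambda>a c. if a \<in> idx \<and> c \<in> idx then fusion X n a c else 0)"
  unfolding fusion_inv_def by (rule matrix_inverse_on_eq) (auto simp: fusion_square)

text \<open>Without complementarity the two descriptions agree term by term. With it, the sum over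
  \<open>e\<close> has only the term \<open>e = d\<close>, which \<open>beta_eq\<close> splits into
  the pair term and the diagonal term. The coefficient of the transposition is \<open>s\<close>, or
  1 at the self-complementary label.\<close>

lemma braiding_eq:
  assumes "a \<in> idx" "c \<in> idx" "b \<in> idx" "d \<in> idx"
  shows "braiding X n (a, c) (b, d) = R (lab a) (lab c) (lab b) (lab d)"
proof (cases "a + c = N")
  case False
  moreover have "lab a \<noteq> 0" if "a = c"
    using False that label_add_eq_0[of X n a c] by simp
  ultimately show ?thesis
    by (auto simp: R_def g_def delta_def Let_def gam_eq param_z_eq)
next
  case True
  have "(\<Sum>e = a + 1..N. beta X (int n) (int a) (int e) * delta (b, d) (N - e, e)) =
    (\<Sum>e = a + 1..N. if e = d then if b + d = N then beta X (int n) (int a) (int d) else 0 else 0)"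
    using assms by (intro sum.cong refl) (auto simp: delta_def index_set_def)
  also have "\<dots> = (if a < d \<and> b + d = N then beta X (int n) (int a) (int d) else 0)"
    using assms by (simp add: index_set_def)
  finally have sum: "(\<Sum>e = a + 1..N. beta X (int n) (int a) (int e) * delta (b, d) (N - e, e)) =
    (if a < d \<and> b + d = N then beta X (int n) (int a) (int d) else 0)" .
  have beta: "beta X (int n) (int a) (int d) =
    param_z X * weight_fun X n (lab a) * weight_fun X n (lab b) - (if d = c then param_z X else 0)"
    if "a < d" "b + d = N"
  proof -
    have b: "int N - int d = int b" and c: "a + d = N \<longleftrightarrow> d = c"
      using that True by linarith+
    have "d \<le> N"
      using that by simp
    from beta_eq[OF rank \<open>a < d\<close> this, unfolded b c] show ?thesis
      by (simp add: weight_fun_label[OF rank])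
  qed
  have zero: "lab x = 0 \<longleftrightarrow> x + x = N" for x
    by (auto simp: label_def)
  have g: "g (lab a) (lab c) = (if a = c then 1 else root_q X)"
    using True by (auto simp: g_def label_def)
  have "braiding X n (a, c) (b, d) = (if a = c then 1 else root_q X) * delta (b, d) (c, a)
    + (if a < d \<and> b + d = N then beta X (int n) (int a) (int d) else 0)"
    using True sum by (simp add: Let_def gam_eq del: sum.delta)
  also have "\<dots> = R (lab a) (lab c) (lab b) (lab d)"
  proof (cases "a < d \<and> b + d = N")
    case less: True
    then have "b = a \<longleftrightarrow> d = c"
      using True by linarith
    then show ?thesis
      using less True beta g by (cases "a = c"; cases "d = c"; cases "d = a") (simp_all add: R_def delta_def zero)
  next
    case False
    then have no: "\<not> (a < c \<and> b = a \<and> d = c)" "\<not> (a + c = N \<and> b + d = N \<and> a < d)"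
      using True by auto
    then have R: "R (lab a) (lab c) (lab b) (lab d) = (if b = c \<and> d = a then g (lab a) (lab c) else 0)"
      unfolding R_def label_add_eq_0 label_eq_iff label_less_iff by (simp only: no if_False) simp
    show ?thesis
      unfolding R g by (simp only: False if_False) (simp add: delta_def)
  qed
  finally show ?thesis .
qed

lemma R_Rinv_label:
  assumes "a \<in> idx" "b \<in> idx" "p \<in> idx" "q \<in> idx"
  shows "(\<Sum>i\<in>idx. \<Sum>j\<in>idx. R (lab a) (lab b) (lab i) (lab j) * Rinv (lab i) (lab j) (lab p) (lab q)) = delta a p * delta b q"
    and "(\<Sum>i\<in>idx. \<Sum>j\<in>idx. Rinv (lab a) (lab b) (lab i) (lab j) * R (lab i) (lab j) (lab p) (lab q)) = delta a p * delta b q"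
  using R_Rinv[of "lab a" "lab b" "lab p" "lab q"] Rinv_R[of "lab a" "lab b" "lab p" "lab q"] assms
  by (auto simp: sum_label delta_def)

lemma braiding_inv_eq:
  "braiding_inv X n = (\<lambda>(a, c) (b, d). if a \<in> idx \<and> c \<in> idx \<and> b \<in> idx \<and> d \<in> idx then Rinv (lab a) (lab c) (lab b) (lab d) else 0)"
  unfolding braiding_inv_def
proof (rule matrix_inverse_on_eq)
  fix i j
  assume "i \<in> idx \<times> idx" "j \<in> idx \<times> idx"
  then obtain a c b d where ij: "i = (a, c)" "j = (b, d)" and mem: "a \<in> idx" "c \<in> idx" "b \<in> idx" "d \<in> idx"
    by auto
  have delta: "delta a b * delta c d = (delta (a, c) (b, d) :: K0)"
    by (simp add: delta_def)
  show "(\<Sum>k\<in>idx \<times> idx. braiding X n i k * (\<lambda>(a, c) (b, d). if a \<in> idx \<and> c \<in> idx \<and> b \<in> idx \<and> d \<in> idx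
      then Rinv (lab a) (lab c) (lab b) (lab d) else 0) k j) = delta i j"
    "(\<Sum>k\<in>idx \<times> idx. (\<lambda>(a, c) (b, d). if a \<in> idx \<and> c \<in> idx \<and> b \<in> idx \<and> d \<in> idx
      then Rinv (lab a) (lab c) (lab b) (lab d) else 0) i k * braiding X n k j) = delta i j"
    using R_Rinv_label[OF mem] mem unfolding ij delta
    by (simp_all add: sum.cartesian_product' braiding_eq del: braiding.simps)
qed (auto split: if_splits)

lemma crossing_weight_eq:
  assumes "a \<in> idx" "b \<in> idx" "p \<in> idx" "q \<in> idx"
  shows "crossing_weight X n CrossB a b p q = R (lab a) (lab b) (lab p) (lab q)"
    and "crossing_weight X n CrossBinv a b p q = Rinv (lab a) (lab b) (lab p) (lab q)"
  using assms by (simp_all add: crossing_weight_def braiding_eq braiding_inv_eq del: braiding.simps)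

interpretation skein_weights X n "param_z X" "param_\<alpha> X n"
proof
  fix a c
  assume "a \<in> idx" "c \<in> idx"
  then show "(\<Sum>b\<in>idx. fusion X n a b * fusion_inv X n b c) = delta a c"
    "(\<Sum>b\<in>idx. fusion_inv X n a b * fusion X n b c) = delta a c"
    by (simp_all add: fusion_inv_eq fusion_square)
next
  fix x a b c d
  assume x: "is_crossing x" and "{a, b, c, d} \<subseteq> idx"
  then have mem: "a \<in> idx" "b \<in> idx" "c \<in> idx" "d \<in> idx"
    by auto
  have "(\<Sum>p\<in>idx. crossing_weight X n x b c p d * fusion X n a p) =
    (\<Sum>p\<in>idx. if a + p = N then crossing_weight X n x b c p d * weight_fun X n (lab a) else 0)"
    by (intro sum.cong) (auto simp: fusion_eq)
  also have "\<dots> = crossing_weight X n x b c (N - a) d * weight_fun X n (lab a)"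
    using mem by (simp add: sum_complement)
  also have "\<dots> = crossing_weight X n (opposite x) a b d (N - c) * weight_fun X n (lab (N - c))"
    using x slide_R[of "lab a" "lab b" "lab c" "lab d"] slide_Rinv[of "lab a" "lab b" "lab c" "lab d"] mem
    by (auto simp: crossing_weight_eq complement_mem label_complement mult.commute)
  also have "\<dots> = (\<Sum>p\<in>idx. if p + c = N then crossing_weight X n (opposite x) a b d p * weight_fun X n (lab p) else 0)"
    using mem by (simp add: sum_complement)
  also have "\<dots> = (\<Sum>p\<in>idx. crossing_weight X n (opposite x) a b d p * fusion X n p c)"
    by (intro sum.cong) (auto simp: fusion_eq)
  finally show "(\<Sum>p\<in>idx. crossing_weight X n x b c p d * fusion X n a p) =
    (\<Sum>p\<in>idx. crossing_weight X n (opposite x) a b d p * fusion X n p c)" .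
next
  fix x a e p q
  assume x: "is_crossing x" and "{a, e, p, q} \<subseteq> idx"
  then have mem: "a \<in> idx" "e \<in> idx" "p \<in> idx" "q \<in> idx"
    by auto
  have "(\<Sum>b\<in>idx. fusion_inv X n e b * crossing_weight X n x b a p q) =
    (\<Sum>b\<in>idx. if e + b = N then weight_fun X n (lab e) * crossing_weight X n x b a p q else 0)"
    using mem by (intro sum.cong) (auto simp: fusion_eq fusion_inv_eq)
  also have "\<dots> = weight_fun X n (lab e) * crossing_weight X n x (N - e) a p q"
    using mem by (simp add: sum_complement)
  \<comment> \<open>Both matrices are symmetric, so the slide past a creation follows from the slide
    past an annihilation.\<close>
  also have "\<dots> = weight_fun X n (lab (N - q)) * crossing_weight X n (opposite x) a (N - q) e p"
    using x slide_R[of "lab e" "lab p" "lab q" "lab a"] slide_Rinv[of "lab e" "lab p" "lab q" "lab a"] mem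
    by (auto simp: crossing_weight_eq complement_mem label_complement R_transpose[of "lab p"] Rinv_transpose[of "lab p"]
        R_transpose[of "lab e"] Rinv_transpose[of "lab e"])
  also have "\<dots> = (\<Sum>b\<in>idx. if b + q = N then weight_fun X n (lab b) * crossing_weight X n (opposite x) a b e p else 0)"
    using mem by (simp add: sum_complement)
  also have "\<dots> = (\<Sum>b\<in>idx. fusion_inv X n b q * crossing_weight X n (opposite x) a b e p)"
    using mem by (intro sum.cong) (auto simp: fusion_eq fusion_inv_eq)
  finally show "(\<Sum>b\<in>idx. fusion_inv X n e b * crossing_weight X n x b a p q) =
    (\<Sum>b\<in>idx. fusion_inv X n b q * crossing_weight X n (opposite x) a b e p)" .
next
  fix x a b p q
  assume "is_crossing x" "{a, b, p, q} \<subseteq> idx"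
  then show "(\<Sum>i\<in>idx. \<Sum>j\<in>idx. crossing_weight X n x a b i j * crossing_weight X n (opposite x) i j p q) = delta a p * delta b q"
    using R_Rinv_label by (auto simp: crossing_weight_eq)
next
  fix a b c p q r
  assume "{a, b, c, p, q, r} \<subseteq> idx"
  then show "(\<Sum>i\<in>idx. \<Sum>j\<in>idx. \<Sum>k\<in>idx.
        crossing_weight X n CrossB a b i j * (crossing_weight X n CrossB j c k r * crossing_weight X n CrossB i k p q)) =
      (\<Sum>i\<in>idx. \<Sum>j\<in>idx. \<Sum>k\<in>idx.
        crossing_weight X n CrossB b c i j * (crossing_weight X n CrossB a i p k * crossing_weight X n CrossB k j q r))"
    using yang_baxter[of "lab a" "lab b" "lab c" "lab p" "lab q" "lab r"]
    by (simp add: crossing_weight_eq YB_left_def YB_right_def sum_label sum_distrib_left)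
next
  fix a b p q
  assume "{a, b, p, q} \<subseteq> idx"
  then show "crossing_weight X n CrossB a b p q - crossing_weight X n CrossBinv a b p q =
      param_z X * (fusion X n a b * fusion_inv X n p q - delta a p * delta b q)"
    by (auto simp: crossing_weight_eq Rinv_def fusion_inv_eq fusion_eq delta_def)
next
  fix a b
  assume "{a, b} \<subseteq> idx"
  then show "(\<Sum>i\<in>idx. \<Sum>j\<in>idx. crossing_weight X n CrossB a b i j * fusion X n i j) = param_\<alpha> X n * fusion X n a b"
    "(\<Sum>i\<in>idx. \<Sum>j\<in>idx. crossing_weight X n CrossBinv a b i j * fusion X n i j) = inverse (param_\<alpha> X n) * fusion X n a b"
    using R_curl[of "lab a" "lab b"] Rinv_curl[of "lab a" "lab b"]
    by (simp_all add: crossing_weight_eq fusion_eq sum_label)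
next
  have "(\<Sum>a\<in>idx. \<Sum>b\<in>idx. fusion_inv X n a b * fusion X n a b) = (\<Sum>a\<in>idx. \<Sum>b\<in>idx. if a + b = N then weight_fun X n (lab a) ^ 2 else 0)"
    by (intro sum.cong refl) (auto simp: fusion_eq fusion_inv_eq power2_eq_square)
  also have "\<dots> = (\<Sum>a\<in>idx. weight_fun X n (lab a) ^ 2)"
    by (intro sum.cong refl sum_complement)
  also have "\<dots> = (param_\<alpha> X n - inverse (param_\<alpha> X n)) / param_z X + 1"
    using sum_zeta param_z_nonzero[of X] by (simp add: sum_label field_simps)
  finally show "(\<Sum>a\<in>idx. \<Sum>b\<in>idx. fusion_inv X n a b * fusion X n a b) =
    (param_\<alpha> X n - inverse (param_\<alpha> X n)) / param_z X + 1" .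
qed

lemma kauffman_invariant_restrict_state_sum:
  "kauffman_invariant (param_z X) (param_\<alpha> X n) (restrict (state_sum X n) {K. link_diagram K})"
  by (rule kauffman_invariant_state_sum)

end

theorem mainTheorem1:
  fixes X :: lie_type and n :: nat
  assumes "rank_ok X n"
  shows "(\<exists>!D. D \<in> extensional {K. link_diagram K} \<and>
               kauffman_invariant (param_z X) (param_\<alpha> X n) D) \<and>
         (\<forall>K. link_diagram K \<longrightarrow>
               state_sum X n K = kauffman_polynomial (param_z X) (param_\<alpha> X n) K)"
proof -
  let ?D = "restrict (state_sum X n) {K. link_diagram K}"
  have D: "?D \<in> extensional {K. link_diagram K} \<and> kauffman_invariant (param_z X) (param_\<alpha> X n) ?D"
    using kauffman_invariant_restrict_state_sum[OF assms] by simp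
  \<comment> \<open>Two Kauffman invariants agree on link diagrams; extensionality fixes the values
    on all other lists.\<close>
  have unique: "D = ?D"
    if "D \<in> extensional {K. link_diagram K} \<and> kauffman_invariant (param_z X) (param_\<alpha> X n) D" for D
  proof (rule extensionalityI)
    show "D K = ?D K" if "K \<in> {K. link_diagram K}" for K
      using that \<open>D \<in> _ \<and> _\<close> D kauffman_invariant_unique[OF param_z_nonzero, of X "param_\<alpha> X n" D ?D K] by blast
  qed (use that in auto)
  have "kauffman_polynomial (param_z X) (param_\<alpha> X n) = ?D"
    unfolding kauffman_polynomial_def using D unique by (rule the_equality)
  with D unique show ?thesis
    by auto
qed

end
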